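(* Let $-\infty\le a<b\le\infty$, let $1 \leq p < \infty$, $0 < q, r < \infty$ and let $u, v, w$ be weights on $(a,b)$. Let $\{x_k\}_{k=N}^{\infty}$ be a discretizing sequence of $W^*$. Consider the inequality $$\bigg(\int_a^b \bigg(\int_a^x \bigg(\int_a^t f(s)\,ds \bigg)^q u(t)\, dt \bigg)^{\frac{r}{q}} w(x)\, dx \bigg)^{\frac{1}{r}} \leq C \bigg(\int_a^b f(x)^p v(x)\, dx \bigg)^{\frac{1}{p}}. \qquad ( * )$$ Define, when the exponents are in the ranges in which they are used below, $$\mathcal{A}_1 :=\sup_{N+1\leq k <\infty} 2^{-\frac{k}{r}} \operatorname*{ess\,sup}_{t \in (x_{k-1}, x_{k})} \bigg(\int_t^{x_{k}} u \bigg)^{\frac{1}{q}} V_p(x_{k-1}, t),$$ $$\mathcal{A}_2 :=\bigg(\sum_{k=N+1}^{\infty} 2^{-k\frac{p}{p-r}} \operatorname*{ess\,sup}_{t \in (x_{k-1}, x_{k})} \bigg(\int_t^{x_{k}} u\bigg)^{\frac{pr}{q(p-r)}} V_p(x_{k-1}, t)^{\frac{pr}{p-r}} \bigg)^{\frac{p-r}{pr}},$$ $$\mathcal{A}_3 :=\sup_{N+1 \leq k <\infty} 2^{-\frac{k}{r}} \bigg(\int_{x_{k-1}}^{x_{k}} \bigg(\int_t^{x_{k}} u \bigg)^{\frac{q}{p-q}} u(t) V_p(x_{k-1}, t)^{\frac{pq}{p-q}} dt \bigg)^{\frac{p-q}{pq}},$$ $$\mathcal{A}_4 :=\bigg( \sum_{k=N+1}^{\infty}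 2^{-k\frac{p}{p-r}} \bigg( \int_{x_{k-1}}^{x_{k}} \bigg(\int_{t}^{x_{k}} u \bigg)^{\frac{q}{p-q}} u(t) V_p(x_{k-1}, t)^{\frac{pq}{p-q}} dt \bigg)^{\frac{r(p-q)}{q(p-r)}} \bigg)^{\frac{p-r}{pr}},$$ $$\mathcal{B}_1 := \sup_{N+1 \leq k <\infty} \bigg(\sum_{i=k}^{\infty} 2^{-i} \bigg(\int_{x_i}^{x_{i+1}} u \bigg)^{\frac{r}{q}} \bigg)^{\frac{1}{r}} V_p(a, x_k),$$ $$\mathcal{B}_2 := \bigg( \sum_{k=N+1}^{\infty} 2^{-k} \bigg(\int_{x_k}^{x_{k+1}} u \bigg)^{\frac{r}{q}} \bigg(\sum_{i=k }^{\infty} 2^{-i} \bigg(\int_{x_i}^{x_{i+1}} u \bigg)^{\frac{r}{q}} \bigg)^{\frac{r}{p-r}} V_p(a, x_k)^{\frac{pr}{p-r}} \bigg)^{\frac{p-r}{pr}}.$$ Then there is a constant $C\in(0,\infty)$ such that $( * )$ holds for all $f \in \mathfrak{M}^+(a,b)$ if and only if the following holds: (i) in the case $p \le r$, $p\leq q$: $\mathcal{A}_1 + \mathcal{B}_1 <\infty$; (ii) in the case $r < p\leq q$: $\mathcal{A}_2 + \mathcal{B}_2<\infty$; (iii) in the case $q< p \le r$: $\mathcal{A}_3 + \mathcal{B}_1<\infty$; (iv) in the case $r < p$, $q < p$: $\mathcal{A}_4 +\mathcal{B}_2 <\infty$. Moreover, the best constant $C$ in $( * )$ satisfies $C\approx\mathcal{A}_1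 +\mathcal{B}_1$ in case (i), $C\approx\mathcal{A}_2 +\mathcal{B}_2$ in case (ii), $C\approx\mathcal{A}_3+\mathcal{B}_1$ in case (iii), and $C\approx\mathcal{A}_4 +\mathcal{B}_2$ in case (iv).
   Context: $\mathfrak{M}^+(a,b)$ is the set of all non-negative measurable functions on $(a,b)$. A weight on $(a,b)$ is a positive measurable function on $(a,b)$ (values in $(0,\infty)$). Conventions: $0\cdot\infty=\infty/\infty=0/0=0$. $A\lesssim B$ means $A\le cB$ with a constant $c>0$ depending only on $p,q,r$; $A\approx B$ means $A\lesssim B$ and $B\lesssim A$. For $x,y\in[a,b]$, $$V_p(x,y):=\bigg(\int_x^y v^{-\frac{1}{p-1}}\bigg)^{\frac{p-1}{p}}\ \text{ if } 1<p<\infty,\qquad V_1(x,y):=\operatorname*{ess\,sup}_{s\in(x,y)} v(s)^{-1}\ \text{ if } p=1.$$ $W^*(t)=\int_t^b w(s)\,ds$ for $t\in[a,b]$. Let $N\in\mathbb{Z}\cup\{-\infty\}$. A strictly increasing sequence $\{x_k\}_{k=N}^{\infty}\subset[a,b]$ is a discretizing sequence of $W^*$ if $W^*(x_k)\approx 2^{-k}$ for all $N\le k<\infty$ (with constants uniform in $k$); if $N>-\infty$ then $x_N:=a$, otherwise (indices $k$ run over $\mathbb{Z}$) $x_{-\infty}:=\lim_{k\to-\infty}x_k=a$. If $N=-\infty$, then $N+1$ is also $-\infty$, and sums and suprema over $N+1\le k<\infty$ are over all $k\in\mathbb{Z}$. *)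

theory Defs
  imports "HOL-Analysis.Analysis" "HOL-Probability.Essential_Supremum"
begin

text \<open>Endpoints of intervals are extended reals, and the open interval from \<open>c\<close> to \<open>d\<close> is
  \<^term>\<open>einterval c d\<close>, a set of reals. All integrals and suprema of non-negative
  functions are taken in \<^typ>\<open>ennreal\<close>, where \<open>0 * \<infinity> = 0\<close>.\<close>

text \<open>Real powers on the extended half-line. Only positive exponents \<open>s\<close> are intended, for which
  \<open>0\<close> and \<open>\<infinity>\<close> are fixed; the value \<open>\<infinity>\<close> at \<open>\<infinity>\<close> is not meaningful for \<open>s \<le> 0\<close>.\<close>

definition enn_powr :: "ennreal \<Rightarrow> real \<Rightarrow> ennreal" (infixr "epowr" 80) where
  "x epowr s = (if x = \<infinity> then \<infinity> else ennreal (enn2real x powr s))"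

definition integ :: "ereal \<Rightarrow> ereal \<Rightarrow> (real \<Rightarrow> ennreal) \<Rightarrow> ennreal" where
  "integ c d g = (\<integral>\<^sup>+ t. g t \<partial>lebesgue_on (einterval c d))"

definition ess_sup :: "ereal \<Rightarrow> ereal \<Rightarrow> (real \<Rightarrow> ennreal) \<Rightarrow> ennreal" where
  "ess_sup c d g = esssup (lebesgue_on (einterval c d)) g"

definition Mplus :: "ereal \<Rightarrow> ereal \<Rightarrow> (real \<Rightarrow> ennreal) set" where
  "Mplus a b = borel_measurable (lebesgue_on (einterval a b))"

definition weight :: "ereal \<Rightarrow> ereal \<Rightarrow> (real \<Rightarrow> real) \<Rightarrow> bool" where
  "weight a b v \<longleftrightarrow>
     v \<in> borel_measurable (lebesgue_on (einterval a b)) \<and> (\<forall>t\<in>einterval a b. 0 < v t)"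

definition V :: "real \<Rightarrow> (real \<Rightarrow> real) \<Rightarrow> ereal \<Rightarrow> ereal \<Rightarrow> ennreal" where
  "V p v x y =
     (if p = 1 then ess_sup x y (\<lambda>s. ennreal (inverse (v s)))
      else integ x y (\<lambda>s. ennreal (v s powr (- 1 / (p - 1)))) epowr ((p - 1) / p))"

definition Wstar :: "ereal \<Rightarrow> (real \<Rightarrow> real) \<Rightarrow> ereal \<Rightarrow> ennreal" where
  "Wstar b w t = integ t b (\<lambda>s. ennreal (w s))"

text \<open>The lower index bound \<open>N \<in> \<int> \<union> {-\<infinity>}\<close> is an \<^typ>\<open>int option\<close>, with \<^term>\<open>None\<close>
  standing for \<open>-\<infinity>\<close>. The two sets below are \<open>{k. N \<le> k}\<close> and \<open>{k. N + 1 \<le> k}\<close>; values \<open>x k\<close>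
  with \<open>k\<close> outside the first set are irrelevant.\<close>

definition indices :: "int option \<Rightarrow> int set" where
  "indices N = (case N of None \<Rightarrow> UNIV | Some n \<Rightarrow> {n..})"

definition indices1 :: "int option \<Rightarrow> int set" where
  "indices1 N = (case N of None \<Rightarrow> UNIV | Some n \<Rightarrow> {n + 1..})"

text \<open>The constant \<open>c\<close> witnesses the equivalence of \<open>W\<^sup>*(x k)\<close> and \<open>2 powr (-k)\<close>,
  uniformly in \<open>k\<close>.\<close>

definition discretizing ::
  "real \<Rightarrow> ereal \<Rightarrow> ereal \<Rightarrow> (real \<Rightarrow> real) \<Rightarrow> int option \<Rightarrow> (int \<Rightarrow> ereal) \<Rightarrow> bool" where
  "discretizing c a b w N x \<longleftrightarrow>
     (\<forall>k\<in>indices N. a \<le> x k \<and> x k \<le> b) \<and>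
     strict_mono_on (indices N) x \<and>
     (\<forall>k\<in>indices N. ennreal (inverse c * 2 powr - real_of_int k) \<le> Wstar b w (x k) \<and>
        Wstar b w (x k) \<le> ennreal (c * 2 powr - real_of_int k)) \<and>
     (case N of None \<Rightarrow> (x \<longlongrightarrow> a) at_bot | Some n \<Rightarrow> x n = a)"

definition hardy_lhs ::
  "real \<Rightarrow> real \<Rightarrow> ereal \<Rightarrow> ereal \<Rightarrow> (real \<Rightarrow> real) \<Rightarrow> (real \<Rightarrow> real) \<Rightarrow> (real \<Rightarrow> ennreal) \<Rightarrow> ennreal" where
  "hardy_lhs q r a b u w f =
     integ a b (\<lambda>x.
       integ a (ereal x) (\<lambda>t. integ a (ereal t) f epowr q * ennreal (u t)) epowr (r / q)
       * ennreal (w x)) epowr (1 / r)"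

definition hardy_rhs ::
  "real \<Rightarrow> ereal \<Rightarrow> ereal \<Rightarrow> (real \<Rightarrow> real) \<Rightarrow> (real \<Rightarrow> ennreal) \<Rightarrow> ennreal" where
  "hardy_rhs p a b v f = integ a b (\<lambda>x. f x epowr p * ennreal (v x)) epowr (1 / p)"

definition hardy_ineq ::
  "real \<Rightarrow> real \<Rightarrow> real \<Rightarrow> ereal \<Rightarrow> ereal \<Rightarrow> (real \<Rightarrow> real) \<Rightarrow> (real \<Rightarrow> real) \<Rightarrow> (real \<Rightarrow> real)
   \<Rightarrow> real \<Rightarrow> bool" where
  "hardy_ineq p q r a b u v w C \<longleftrightarrow>
     (\<forall>f\<in>Mplus a b. hardy_lhs q r a b u w f \<le> ennreal C * hardy_rhs p a b v f)"

text \<open>The best constant is \<open>\<infinity>\<close> if the inequality holds with no finite constant.\<close>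

definition best_const ::
  "real \<Rightarrow> real \<Rightarrow> real \<Rightarrow> ereal \<Rightarrow> ereal \<Rightarrow> (real \<Rightarrow> real) \<Rightarrow> (real \<Rightarrow> real) \<Rightarrow> (real \<Rightarrow> real)
   \<Rightarrow> ennreal" where
  "best_const p q r a b u v w = Inf {ennreal C | C. 0 < C \<and> hardy_ineq p q r a b u v w C}"

definition A1 :: "real \<Rightarrow> real \<Rightarrow> real \<Rightarrow> (real \<Rightarrow> real) \<Rightarrow> (real \<Rightarrow> real) \<Rightarrow> int option
    \<Rightarrow> (int \<Rightarrow> ereal) \<Rightarrow> ennreal" where
  "A1 p q r u v N x =
     (SUP k\<in>indices1 N. ennreal (2 powr (- real_of_int k / r)) *
        ess_sup (x (k - 1)) (x k) (\<lambda>t.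
          integ (ereal t) (x k) (\<lambda>s. ennreal (u s)) epowr (1 / q) * V p v (x (k - 1)) (ereal t)))"

definition A2 :: "real \<Rightarrow> real \<Rightarrow> real \<Rightarrow> (real \<Rightarrow> real) \<Rightarrow> (real \<Rightarrow> real) \<Rightarrow> int option
    \<Rightarrow> (int \<Rightarrow> ereal) \<Rightarrow> ennreal" where
  "A2 p q r u v N x =
     (\<Sum>\<^sub>\<infinity>k\<in>indices1 N. ennreal (2 powr (- real_of_int k * (p / (p - r)))) *
        ess_sup (x (k - 1)) (x k) (\<lambda>t.
          integ (ereal t) (x k) (\<lambda>s. ennreal (u s)) epowr (p * r / (q * (p - r)))
          * V p v (x (k - 1)) (ereal t) epowr (p * r / (p - r)))) epowr ((p - r) / (p * r))"

definition A3 :: "real \<Rightarrow> real \<Rightarrow> real \<Rightarrow> (real \<Rightarrow> real) \<Rightarrow> (real \<Rightarrow> real) \<Rightarrow> int option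
    \<Rightarrow> (int \<Rightarrow> ereal) \<Rightarrow> ennreal" where
  "A3 p q r u v N x =
     (SUP k\<in>indices1 N. ennreal (2 powr (- real_of_int k / r)) *
        integ (x (k - 1)) (x k) (\<lambda>t.
          integ (ereal t) (x k) (\<lambda>s. ennreal (u s)) epowr (q / (p - q)) * ennreal (u t)
          * V p v (x (k - 1)) (ereal t) epowr (p * q / (p - q))) epowr ((p - q) / (p * q)))"

definition A4 :: "real \<Rightarrow> real \<Rightarrow> real \<Rightarrow> (real \<Rightarrow> real) \<Rightarrow> (real \<Rightarrow> real) \<Rightarrow> int option
    \<Rightarrow> (int \<Rightarrow> ereal) \<Rightarrow> ennreal" where
  "A4 p q r u v N x =
     (\<Sum>\<^sub>\<infinity>k\<in>indices1 N. ennreal (2 powr (- real_of_int k * (p / (p - r)))) *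
        integ (x (k - 1)) (x k) (\<lambda>t.
          integ (ereal t) (x k) (\<lambda>s. ennreal (u s)) epowr (q / (p - q)) * ennreal (u t)
          * V p v (x (k - 1)) (ereal t) epowr (p * q / (p - q)))
        epowr (r * (p - q) / (q * (p - r)))) epowr ((p - r) / (p * r))"

definition tail_sum :: "real \<Rightarrow> real \<Rightarrow> (real \<Rightarrow> real) \<Rightarrow> (int \<Rightarrow> ereal) \<Rightarrow> int \<Rightarrow> ennreal" where
  "tail_sum q r u x k =
     (\<Sum>\<^sub>\<infinity>i\<in>{k..}. ennreal (2 powr - real_of_int i) *
        integ (x i) (x (i + 1)) (\<lambda>s. ennreal (u s)) epowr (r / q))"

definition B1 :: "real \<Rightarrow> real \<Rightarrow> real \<Rightarrow> ereal \<Rightarrow> (real \<Rightarrow> real) \<Rightarrow> (real \<Rightarrow> real) \<Rightarrow> int option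
    \<Rightarrow> (int \<Rightarrow> ereal) \<Rightarrow> ennreal" where
  "B1 p q r a u v N x =
     (SUP k\<in>indices1 N. tail_sum q r u x k epowr (1 / r) * V p v a (x k))"

definition B2 :: "real \<Rightarrow> real \<Rightarrow> real \<Rightarrow> ereal \<Rightarrow> (real \<Rightarrow> real) \<Rightarrow> (real \<Rightarrow> real) \<Rightarrow> int option
    \<Rightarrow> (int \<Rightarrow> ereal) \<Rightarrow> ennreal" where
  "B2 p q r a u v N x =
     (\<Sum>\<^sub>\<infinity>k\<in>indices1 N. ennreal (2 powr - real_of_int k) *
        integ (x k) (x (k + 1)) (\<lambda>s. ennreal (u s)) epowr (r / q) *
        tail_sum q r u x k epowr (r / (p - r)) *
        V p v a (x k) epowr (p * r / (p - r))) epowr ((p - r) / (p * r))"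

end

theory Submission
  imports Defs
begin

text \<open>Since \<open>W\<^sup>*(x k)\<close> is comparable to \<open>2 powr (-k)\<close>, the left-hand side is comparable to the sum of
  \<open>2 powr (-k)\<close> times the \<open>r/q\<close>-th power of the inner integral up to \<open>x k\<close>, and geometric
  weights allow one to keep only the part of the inner integral over the \<open>k\<close>-th cell. Splitting the
  primitive of \<open>f\<close> at the left end of the cell leaves two families of ordinary Hardy inequalities:
  local ones on each cell with respect to \<open>u\<close>, and a global one for the purely atomic measure
  with masses \<open>2 powr (-k)\<close> times \<open>(\<integral> u)\<close> to the power \<open>r/q\<close> at the points \<open>x k\<close>. Both are
  instances of a single Hardy inequality for an arbitrary Borel measure, which is proved by cutting the
  interval along the dyadic levels of the function \<open>V\<close>: there the operator is dominated by a
  geometric convolution, bounded on every \<open>\<ell>\<^sup>s\<close>, and the problem becomes diagonal. Diagonal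
  operators from \<open>\<ell>\<^sup>p\<close> to \<open>\<ell>\<^sup>r\<close> also govern the passage from the local constants to
  \<open>A1\<close>, ..., \<open>A4\<close>.\<close>

section \<open>Powers and sums in the extended half-line\<close>

text \<open>The obstacle is that neither finiteness nor continuity is available. \<open>V\<close>
  may equal \<infinity>, for p = 1 it may jump, the measure may have atoms and infinite mass, and
  the ends of a level need not belong to it. So the cuts are level sets rather than points where
  \<open>V\<close> is a given power of 2; bounds up to the end of a set are obtained by exhausting
  it with segments that end in the set; and integration by parts is replaced by a median argument. A
  finite functional first forces \<open>V\<close> to be finite almost everywhere; only then do the
  levels fill the interval up to a null set. For the lower bounds, near-optimal functions for
  infinitely many levels or cells are merged into one by a weighted supremum. Choosing them with a
  loss of a factor 2 requires finite quantities, and finiteness comes from testing single levels or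
  cells beforehand.\<close>

lemma epowr_ennreal [simp]: "0 \<le> x \<Longrightarrow> ennreal x epowr s = ennreal (x powr s)"
  by (simp add: enn_powr_def)

lemma epowr_top [simp]: "top epowr s = top"
  by (simp add: enn_powr_def)

lemma epowr_zero [simp]: "0 epowr s = 0"
  by (simp add: enn_powr_def)

lemma epowr_one [simp]: "1 epowr s = 1"
  by (simp add: enn_powr_def)

lemma epowr_1 [simp]: "x epowr 1 = x"
  by (cases x) auto

lemma epowr_eq_0_iff [simp]: "x epowr s = 0 \<longleftrightarrow> x = 0"
  by (cases x) (auto simp: ennreal_eq_0_iff)

lemma epowr_eq_top_iff [simp]: "x epowr s = top \<longleftrightarrow> x = top"
  by (cases x) auto

lemma epowr_less_top_iff [simp]: "x epowr s < top \<longleftrightarrow> x < top"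
  by (cases x) auto

lemma epowr_mono: "x \<le> y \<Longrightarrow> 0 \<le> s \<Longrightarrow> x epowr s \<le> y epowr s"
  by (cases x; cases y) (auto simp: ennreal_le_iff powr_mono2 top_unique)

lemma epowr_strict_mono: "x < y \<Longrightarrow> 0 < s \<Longrightarrow> x epowr s < y epowr s"
  by (cases x; cases y) (auto simp: ennreal_less_iff powr_less_mono2)

lemma epowr_le_iff [simp]: "0 < s \<Longrightarrow> x epowr s \<le> y epowr s \<longleftrightarrow> x \<le> y"
  by (meson epowr_mono epowr_strict_mono less_imp_le not_le)

lemma epowr_mult: "(x * y) epowr s = x epowr s * y epowr s"
proof (cases "x = 0 \<or> y = 0")
  case False
  then show ?thesis
    by (cases x; cases y)
       (auto simp: ennreal_mult[symmetric] powr_mult ennreal_mult_top ennreal_top_mult)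
qed auto

lemma epowr_epowr: "(x epowr s) epowr t = x epowr (s * t)"
  by (cases x) (auto simp: powr_powr)

lemma epowr_add: "x epowr (s + t) = x epowr s * x epowr t"
  by (cases x) (auto simp: powr_add ennreal_mult[symmetric] ennreal_top_mult)

lemma epowr_inv_cancel [simp]: "s \<noteq> 0 \<Longrightarrow> (x epowr (1 / s)) epowr s = x"
  "s \<noteq> 0 \<Longrightarrow> (x epowr s) epowr (1 / s) = x"
  by (auto simp: epowr_epowr)

lemma epowr_le_iff_le_root: "0 < s \<Longrightarrow> x epowr s \<le> y \<longleftrightarrow> x \<le> y epowr (1 / s)"
  by (metis epowr_inv_cancel(1) epowr_le_iff less_irrefl)

text \<open>A positive power is an order automorphism of the half-line with inverse the power
  \<open>1 / s\<close>, so it commutes with every supremum, the empty one included.\<close>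

lemma epowr_SUP:
  assumes "0 < s"
  shows "(SUP i\<in>I. f i) epowr s = (SUP i\<in>I. f i epowr s)"
proof (rule antisym)
  show "(SUP i\<in>I. f i) epowr s \<le> (SUP i\<in>I. f i epowr s)"
    unfolding epowr_le_iff_le_root[OF assms]
    by (rule SUP_least, unfold epowr_le_iff_le_root[OF assms, symmetric]) (rule SUP_upper)
  show "(SUP i\<in>I. f i epowr s) \<le> (SUP i\<in>I. f i) epowr s"
    using assms by (auto intro!: SUP_least epowr_mono SUP_upper)
qed

text \<open>Bounding the sum by twice the maximum treats s < 1 and s > 1 alike.\<close>

lemma epowr_add_le: "0 < s \<Longrightarrow> (x + y) epowr s \<le> ennreal (2 powr s) * (x epowr s + y epowr s)"
proof -
  assume s: "0 < s"
  have "x + y \<le> 2 * max x y"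
    by (metis add_mono max.cobounded1 max.cobounded2 mult_2)
  then have "(x + y) epowr s \<le> (2 * max x y) epowr s"
    using s by (simp add: epowr_mono)
  also have "\<dots> = ennreal (2 powr s) * (max x y) epowr s"
    using epowr_ennreal[of 2 s] by (simp add: epowr_mult)
  also have "(max x y) epowr s \<le> x epowr s + y epowr s"
    by (simp add: max_def)
  finally show ?thesis by (simp add: mult_left_mono)
qed

lemma borel_measurable_epowr [measurable (raw)]:
  assumes [measurable]: "f \<in> borel_measurable M"
  shows "(\<lambda>x. f x epowr s) \<in> borel_measurable M"
  unfolding enn_powr_def by measurable

text \<open>As an integral over counting measure, a sum obeys Fubini, Hoelder and monotone
  convergence without questions of summability. All families are indexed by the integers; smaller
  index sets are imposed by indicators.\<close>

abbreviation isum :: "(int \<Rightarrow> ennreal) \<Rightarrow> ennreal" where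
  "isum f \<equiv> \<integral>\<^sup>+ i. f i \<partial>count_space UNIV"

lemma isum_eq_SUP: "isum f = (SUP n. \<Sum>i\<in>{- int n..int n}. f i)"
proof -
  have eq: "f i = (SUP n. f i * indicator {- int n..int n} i)" for i
  proof (rule antisym)
    have "f i = f i * indicator {- int (nat \<bar>i\<bar>)..int (nat \<bar>i\<bar>)} i"
    proof -
      have "i \<in> {- int (nat \<bar>i\<bar>)..int (nat \<bar>i\<bar>)}" by (simp; linarith)
      then show ?thesis by (simp only: indicator_simps mult_1_right)
    qed
    also have "\<dots> \<le> (SUP n. f i * indicator {- int n..int n} i)"
      by (rule SUP_upper) simp
    finally show "f i \<le> (SUP n. f i * indicator {- int n..int n} i)" .
    show "(SUP n. f i * indicator {- int n..int n} i) \<le> f i"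
      by (auto intro!: SUP_least split: split_indicator)
  qed
  have "isum f = isum (\<lambda>i. SUP n. f i * indicator {- int n..int n} i)"
    using eq by (intro nn_integral_cong) blast
  also have "\<dots> = (SUP n. isum (\<lambda>i. f i * indicator {- int n..int n} i))"
    by (rule nn_integral_monotone_convergence_SUP)
       (auto simp: incseq_def le_fun_def split: split_indicator)
  also have "\<dots> = (SUP n. \<Sum>i\<in>{- int n..int n}. f i)"
    by (simp add: nn_integral_count_space_indicator[symmetric] nn_integral_count_space_finite)
  finally show ?thesis .
qed

lemma sum_le_isum: "finite F \<Longrightarrow> sum f F \<le> isum f"
proof -
  assume "finite F"
  then have "sum f F = isum (\<lambda>i. f i * indicator F i)"
    by (simp add: nn_integral_count_space_indicator[symmetric] nn_integral_count_space_finite)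
  also have "\<dots> \<le> isum f"
    by (intro nn_integral_mono) (auto split: split_indicator)
  finally show ?thesis .
qed

lemma le_isum: "f i \<le> isum f"
  using sum_le_isum[of "{i}" f] by simp

lemma isum_least: "(\<And>F. finite F \<Longrightarrow> sum f F \<le> K) \<Longrightarrow> isum f \<le> K"
  unfolding isum_eq_SUP by (rule SUP_least) simp

text \<open>The functionals in the theorem use \<open>infsum\<close>; in \<open>ennreal\<close> both
  notions are the supremum of the finite partial sums.\<close>

lemma infsum_eq_isum: "infsum f A = isum (\<lambda>i. f i * indicator A i)"
proof (rule antisym)
  show "infsum f A \<le> isum (\<lambda>i. f i * indicator A i)"
    unfolding nonneg_infsum_complete[of A f, OF zero_le]
  proof (rule SUP_least)
    fix F assume F: "F \<in> {F. finite F \<and> F \<subseteq> A}"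
    then have "sum f F = sum (\<lambda>i. f i * indicator A i) F"
      by (intro sum.cong) auto
    also have "\<dots> \<le> isum (\<lambda>i. f i * indicator A i)"
      using F by (intro sum_le_isum) simp
    finally show "sum f F \<le> isum (\<lambda>i. f i * indicator A i)" .
  qed
  show "isum (\<lambda>i. f i * indicator A i) \<le> infsum f A"
    unfolding nonneg_infsum_complete[of A f, OF zero_le]
  proof (rule isum_least)
    fix F :: "int set" assume F: "finite F"
    have "(\<Sum>i\<in>F. f i * indicator A i) = sum f (F \<inter> A)"
      using F by (simp add: sum.inter_restrict indicator_def if_distrib cong: if_cong)
    also have "\<dots> \<le> (SUP F\<in>{F. finite F \<and> F \<subseteq> A}. sum f F)"
      using F by (intro SUP_upper) auto
    finally show "(\<Sum>i\<in>F. f i * indicator A i) \<le> (SUP F\<in>{F. finite F \<and> F \<subseteq> A}. sum f F)" .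
  qed
qed

lemma isum_swap: "isum (\<lambda>i. isum (\<lambda>j. f i j)) = isum (\<lambda>j. isum (\<lambda>i. f i j))"
  by (rule nn_integral_count_space_nn_integral) auto

lemma isum_shift: "isum (\<lambda>i. f (i + k)) = isum f"
  by (rule nn_integral_bij_count_space[where g="\<lambda>i. i + k"])
     (auto simp: bij_betw_def inj_on_def intro: surjI[where g="\<lambda>i. i - k"])

lemma isum_cmult: "isum (\<lambda>i. c * f i) = c * isum f"
  by (rule nn_integral_cmult) simp

lemma isum_add: "isum (\<lambda>i. f i + g i) = isum f + isum g"
  by (rule nn_integral_add) auto

lemma isum_mono: "(\<And>i. f i \<le> g i) \<Longrightarrow> isum f \<le> isum g"
  by (rule nn_integral_mono) simp

section \<open>Discrete inequalities\<close>

text \<open>Young's inequality for \<open>F\<close> and \<open>G\<close> divided by their integrals.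
  With exponents \<theta> and 1 - \<theta> the same form serves the duality behind \<open>V\<close>
  and the diagonal operators.\<close>

lemma nn_integral_Hoelder:
  assumes [measurable]: "F \<in> borel_measurable M" "G \<in> borel_measurable M"
    and \<theta>: "0 < \<theta>" "\<theta> < 1"
  shows "(\<integral>\<^sup>+ x. F x epowr \<theta> * G x epowr (1 - \<theta>) \<partial>M) \<le>
    (\<integral>\<^sup>+ x. F x \<partial>M) epowr \<theta> * (\<integral>\<^sup>+ x. G x \<partial>M) epowr (1 - \<theta>)"
    (is "?L \<le> ?A epowr _ * ?B epowr _")
proof -
  consider "?A = 0" | "?B = 0" | "?A \<noteq> 0" "?B \<noteq> 0" "?A = top \<or> ?B = top"
    | "?A \<noteq> 0" "?B \<noteq> 0" "?A < top" "?B < top"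
    unfolding less_top[symmetric] by blast
  then show ?thesis
  proof cases
    case 1
    then have "AE x in M. F x = 0" by (simp add: nn_integral_0_iff_AE)
    then have "AE x in M. F x epowr \<theta> * G x epowr (1 - \<theta>) = 0" by eventually_elim simp
    then have "?L = 0" by (subst nn_integral_0_iff_AE) auto
    then show ?thesis by simp
  next
    case 2
    then have "AE x in M. G x = 0" by (simp add: nn_integral_0_iff_AE)
    then have "AE x in M. F x epowr \<theta> * G x epowr (1 - \<theta>) = 0" by eventually_elim simp
    then have "?L = 0" by (subst nn_integral_0_iff_AE) auto
    then show ?thesis by simp
  next
    case 3
    then show ?thesis by (auto simp: ennreal_top_mult ennreal_mult_top)
  next
    case 4
    obtain a where a: "?A = ennreal a" "0 < a"
      using 4 by (cases ?A) (auto simp: ennreal_eq_0_iff)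
    obtain b where b: "?B = ennreal b" "0 < b"
      using 4 by (cases ?B) (auto simp: ennreal_eq_0_iff)
    \<comment> \<open>The value of the right-hand side; multiplying Young's inequality by it undoes
      the normalisation.\<close>
    define k where "k = a powr \<theta> * b powr (1 - \<theta>)"
    have k: "0 < k" using a b by (simp add: k_def)
    have pt: "F x epowr \<theta> * G x epowr (1 - \<theta>) \<le>
        ennreal (k * \<theta> / a) * F x + ennreal (k * (1 - \<theta>) / b) * G x" for x
    proof (cases "F x = top \<or> G x = top")
      case True
      then show ?thesis using k a b \<theta> by (auto simp: ennreal_mult_top)
    next
      case False
      then obtain y z where y: "F x = ennreal y" "0 \<le> y" and z: "G x = ennreal z" "0 \<le> z"
        by (cases "F x"; cases "G x") auto
      have "(y / a) powr \<theta> * (z / b) powr (1 - \<theta>) \<le> \<theta> * (y / a) + (1 - \<theta>) * (z / b)"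
      proof (cases "y = 0 \<or> z = 0")
        case True
        then show ?thesis using y z a b \<theta> by auto
      next
        case False
        then show ?thesis
          using y z a b \<theta> by (intro Youngs_inequality_0) auto
      qed
      then have "k * ((y / a) powr \<theta> * (z / b) powr (1 - \<theta>)) \<le>
          k * (\<theta> * (y / a) + (1 - \<theta>) * (z / b))"
        using k by (intro mult_left_mono) auto
      moreover have "k * ((y / a) powr \<theta> * (z / b) powr (1 - \<theta>)) = y powr \<theta> * z powr (1 - \<theta>)"
        using a b y z by (simp add: k_def powr_divide)
      ultimately have "y powr \<theta> * z powr (1 - \<theta>) \<le> k * \<theta> / a * y + k * (1 - \<theta>) / b * z"
        by (simp add: algebra_simps)
      then show ?thesis
        using y z a b k \<theta>
        by (simp add: ennreal_mult[symmetric] ennreal_plus[symmetric] ennreal_leI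
            del: ennreal_plus)
    qed
    have "?L \<le> (\<integral>\<^sup>+ x. ennreal (k * \<theta> / a) * F x + ennreal (k * (1 - \<theta>) / b) * G x \<partial>M)"
      by (intro nn_integral_mono pt)
    also have "\<dots> = ennreal (k * \<theta> / a) * ennreal a + ennreal (k * (1 - \<theta>) / b) * ennreal b"
      using a b by (simp add: nn_integral_add nn_integral_cmult)
    also have "\<dots> = ennreal (k * \<theta> / a * a + k * (1 - \<theta>) / b * b)"
      using a b k \<theta> by (subst ennreal_plus) (auto simp: ennreal_mult[symmetric])
    also have "k * \<theta> / a * a + k * (1 - \<theta>) / b * b = k"
      using a b by (simp add: field_simps)
    also have "\<dots> = ?A epowr \<theta> * ?B epowr (1 - \<theta>)"
      using a b by (simp add: k_def ennreal_mult)
    finally show ?thesis .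
  qed
qed

section \<open>Geometric convolution on the integers\<close>

definition geo :: "real \<Rightarrow> ennreal" where
  "geo \<delta> = isum (\<lambda>i. ennreal (2 powr (- \<delta> * \<bar>real_of_int i\<bar>)))"

lemma geo_less_top: 
  assumes "0 < \<delta>"
  shows "geo \<delta> < top"
proof -
  define y where "y = 2 powr - \<delta>"
  have y: "0 < y" "y < 1" using assms by (auto simp: y_def powr_minus field_simps)
  have yp: "2 powr (- \<delta> * real n) = y ^ n" for n
    by (simp add: y_def powr_realpow[symmetric] powr_powr)
  have "(\<Sum>i\<in>{- int n..int n}. 2 powr (- \<delta> * \<bar>real_of_int i\<bar>)) \<le> 2 * (\<Sum>i\<le>n. y ^ i)" for n
  proof (induction n)
    case (Suc n)
    have "{- int (Suc n)..int (Suc n)} = insert (- int (Suc n)) (insert (int (Suc n)) {- int n..int n})"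
      by auto
    then have "(\<Sum>i\<in>{- int (Suc n)..int (Suc n)}. 2 powr (- \<delta> * \<bar>real_of_int i\<bar>)) =
      2 * y ^ Suc n + (\<Sum>i\<in>{- int n..int n}. 2 powr (- \<delta> * \<bar>real_of_int i\<bar>))"
      using yp[of "Suc n"] by (simp add: algebra_simps)
    then show ?case using Suc by simp
  qed simp
  moreover have "2 * (\<Sum>i\<le>n. y ^ i) \<le> 2 / (1 - y)" for n
    using y by (simp add: sum_gp_strict lessThan_Suc_atMost[symmetric] field_simps)
  ultimately have "(\<Sum>i\<in>{- int n..int n}. 2 powr (- \<delta> * \<bar>real_of_int i\<bar>)) \<le> 2 / (1 - y)" for n
    by (meson order_trans)
  then have "geo \<delta> \<le> ennreal (2 / (1 - y))"
    unfolding geo_def isum_eq_SUP by (intro SUP_least) (simp add: sum_ennreal ennreal_leI)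
  then show ?thesis by (simp add: order_le_less_trans)
qed

lemma geo_shift: "isum (\<lambda>i. ennreal (2 powr (- \<delta> * \<bar>real_of_int (k - i)\<bar>))) = geo \<delta>"
  using isum_shift[of "\<lambda>i. ennreal (2 powr (- \<delta> * \<bar>real_of_int (k - i)\<bar>))" k]
  by (simp add: geo_def)

lemma geo_shift': "isum (\<lambda>i. ennreal (2 powr (- \<delta> * \<bar>real_of_int (i - k)\<bar>))) = geo \<delta>"
  using geo_shift[of \<delta> k] by (simp add: abs_minus_commute)

text \<open>Half of the decay is kept in the supremum \<open>M\<close>, the other half is spent on
  summing the series. The s-th power of a supremum is at most the sum of the s-th powers, so one
  argument covers every s > 0, where Minkowski's inequality would reach only s \<ge> 1.\<close>

lemma isum_convolution:
  assumes \<delta>: "0 < \<delta>" and s: "0 < s"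
  shows "isum (\<lambda>k. isum (\<lambda>i. ennreal (2 powr (- \<delta> * \<bar>real_of_int (k - i)\<bar>)) * b i) epowr s)
    \<le> geo (\<delta> / 2) epowr s * geo (\<delta> * s / 2) * isum (\<lambda>i. b i epowr s)"
proof -
  let ?e = "\<lambda>k i. ennreal (2 powr (- (\<delta> / 2) * \<bar>real_of_int (k - i)\<bar>))"
  define M where "M = (\<lambda>k. SUP i. ?e k i * b i)"
  have split: "ennreal (2 powr (- \<delta> * \<bar>real_of_int (k - i)\<bar>)) = ?e k i * ?e k i" for k i
    by (simp add: ennreal_mult[symmetric] powr_add[symmetric])
  have "isum (\<lambda>i. ennreal (2 powr (- \<delta> * \<bar>real_of_int (k - i)\<bar>)) * b i) \<le> geo (\<delta> / 2) * M k" for k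
  proof -
    have "isum (\<lambda>i. ennreal (2 powr (- \<delta> * \<bar>real_of_int (k - i)\<bar>)) * b i) \<le> isum (\<lambda>i. M k * ?e k i)"
    proof (rule isum_mono)
      fix i
      have "?e k i * (?e k i * b i) \<le> ?e k i * M k"
        unfolding M_def by (intro mult_left_mono SUP_upper) auto
      then show "ennreal (2 powr (- \<delta> * \<bar>real_of_int (k - i)\<bar>)) * b i \<le> M k * ?e k i"
        unfolding split by (simp add: mult.assoc mult.commute[of "M k"])
    qed
    also have "\<dots> = geo (\<delta> / 2) * M k"
      unfolding isum_cmult geo_shift by (simp add: mult.commute)
    finally show ?thesis .
  qed
  then have "isum (\<lambda>i. ennreal (2 powr (- \<delta> * \<bar>real_of_int (k - i)\<bar>)) * b i) epowr s
      \<le> geo (\<delta> / 2) epowr s * M k epowr s" for k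
    using s by (simp add: epowr_mult[symmetric])
  moreover have "M k epowr s \<le> isum (\<lambda>i. ennreal (2 powr (- (\<delta> * s / 2) * \<bar>real_of_int (k - i)\<bar>)) * b i epowr s)" for k
    unfolding M_def epowr_SUP[OF s]
  proof (rule SUP_least)
    fix i
    have "(?e k i * b i) epowr s = ennreal (2 powr (- (\<delta> * s / 2) * \<bar>real_of_int (k - i)\<bar>)) * b i epowr s"
      by (simp add: epowr_mult powr_powr mult_ac)
    also have "\<dots> \<le> isum (\<lambda>i. ennreal (2 powr (- (\<delta> * s / 2) * \<bar>real_of_int (k - i)\<bar>)) * b i epowr s)"
      by (rule le_isum)
    finally show "(?e k i * b i) epowr s \<le> isum (\<lambda>i. ennreal (2 powr (- (\<delta> * s / 2) * \<bar>real_of_int (k - i)\<bar>)) * b i epowr s)" .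
  qed
  ultimately have "isum (\<lambda>i. ennreal (2 powr (- \<delta> * \<bar>real_of_int (k - i)\<bar>)) * b i) epowr s
      \<le> geo (\<delta> / 2) epowr s * isum (\<lambda>i. ennreal (2 powr (- (\<delta> * s / 2) * \<bar>real_of_int (k - i)\<bar>)) * b i epowr s)" for k
    by (meson order_trans mult_left_mono zero_le)
  then have "isum (\<lambda>k. isum (\<lambda>i. ennreal (2 powr (- \<delta> * \<bar>real_of_int (k - i)\<bar>)) * b i) epowr s)
      \<le> isum (\<lambda>k. geo (\<delta> / 2) epowr s * isum (\<lambda>i. ennreal (2 powr (- (\<delta> * s / 2) * \<bar>real_of_int (k - i)\<bar>)) * b i epowr s))"
    by (rule isum_mono)
  also have "\<dots> = geo (\<delta> / 2) epowr s * isum (\<lambda>i. isum (\<lambda>k. b i epowr s * ennreal (2 powr (- (\<delta> * s / 2) * \<bar>real_of_int (k - i)\<bar>))))"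
    by (subst isum_cmult, subst isum_swap) (simp add: mult.commute)
  also have "\<dots> = geo (\<delta> / 2) epowr s * geo (\<delta> * s / 2) * isum (\<lambda>i. b i epowr s)"
    unfolding isum_cmult geo_shift' by (simp add: nn_integral_multc mult_ac)
  finally show ?thesis .
qed

text \<open>In the three diagonal estimates, \<open>h\<close> or \<open>c\<close> is a sequence of
  energies, that is of p-th powers, and \<theta> is the target exponent divided by p. For \<theta>
  \<ge> 1 one factor of \<open>h k\<close> is kept and the remaining power is bounded by the
  total.\<close>

lemma diagonal_le_sup:
  assumes "\<And>k. \<alpha> k \<le> B" "1 \<le> \<theta>"
  shows "isum (\<lambda>k. \<alpha> k * h k epowr \<theta>) \<le> B * isum h epowr \<theta>"
proof -
  have "isum (\<lambda>k. \<alpha> k * h k epowr \<theta>) \<le> isum (\<lambda>k. (B * isum h epowr (\<theta> - 1)) * h k)"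
  proof (rule isum_mono)
    fix k
    have "h k epowr \<theta> = h k epowr (\<theta> - 1) * h k"
      using epowr_add[of "h k" "\<theta> - 1" 1] by simp
    also have "\<dots> \<le> isum h epowr (\<theta> - 1) * h k"
      using assms by (intro mult_right_mono epowr_mono le_isum) auto
    finally show "\<alpha> k * h k epowr \<theta> \<le> (B * isum h epowr (\<theta> - 1)) * h k"
      unfolding mult.assoc by (intro mult_mono assms) auto
  qed
  also have "\<dots> = B * isum h epowr \<theta>"
    unfolding isum_cmult using epowr_add[of "isum h" "\<theta> - 1" 1] by (simp add: mult.assoc)
  finally show ?thesis .
qed

lemma diagonal_le_sum:
  assumes "0 < \<theta>" "\<theta> < 1"
  shows "isum (\<lambda>k. \<alpha> k * h k epowr \<theta>)
    \<le> isum (\<lambda>k. \<alpha> k epowr (1 / (1 - \<theta>))) epowr (1 - \<theta>) * isum h epowr \<theta>"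
  using nn_integral_Hoelder[of h "count_space UNIV" "\<lambda>k. \<alpha> k epowr (1 / (1 - \<theta>))" \<theta>] assms
  by (simp add: mult.commute)

text \<open>Converse of \<open>diagonal_le_sum\<close>: the sequence for which Hoelder's inequality
  is an equality recovers the norm of the coefficients.\<close>

lemma diagonal_sum_le:
  assumes \<theta>: "0 < \<theta>" "\<theta> < 1"
    and le: "\<And>c. isum c \<le> 1 \<Longrightarrow> isum (\<lambda>k. \<alpha> k * c k epowr \<theta>) \<le> B"
  shows "isum (\<lambda>k. \<alpha> k epowr (1 / (1 - \<theta>))) \<le> B epowr (1 / (1 - \<theta>))"
proof (cases "B = top")
  case False
  define s where "s = 1 / (1 - \<theta>)"
  have s: "0 < s" "1 + s * \<theta> = s" using \<theta> by (auto simp: s_def field_simps)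
  \<comment> \<open>Testing with unit sequences bounds every coefficient by the finite
    \<open>B\<close>, so the partial sum \<open>X\<close> below is finite and may be divided
    by.\<close>
  have \<alpha>: "\<alpha> k \<le> B" for k
  proof -
    have "isum (\<lambda>i. indicator {k} i) \<le> 1" by simp
    note le[OF this]
    moreover have "\<alpha> k \<le> isum (\<lambda>i. \<alpha> i * indicator {k} i epowr \<theta>)"
      using le_isum[of "\<lambda>i. \<alpha> i * indicator {k} i epowr \<theta>" k] by simp
    ultimately show ?thesis by (rule order_trans[rotated])
  qed
  show ?thesis unfolding s_def[symmetric]
  proof (rule isum_least)
    fix F :: "int set" assume F: "finite F"
    define X where "X = (\<Sum>k\<in>F. \<alpha> k epowr s)"
    show "X \<le> B epowr s"
    proof (cases "X = 0")
      case nz: False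
      have "\<alpha> k < top" for k using \<alpha>[of k] False by (simp add: less_top order_le_less_trans)
      then have "X < top" using F by (simp add: X_def)
      then obtain x where x: "X = ennreal x" "0 < x"
        using nz by (cases X) (auto simp: ennreal_eq_0_iff)
      \<comment> \<open>The extremal sequence, restricted to \<open>F\<close> and normalised to
        total 1.\<close>
      define c where "c = (\<lambda>k. \<alpha> k epowr s * ennreal (1 / x) * indicator F k)"
      have "isum c = (\<Sum>k\<in>F. \<alpha> k epowr s * ennreal (1 / x))"
        using F unfolding c_def
        by (simp add: nn_integral_count_space_indicator[symmetric] nn_integral_count_space_finite)
      also have "\<dots> = X * ennreal (1 / x)" by (simp add: X_def sum_distrib_right)
      also have "\<dots> = 1" using x by (simp add: ennreal_mult[symmetric])
      finally have "isum c \<le> 1" by simp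
      note le[OF this]
      moreover have "isum (\<lambda>k. \<alpha> k * c k epowr \<theta>) =
          isum (\<lambda>k. (\<alpha> k epowr s * ennreal (x powr - \<theta>)) * indicator F k)"
      proof (rule nn_integral_cong)
        fix k
        have "\<alpha> k * (\<alpha> k epowr s * ennreal (1 / x)) epowr \<theta> =
            \<alpha> k epowr (1 + s * \<theta>) * ennreal ((1 / x) powr \<theta>)"
          using x by (simp add: epowr_mult epowr_epowr epowr_add mult_ac)
        also have "\<dots> = \<alpha> k epowr s * ennreal (x powr - \<theta>)"
          using x unfolding s by (simp add: powr_minus powr_divide inverse_eq_divide)
        finally show "\<alpha> k * c k epowr \<theta> = \<alpha> k epowr s * ennreal (x powr - \<theta>) * indicator F k"
          by (simp add: c_def indicator_def)
      qed
      moreover have "\<dots> = X * ennreal (x powr - \<theta>)"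
        using F by (simp add: nn_integral_count_space_indicator[symmetric]
            nn_integral_count_space_finite X_def sum_distrib_right)
      moreover have "\<dots> = X epowr (1 - \<theta>)"
        using x powr_add[of x 1 "- \<theta>"] by (simp add: ennreal_mult[symmetric])
      ultimately have "X epowr (1 - \<theta>) \<le> B" by simp
      then show ?thesis using \<theta> by (simp add: epowr_le_iff_le_root s_def)
    qed simp
  qed
qed simp

section \<open>Integrals over intervals and the function V\<close>

lemma ex_decseq_coinitial:
  fixes E :: "real set"
  assumes "E \<noteq> {}"
  obtains s :: "nat \<Rightarrow> real" where "decseq s" "range s \<subseteq> E" "\<And>t. t \<in> E \<Longrightarrow> \<exists>n. s n \<le> t"
proof (cases "\<exists>m\<in>E. \<forall>t\<in>E. m \<le> t")
  case True
  then obtain m where "m \<in> E" "\<forall>t\<in>E. m \<le> t" by blast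
  then show ?thesis using that[of "\<lambda>_. m"] by (auto simp: decseq_def)
next
  case False
  \<comment> \<open>Without a least element, a countable dense subset is already coinitial: below
    each point of \<open>E\<close> lies another one, which the elements of \<open>T\<close>
    approach. The running minima of \<open>T\<close> then form the sequence.\<close>
  obtain T where T: "countable T" "T \<subseteq> E" "E \<subseteq> closure T" by (rule separable)
  have ne: "T \<noteq> {}" using T assms by auto
  have below: "\<exists>y\<in>T. y \<le> t" if "t \<in> E" for t
  proof -
    obtain y where y: "y \<in> E" "y < t" using False \<open>t \<in> E\<close> by (meson not_le)
    then have "y \<in> closure T" using T by auto
    then have "{..<t} \<inter> T \<noteq> {}"
      using y open_Int_closure_eq_empty[of "{..<t}" T] by auto
    then show ?thesis by (auto intro: less_imp_le)
  qed
  define s where "s = (\<lambda>n. Min (from_nat_into T ` {..n::nat}))"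
  have "decseq s" unfolding s_def decseq_def by (auto intro!: Min_antimono)
  moreover have "range s \<subseteq> E"
  proof
    fix y assume "y \<in> range s"
    then obtain n where "y = s n" by blast
    then have "y \<in> from_nat_into T ` {..n}" unfolding s_def by (simp only:) (rule Min_in, auto)
    then show "y \<in> E" using T from_nat_into[OF ne] by auto
  qed
  moreover have "\<exists>n. s n \<le> t" if t: "t \<in> E" for t
  proof -
    obtain y where y: "y \<in> T" "y \<le> t" using below[OF t] by blast
    then obtain n where "y = from_nat_into T n" using from_nat_into_surj[OF T(1)] by metis
    then have "s n \<le> y" unfolding s_def by (auto intro!: Min_le)
    then show ?thesis using y by (intro exI[of _ n]) simp
  qed
  ultimately show ?thesis by (rule that)
qed

lemma ex_incseq_cofinal:
  fixes E :: "real set"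
  assumes "E \<noteq> {}"
  obtains s :: "nat \<Rightarrow> real" where "incseq s" "range s \<subseteq> E" "\<And>t. t \<in> E \<Longrightarrow> \<exists>n. t \<le> s n"
proof -
  obtain s where s: "decseq s" "range s \<subseteq> uminus ` E" "\<And>t. t \<in> uminus ` E \<Longrightarrow> \<exists>n. s n \<le> t"
    using ex_decseq_coinitial[of "uminus ` E"] assms by auto
  show ?thesis
  proof (rule that[of "\<lambda>n. - s n"])
    show "range (\<lambda>n. - s n) \<subseteq> E" using s(2) by fastforce
    show "\<exists>n. t \<le> - s n" if "t \<in> E" for t
      using s(3)[of "- t"] that by (auto simp: le_minus_iff)
  qed (use s(1) in \<open>auto simp: incseq_def decseq_def\<close>)
qed

text \<open>Continuity from below along the segments. A bound known only at points of
  \<open>E\<close> thereby reaches down to the infimum of \<open>E\<close>, which need not belong to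
  \<open>E\<close>.\<close>

lemma emeasure_le_if_upper_segments:
  fixes M :: "real measure"
  assumes M: "sets borel \<subseteq> sets M" and E: "E \<in> sets M"
    and le: "\<And>t. t \<in> E \<Longrightarrow> emeasure M (E \<inter> {t..}) \<le> K"
  shows "emeasure M E \<le> K"
proof (cases "E = {}")
  case False
  obtain s where s: "decseq s" "range s \<subseteq> E" "\<And>t. t \<in> E \<Longrightarrow> \<exists>n. s n \<le> t"
    using ex_decseq_coinitial[OF False] by metis
  have "E = (\<Union>n. E \<inter> {s n..})" using s(3) by auto
  then have "emeasure M E = emeasure M (\<Union>n. E \<inter> {s n..})" by simp
  also have "\<dots> = (SUP n. emeasure M (E \<inter> {s n..}))"
  proof (rule SUP_emeasure_incseq[symmetric])
    show "range (\<lambda>n. E \<inter> {s n..}) \<subseteq> sets M"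
      using E M by (intro image_subsetI sets.Int) auto
    show "incseq (\<lambda>n. E \<inter> {s n..})"
      using s(1) by (auto simp: incseq_def decseq_def) (meson order_trans)
  qed
  also have "\<dots> \<le> K" using s(2) by (intro SUP_least le) auto
  finally show ?thesis .
qed simp

lemma emeasure_le_if_lower_segments:
  fixes M :: "real measure"
  assumes M: "sets borel \<subseteq> sets M" and E: "E \<in> sets M"
    and le: "\<And>t. t \<in> E \<Longrightarrow> emeasure M (E \<inter> {..t}) \<le> K"
  shows "emeasure M E \<le> K"
proof (cases "E = {}")
  case False
  obtain s where s: "incseq s" "range s \<subseteq> E" "\<And>t. t \<in> E \<Longrightarrow> \<exists>n. t \<le> s n"
    using ex_incseq_cofinal[OF False] by metis
  have "E = (\<Union>n. E \<inter> {..s n})" using s(3) by auto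
  then have "emeasure M E = emeasure M (\<Union>n. E \<inter> {..s n})" by simp
  also have "\<dots> = (SUP n. emeasure M (E \<inter> {..s n}))"
  proof (rule SUP_emeasure_incseq[symmetric])
    show "range (\<lambda>n. E \<inter> {..s n}) \<subseteq> sets M"
      using E M by (intro image_subsetI sets.Int) auto
    show "incseq (\<lambda>n. E \<inter> {..s n})"
      using s(1) by (auto simp: incseq_def) (meson order_trans)
  qed
  also have "\<dots> \<le> K" using s(2) by (intro SUP_least le) auto
  finally show ?thesis .
qed simp

text \<open>Superlevel sets of a monotone function are intervals. The indicator is there because
  \<open>V\<close>, as a function of its right end, is shown to be monotone only inside the interval
  on which v is a weight.\<close>

lemma borel_measurable_mono_ennreal:
  fixes h :: "real \<Rightarrow> ennreal"
  assumes "\<And>s t. s \<in> I \<Longrightarrow> t \<in> I \<Longrightarrow> s \<le> t \<Longrightarrow> h s \<le> h t" and I: "is_interval I"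
  shows "(\<lambda>t. h t * indicator I t) \<in> borel_measurable borel"
proof (rule borel_measurableI_greater)
  fix y :: ennreal
  have "is_interval {t \<in> I. y < h t}"
    using assms(1) I unfolding is_interval_1 by (smt (verit) mem_Collect_eq order_less_le_trans)
  then have "{t \<in> I. y < h t} \<in> sets borel" by (rule real_interval_borel_measurable)
  also have "{t \<in> I. y < h t} = {t \<in> space borel. y < h t * indicator I t}"
    by (auto split: split_indicator_asm split_indicator)
  finally show "{t \<in> space borel. y < h t * indicator I t} \<in> sets borel" .
qed

lemma borel_measurable_antimono_ennreal:
  fixes h :: "real \<Rightarrow> ennreal"
  assumes "\<And>s t. s \<le> t \<Longrightarrow> h t \<le> h s"
  shows "h \<in> borel_measurable borel"
proof (rule borel_measurableI_greater)
  fix y :: ennreal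
  have "is_interval {t. y < h t}"
    unfolding is_interval_1 using assms by (auto intro: less_le_trans)
  then show "{t \<in> space borel. y < h t} \<in> sets borel" by (simp add: real_interval_borel_measurable)
qed

lemma is_interval_einterval: "is_interval (einterval a b)"
  unfolding is_interval_1
proof (intro ballI allI impI, elim conjE)
  fix s t x assume "s \<in> einterval a b" "t \<in> einterval a b" "s \<le> x" "x \<le> t"
  then show "x \<in> einterval a b"
    using less_le_trans[of a "ereal s" "ereal x"] le_less_trans[of "ereal x" "ereal t" b]
    by (simp add: einterval_iff)
qed

section \<open>Open intervals, integrals over them, and weights\<close>

lemma sets_lebesgue_einterval [simp, measurable]: "einterval a b \<in> sets lebesgue"
  by (simp add: borel_einterval)

lemma integ_eq: "integ c d g = (\<integral>\<^sup>+ t. g t * indicator (einterval c d) t \<partial>lebesgue)"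
  unfolding integ_def by (rule nn_integral_restrict_space) simp

lemma Mplus_iff: "f \<in> Mplus a b \<longleftrightarrow> (\<lambda>t. f t * indicator (einterval a b) t) \<in> borel_measurable lebesgue"
  unfolding Mplus_def by (rule borel_measurable_restrict_space_iff_ennreal) simp

lemma einterval_mono: "a \<le> c \<Longrightarrow> d \<le> b \<Longrightarrow> einterval c d \<subseteq> einterval a b"
  by (auto simp: einterval_iff)

lemma Mplus_mono: "f \<in> Mplus a b \<Longrightarrow> a \<le> c \<Longrightarrow> d \<le> b \<Longrightarrow> f \<in> Mplus c d"
  unfolding Mplus_def by (rule measurable_restrict_mono) (use einterval_mono[of a c d b] in auto)

lemma integ_mono_interval: "a \<le> c \<Longrightarrow> d \<le> b \<Longrightarrow> integ c d g \<le> integ a b g"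
  unfolding integ_eq using einterval_mono[of a c d b]
  by (intro nn_integral_mono) (auto split: split_indicator)

lemma integ_mono: "(\<And>t. t \<in> einterval c d \<Longrightarrow> f t \<le> g t) \<Longrightarrow> integ c d f \<le> integ c d g"
  unfolding integ_def by (intro nn_integral_mono) (auto simp: space_restrict_space)

lemma integ_cong: "(\<And>t. t \<in> einterval c d \<Longrightarrow> f t = g t) \<Longrightarrow> integ c d f = integ c d g"
  unfolding integ_def by (intro nn_integral_cong) (auto simp: space_restrict_space)

lemma integ_empty [simp]: "integ c c g = 0"
  by (simp add: integ_eq einterval_same)

lemma weight_mono: "weight a b v \<Longrightarrow> a \<le> c \<Longrightarrow> d \<le> b \<Longrightarrow> weight c d v"
  unfolding weight_def using einterval_mono[of a c d b]
  by (auto intro: measurable_restrict_mono)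

lemma weight_measurable: "weight a b v \<Longrightarrow> v \<in> borel_measurable (lebesgue_on (einterval a b))"
  by (simp add: weight_def)

lemma weight_Mplus: "weight a b v \<Longrightarrow> (\<lambda>t. ennreal (v t)) \<in> Mplus a b"
  unfolding Mplus_def by (auto dest: weight_measurable)

lemma emeasure_einterval_pos:
  assumes "c < d"
  shows "emeasure lebesgue (einterval c d) \<noteq> 0"
proof -
  obtain x where x: "x \<in> einterval c d" using einterval_nonempty[OF assms] by blast
  then obtain e where e: "e > 0" "ball x e \<subseteq> einterval c d"
    using open_contains_ball open_einterval by blast
  have "{x..<x + e} \<subseteq> einterval c d"
    using e by (auto simp: subset_iff dist_real_def)
  then have "emeasure lebesgue {x..<x + e} \<le> emeasure lebesgue (einterval c d)"
    by (intro emeasure_mono) auto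
  then show ?thesis using e by auto
qed

lemma AE_False_einterval:
  assumes "AE t in lebesgue_on (einterval c d). False"
  shows "d \<le> c"
proof (rule ccontr)
  assume "\<not> d \<le> c"
  moreover have "emeasure lebesgue (einterval c d) = 0"
    using assms ae_filter_eq_bot_iff[of "lebesgue_on (einterval c d)"]
    by (simp add: trivial_limit_def emeasure_restrict_space space_restrict_space)
  ultimately show False using emeasure_einterval_pos[of c d] by (simp add: not_le)
qed

lemma integ_pos:
  assumes "g \<in> Mplus c d" "c < d" "\<And>t. t \<in> einterval c d \<Longrightarrow> 0 < g t"
  shows "0 < integ c d g"
proof (rule ccontr)
  assume "\<not> 0 < integ c d g"
  then have "AE t in lebesgue_on (einterval c d). g t = 0"
    using assms(1) by (simp add: integ_def Mplus_def nn_integral_0_iff_AE)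
  moreover have "AE t in lebesgue_on (einterval c d). t \<in> einterval c d"
    using AE_space[of "lebesgue_on (einterval c d)"] by (simp add: space_restrict_space)
  ultimately have "AE t in lebesgue_on (einterval c d). False"
    by eventually_elim (use assms(3) in force)
  then show False using AE_False_einterval assms(2) by fastforce
qed

section \<open>The function \<open>V\<close> as a dual norm\<close>

lemma V_measurable:
  assumes "weight c d v"
  shows "(\<lambda>s. ennreal (inverse (v s))) \<in> borel_measurable (lebesgue_on (einterval c d))"
    and "(\<lambda>s. ennreal (v s powr e)) \<in> borel_measurable (lebesgue_on (einterval c d))"
  using weight_measurable[OF assms] by measurable

lemma AE_lebesgue_on_mono:
  assumes "AE t in lebesgue_on (einterval a b). P t" "a \<le> c" "d \<le> b"
  shows "AE t in lebesgue_on (einterval c d). P t"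
  using assms(1) einterval_mono[OF assms(2,3)]
  by (auto simp: AE_restrict_space_iff elim: eventually_mono)

lemma AE_lebesgue_onI:
  "(\<And>t. t \<in> einterval c d \<Longrightarrow> P t) \<Longrightarrow> AE t in lebesgue_on (einterval c d). P t"
  by (simp add: AE_restrict_space_iff)

lemma V_mono:
  assumes v: "weight a b v" and "a \<le> c" "d \<le> b" "1 \<le> p"
  shows "V p v c d \<le> V p v a b"
proof (cases "p = 1")
  case True
  have "AE s in lebesgue_on (einterval c d). ennreal (inverse (v s)) \<le> ess_sup a b (\<lambda>s. ennreal (inverse (v s)))"
    unfolding ess_sup_def by (rule AE_lebesgue_on_mono[OF esssup_AE assms(2,3)])
  then show ?thesis
    using V_measurable(1)[OF weight_mono[OF assms(1-3)]] True
    by (auto simp: V_def ess_sup_def)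
next
  case False
  then show ?thesis
    using assms by (simp add: V_def epowr_mono integ_mono_interval)
qed

text \<open>Positivity is what puts every point with finite \<open>V\<close> into a dyadic
  level.\<close>

lemma V_pos:
  assumes v: "weight c d v" and "c < d" "1 \<le> p"
  shows "0 < V p v c d"
proof (cases "p = 1")
  case True
  show ?thesis
  proof (rule ccontr)
    assume "\<not> 0 < V p v c d"
    then have "esssup (lebesgue_on (einterval c d)) (\<lambda>s. ennreal (inverse (v s))) = 0"
      using True by (simp add: V_def ess_sup_def)
    then have "AE s in lebesgue_on (einterval c d). ennreal (inverse (v s)) \<le> 0"
      using esssup_AE[of "\<lambda>s. ennreal (inverse (v s))" "lebesgue_on (einterval c d)"] by simp
    moreover have "AE s in lebesgue_on (einterval c d). 0 < v s"
      using v by (intro AE_lebesgue_onI) (auto simp: weight_def)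
    ultimately have "AE s in lebesgue_on (einterval c d). False"
      by eventually_elim (simp add: ennreal_eq_0_iff)
    then show False using AE_False_einterval assms(2) by fastforce
  qed
next
  case False
  have "0 < integ c d (\<lambda>s. ennreal (v s powr (- 1 / (p - 1))))"
    using v V_measurable(2)[OF v] assms
    by (intro integ_pos) (auto simp: Mplus_def weight_def)
  then show ?thesis
    using False by (simp add: V_def zero_less_iff_neq_zero)
qed

text \<open>\<open>V p v c d\<close> is the norm of the functional f \<mapsto> \<integral> f on L^p
  with weight v; this is the upper half of that duality. For p > 1 apply Hoelder's inequality to the
  factors (f^p v)^(1/p) and v^(-1/p); for p = 1 insert v times 1/v and bound 1/v by its essential
  supremum.\<close>

lemma integ_le_V:
  assumes v: "weight c d v" and f: "f \<in> Mplus c d" and p: "1 \<le> p"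
  shows "integ c d f \<le> integ c d (\<lambda>t. f t epowr p * ennreal (v t)) epowr (1 / p) * V p v c d"
proof (cases "p = 1")
  case True
  let ?L = "lebesgue_on (einterval c d)"
  have [measurable]: "f \<in> borel_measurable ?L" "v \<in> borel_measurable ?L"
    using f v by (auto simp: Mplus_def weight_def)
  have "AE t in ?L. ennreal (inverse (v t)) \<le> V p v c d"
    using True unfolding V_def ess_sup_def by (simp add: esssup_AE)
  moreover have "AE t in ?L. 0 < v t"
    using v by (intro AE_lebesgue_onI) (auto simp: weight_def)
  ultimately have "AE t in ?L. f t \<le> f t * ennreal (v t) * V p v c d"
  proof eventually_elim
    fix t assume *: "ennreal (inverse (v t)) \<le> V p v c d" "0 < v t"
    then have "f t = f t * ennreal (v t) * ennreal (inverse (v t))"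
      by (simp add: mult.assoc ennreal_mult[symmetric])
    also have "\<dots> \<le> f t * ennreal (v t) * V p v c d"
      using * by (intro mult_left_mono) auto
    finally show "f t \<le> f t * ennreal (v t) * V p v c d" .
  qed
  then have "integ c d f \<le> (\<integral>\<^sup>+ t. f t * ennreal (v t) * V p v c d \<partial>?L)"
    unfolding integ_def by (rule nn_integral_mono_AE)
  also have "\<dots> = integ c d (\<lambda>t. f t * ennreal (v t)) * V p v c d"
    unfolding integ_def by (rule nn_integral_multc) measurable
  finally show ?thesis using True by simp
next
  case False
  let ?L = "lebesgue_on (einterval c d)"
  have [measurable]: "f \<in> borel_measurable ?L" "v \<in> borel_measurable ?L"
    using f v by (auto simp: Mplus_def weight_def)
  have p: "1 < p" using False p by simp
  have "integ c d f = (\<integral>\<^sup>+ t. (f t epowr p * ennreal (v t)) epowr (1 / p) *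
      ennreal (v t powr (- 1 / (p - 1))) epowr (1 - 1 / p) \<partial>?L)"
    unfolding integ_def
  proof (rule nn_integral_cong)
    fix t assume "t \<in> space ?L"
    then have vt: "0 < v t" using v by (simp add: weight_def space_restrict_space)
    have e: "(- 1 / (p - 1)) * (1 - 1 / p) = - (1 / p)"
      using p by (simp add: divide_simps)
    have "v t powr (1 / p) * v t powr ((- 1 / (p - 1)) * (1 - 1 / p)) = 1"
      unfolding e using vt by (simp add: powr_minus)
    then show "f t = (f t epowr p * ennreal (v t)) epowr (1 / p) *
      ennreal (v t powr (- 1 / (p - 1))) epowr (1 - 1 / p)"
      using p vt by (simp add: epowr_mult epowr_epowr powr_powr mult.assoc ennreal_mult[symmetric])
  qed
  also have "\<dots> \<le> (\<integral>\<^sup>+ t. f t epowr p * ennreal (v t) \<partial>?L) epowr (1 / p) *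
      (\<integral>\<^sup>+ t. ennreal (v t powr (- 1 / (p - 1))) \<partial>?L) epowr (1 - 1 / p)"
    using p by (intro nn_integral_Hoelder) auto
  also have "(1 - 1 / p) = (p - 1) / p" using p by (simp add: field_simps)
  finally show ?thesis
    using False by (simp add: V_def integ_def)
qed

text \<open>The lower half of the duality: the norm is approached by functions of energy at most 1.
  They are multiples of v^(-1/(p-1)), or for p = 1 of 1/v on a set where 1/v exceeds \<kappa>,
  truncated so that they can be normalised. Extension by 0 makes them usable on larger
  intervals.\<close>

lemma V_saturated:
  assumes v: "weight c d v" and p: "1 \<le> p" and less: "\<kappa> < V p v c d"
  obtains f where "f \<in> borel_measurable lebesgue" "\<And>t. t \<notin> einterval c d \<Longrightarrow> f t = 0"
    "integ c d (\<lambda>t. f t epowr p * ennreal (v t)) \<le> 1" "\<kappa> \<le> integ c d f"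
proof -
  let ?L = "lebesgue_on (einterval c d)"
  have [measurable]: "v \<in> borel_measurable ?L" using v by (simp add: weight_def)
  have v0: "0 < v t" if "t \<in> space ?L" for t
    using that v by (simp add: weight_def space_restrict_space)
  have meas_box: "emeasure ?L (A \<inter> {- real n..real n}) < top" if "A \<in> sets ?L" for A n
  proof -
    have "emeasure ?L (A \<inter> {- real n..real n}) = emeasure lebesgue (A \<inter> {- real n..real n})"
      using that by (subst emeasure_restrict_space) (auto simp: sets_restrict_space_iff)
    also have "\<dots> \<le> emeasure lebesgue {- real n..real n}"
      by (intro emeasure_mono) auto
    also have "\<dots> < top" by simp
    finally show ?thesis .
  qed
  have box: "A \<inter> {- real n..real n} \<in> sets ?L" if "A \<in> sets ?L" for A n
    using that by (auto simp: sets_restrict_space_iff)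
  have "\<exists>g\<in>borel_measurable ?L. (\<integral>\<^sup>+ t. g t epowr p * ennreal (v t) \<partial>?L) \<le> 1 \<and> \<kappa> \<le> (\<integral>\<^sup>+ t. g t \<partial>?L)"
  proof (cases "p = 1")
    case True
    \<comment> \<open>Non-null because \<kappa> lies strictly below the essential supremum; some
      bounded part of it then has positive finite measure.\<close>
    define B0 where "B0 = {s \<in> space ?L. \<kappa> < ennreal (inverse (v s))}"
    have [measurable]: "B0 \<in> sets ?L" unfolding B0_def by measurable
    have "emeasure ?L B0 \<noteq> 0"
      using less True esssup_pos_measure[of "\<lambda>s. ennreal (inverse (v s))" ?L \<kappa>]
      by (simp add: V_def ess_sup_def B0_def)
    moreover have "B0 = (\<Union>n. B0 \<inter> {- real n..real n})"
    proof -
      have "\<exists>n. - real n \<le> s \<and> s \<le> real n" for s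
      proof -
        obtain n where "\<bar>s\<bar> \<le> real n" using real_arch_simple by blast
        then have "- real n \<le> s \<and> s \<le> real n" by linarith
        then show ?thesis by blast
      qed
      then show ?thesis by auto
    qed
    ultimately have "emeasure ?L (\<Union>n. B0 \<inter> {- real n..real n}) \<noteq> 0" by simp
    moreover have "emeasure ?L (\<Union>n. B0 \<inter> {- real n..real n}) = 0"
      if "\<forall>n. emeasure ?L (B0 \<inter> {- real n..real n}) = 0"
      using that by (intro emeasure_UN_eq_0) (auto intro: box)
    ultimately obtain n where n: "emeasure ?L (B0 \<inter> {- real n..real n}) \<noteq> 0" by blast
    define B where "B = B0 \<inter> {- real n..real n}"
    have [measurable]: "B \<in> sets ?L" unfolding B_def by (rule box) simp
    obtain m where m: "emeasure ?L B = ennreal m" "0 < m"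
      using n meas_box[of B0 n] unfolding B_def[symmetric]
      by (cases "emeasure ?L B") (auto simp: ennreal_eq_0_iff)
    define g where "g = (\<lambda>s. ennreal (inverse (v s)) * ennreal (1 / m) * indicator B s)"
    have "(\<integral>\<^sup>+ t. g t epowr p * ennreal (v t) \<partial>?L) = (\<integral>\<^sup>+ t. ennreal (1 / m) * indicator B t \<partial>?L)"
    proof (rule nn_integral_cong)
      fix t assume "t \<in> space ?L"
      then have "ennreal (inverse (v t)) * ennreal (v t) = 1"
        using v0[of t] by (simp add: ennreal_mult[symmetric])
      moreover have "g t epowr p * ennreal (v t) =
          (ennreal (inverse (v t)) * ennreal (v t)) * (ennreal (1 / m) * indicator B t)"
        using True by (simp add: g_def mult_ac)
      ultimately show "g t epowr p * ennreal (v t) = ennreal (1 / m) * indicator B t"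
        by simp
    qed
    also have "\<dots> = 1"
      using m by (simp add: nn_integral_cmult ennreal_mult[symmetric])
    finally have 1: "(\<integral>\<^sup>+ t. g t epowr p * ennreal (v t) \<partial>?L) \<le> 1" by simp
    have "\<kappa> = (\<integral>\<^sup>+ t. \<kappa> * ennreal (1 / m) * indicator B t \<partial>?L)"
      using m by (simp add: nn_integral_cmult mult.assoc ennreal_mult[symmetric])
    also have "\<dots> \<le> (\<integral>\<^sup>+ t. g t \<partial>?L)"
      by (intro nn_integral_mono) (auto simp: g_def B_def B0_def mult_right_mono split: split_indicator)
    finally have "\<kappa> \<le> (\<integral>\<^sup>+ t. g t \<partial>?L)" .
    moreover have "g \<in> borel_measurable ?L" unfolding g_def by measurable
    ultimately show ?thesis using 1 by blast
  next
    case False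
    then have p: "1 < p" using p by simp
    define \<rho> where "\<rho> = (\<lambda>s. v s powr (- 1 / (p - 1)))"
    have [measurable]: "\<rho> \<in> borel_measurable ?L" unfolding \<rho>_def by measurable
    have \<rho>0: "0 \<le> \<rho> s" for s by (simp add: \<rho>_def)
    \<comment> \<open>On \<open>A n\<close> the density \<rho> is bounded and the measure is finite,
      so the truncated integral is finite; by monotone convergence it still beats \<kappa> for some
      n.\<close>
    define A where "A = (\<lambda>n. {s \<in> space ?L. \<rho> s \<le> real n} \<inter> {- real n..real n})"
    have A [measurable]: "A n \<in> sets ?L" for n unfolding A_def by (rule box) measurable
    define e where "e = (p - 1) / p"
    have e: "0 < e" using p by (simp add: e_def)
    have "(\<integral>\<^sup>+ s. ennreal (\<rho> s) \<partial>?L) = (\<integral>\<^sup>+ s. (SUP n. ennreal (\<rho> s) * indicator (A n) s) \<partial>?L)"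
    proof (rule nn_integral_cong)
      fix s assume s: "s \<in> space ?L"
      obtain n where n: "max \<bar>s\<bar> (\<rho> s) \<le> real n" using real_arch_simple by blast
      have sn: "s \<in> A n" using n s by (auto simp: A_def abs_le_iff)
      show "ennreal (\<rho> s) = (SUP n. ennreal (\<rho> s) * indicator (A n) s)"
      proof (rule antisym)
        have "ennreal (\<rho> s) = ennreal (\<rho> s) * indicator (A n) s" using sn by simp
        also have "\<dots> \<le> (SUP n. ennreal (\<rho> s) * indicator (A n) s)" by (rule SUP_upper) simp
        finally show "ennreal (\<rho> s) \<le> (SUP n. ennreal (\<rho> s) * indicator (A n) s)" .
      qed (auto intro!: SUP_least split: split_indicator)
    qed
    also have "\<dots> = (SUP n. \<integral>\<^sup>+ s. ennreal (\<rho> s) * indicator (A n) s \<partial>?L)"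
    proof (rule nn_integral_monotone_convergence_SUP)
      show "incseq (\<lambda>n s. ennreal (\<rho> s) * indicator (A n) s)"
        by (auto simp: incseq_def le_fun_def A_def split: split_indicator)
    qed measurable
    finally have "V p v c d = (SUP n. (\<integral>\<^sup>+ s. ennreal (\<rho> s) * indicator (A n) s \<partial>?L) epowr e)"
      using False e by (simp add: V_def integ_def epowr_SUP e_def \<rho>_def)
    then obtain n where n: "\<kappa> < (\<integral>\<^sup>+ s. ennreal (\<rho> s) * indicator (A n) s \<partial>?L) epowr e" (is "_ < ?I epowr e")
      using less by (auto simp: less_SUP_iff)
    have "?I \<le> (\<integral>\<^sup>+ s. ennreal (real n) * indicator (A n) s \<partial>?L)"
      by (intro nn_integral_mono) (auto simp: A_def ennreal_leI split: split_indicator)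
    also have "\<dots> = ennreal (real n) * emeasure ?L (A n)"
      by (rule nn_integral_cmult_indicator) simp
    also have "\<dots> < top"
    proof -
      have "{s \<in> space ?L. \<rho> s \<le> real n} \<in> sets ?L" by measurable
      from meas_box[OF this, of n] have "emeasure ?L (A n) < top" by (simp only: A_def)
      then show ?thesis by (simp add: ennreal_mult_less_top)
    qed
    finally have "?I < top" .
    moreover have "?I \<noteq> 0" using n by auto
    ultimately obtain i where i: "?I = ennreal i" "0 < i"
      by (cases ?I) (auto simp: ennreal_eq_0_iff)
    \<comment> \<open>Since \<rho>^p v = \<rho>, the factor i^(-1/p) makes the energy equal to 1 and
      the integral equal to i^(1 - 1/p), the truncated value of \<open>V\<close>.\<close>
    define g where "g = (\<lambda>s. ennreal (\<rho> s) * indicator (A n) s * ennreal (i powr (- 1 / p)))"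
    have "(\<integral>\<^sup>+ t. g t epowr p * ennreal (v t) \<partial>?L) =
        (\<integral>\<^sup>+ t. (ennreal (\<rho> t) * indicator (A n) t) * ennreal (1 / i) \<partial>?L)"
    proof (rule nn_integral_cong)
      fix t assume "t \<in> space ?L"
      then have vt: "0 < v t" by (rule v0)
      have "\<rho> t powr p * v t = v t powr (- 1 / (p - 1) * p + 1)"
        using vt unfolding \<rho>_def powr_powr powr_add by (simp only: powr_one)
      also have "- 1 / (p - 1) * p + 1 = - 1 / (p - 1)" using p by (simp add: field_simps)
      finally have r: "\<rho> t powr p * v t = \<rho> t" by (simp add: \<rho>_def)
      have "(i powr (- 1 / p)) powr p = 1 / i"
        using i p unfolding powr_powr by (simp add: powr_minus_divide)
      then show "g t epowr p * ennreal (v t) = (ennreal (\<rho> t) * indicator (A n) t) * ennreal (1 / i)"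
        using r i vt \<rho>0[of t] by (auto simp: g_def epowr_mult ennreal_mult[symmetric] mult_ac split: split_indicator)
    qed
    also have "\<dots> = ?I * ennreal (1 / i)" by (rule nn_integral_multc) measurable
    also have "\<dots> = 1" using i by (simp add: ennreal_mult[symmetric])
    finally have 1: "(\<integral>\<^sup>+ t. g t epowr p * ennreal (v t) \<partial>?L) \<le> 1" by simp
    have "(\<integral>\<^sup>+ t. g t \<partial>?L) = ?I * ennreal (i powr (- 1 / p))"
      unfolding g_def by (rule nn_integral_multc) measurable
    also have "\<dots> = ennreal (i powr (1 + - 1 / p))"
      using i by (simp only: ennreal_mult[symmetric] powr_add) (simp add: ennreal_mult[symmetric])
    also have "1 + - 1 / p = e" using p by (simp add: e_def field_simps)
    also have "ennreal (i powr e) = ?I epowr e" using i by simp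
    finally have "\<kappa> \<le> (\<integral>\<^sup>+ t. g t \<partial>?L)" using n by simp
    moreover have "g \<in> borel_measurable ?L" unfolding g_def by measurable
    ultimately show ?thesis using 1 by blast
  qed
  then obtain g where g: "g \<in> borel_measurable ?L"
    "(\<integral>\<^sup>+ t. g t epowr p * ennreal (v t) \<partial>?L) \<le> 1" "\<kappa> \<le> (\<integral>\<^sup>+ t. g t \<partial>?L)" by blast
  show ?thesis
  proof (rule that[of "\<lambda>t. g t * indicator (einterval c d) t"])
    show "(\<lambda>t. g t * indicator (einterval c d) t) \<in> borel_measurable lebesgue"
      using g(1) Mplus_iff[of g c d] by (simp add: Mplus_def)
    have "integ c d (\<lambda>t. g t * indicator (einterval c d) t) = (\<integral>\<^sup>+ t. g t \<partial>?L)"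
      unfolding integ_def by (intro nn_integral_cong) (simp add: space_restrict_space)
    then show "\<kappa> \<le> integ c d (\<lambda>t. g t * indicator (einterval c d) t)" using g by simp
    have "integ c d (\<lambda>t. (g t * indicator (einterval c d) t) epowr p * ennreal (v t)) =
        (\<integral>\<^sup>+ t. g t epowr p * ennreal (v t) \<partial>?L)"
      unfolding integ_def by (intro nn_integral_cong) (simp add: space_restrict_space)
    then show "integ c d (\<lambda>t. (g t * indicator (einterval c d) t) epowr p * ennreal (v t)) \<le> 1"
      using g by simp
  qed simp
qed

lemma borel_measurable_lebesgue_Mplus: "f \<in> borel_measurable lebesgue \<Longrightarrow> f \<in> Mplus a b"
  unfolding Mplus_def by (rule measurable_restrict_space1)

lemma integ_cmult: "f \<in> Mplus c d \<Longrightarrow> integ c d (\<lambda>t. k * f t) = k * integ c d f"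
  unfolding integ_def Mplus_def by (rule nn_integral_cmult)

lemma Mplus_SUP: "(\<And>j::int. f j \<in> Mplus a b) \<Longrightarrow> (\<lambda>t. SUP j. k j * f j t) \<in> Mplus a b"
  unfolding Mplus_def by (intro borel_measurable_SUP) auto

lemma Mplus_energy:
  assumes "f \<in> Mplus a b" "weight a b v"
  shows "(\<lambda>t. f t epowr p * ennreal (v t)) \<in> Mplus a b"
  using assms weight_measurable[OF assms(2)] unfolding Mplus_def by measurable

lemma integ_isum: "(\<And>j. f j \<in> Mplus c d) \<Longrightarrow> integ c d (\<lambda>t. isum (\<lambda>j. f j t)) = isum (\<lambda>j. integ c d (f j))"
  unfolding integ_def Mplus_def by (rule nn_integral_count_space_nn_integral) auto

text \<open>Combining test functions by a supremum instead of a sum keeps the energy additive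
  without any disjointness of supports.\<close>

lemma energy_SUP_le:
  assumes f: "\<And>j::int. f j \<in> Mplus a b" and v: "weight a b v" and p: "0 < p"
    and e: "\<And>j. integ a b (\<lambda>t. f j t epowr p * ennreal (v t)) \<le> 1" and c: "isum c \<le> 1"
  shows "integ a b (\<lambda>t. (SUP j. c j epowr (1 / p) * f j t) epowr p * ennreal (v t)) \<le> 1"
proof -
  have "integ a b (\<lambda>t. (SUP j. c j epowr (1 / p) * f j t) epowr p * ennreal (v t)) \<le>
      integ a b (\<lambda>t. isum (\<lambda>j. c j * (f j t epowr p * ennreal (v t))))"
  proof (rule integ_mono)
    fix t
    have "(SUP j. c j epowr (1 / p) * f j t) epowr p * ennreal (v t) =
        (SUP j. c j * f j t epowr p) * ennreal (v t)"
      using p by (simp add: epowr_SUP epowr_mult)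
    also have "\<dots> \<le> isum (\<lambda>j. c j * f j t epowr p) * ennreal (v t)"
      by (intro mult_right_mono SUP_least le_isum[of "\<lambda>j. c j * f j t epowr p"]) auto
    also have "\<dots> = isum (\<lambda>j. c j * (f j t epowr p * ennreal (v t)))"
      by (simp add: nn_integral_multc[symmetric] mult.assoc)
    finally show "(SUP j. c j epowr (1 / p) * f j t) epowr p * ennreal (v t) \<le>
        isum (\<lambda>j. c j * (f j t epowr p * ennreal (v t)))" .
  qed
  also have "\<dots> = isum (\<lambda>j. integ a b (\<lambda>t. c j * (f j t epowr p * ennreal (v t))))"
    using Mplus_energy[OF f v] by (intro integ_isum) (auto simp: Mplus_def)
  also have "\<dots> = isum (\<lambda>j. c j * integ a b (\<lambda>t. f j t epowr p * ennreal (v t)))"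
    using Mplus_energy[OF f v] by (simp add: integ_cmult)
  also have "\<dots> \<le> isum (\<lambda>j. c j * 1)"
    by (intro isum_mono mult_left_mono e) auto
  finally show ?thesis using c by simp
qed

section \<open>Splitting integrals along countably many disjoint sets\<close>

lemma isum_indicator_unique: "\<exists>!j. x \<in> E j \<Longrightarrow> isum (\<lambda>j. indicator (E j) x) = 1"
proof -
  assume "\<exists>!j. x \<in> E j"
  then obtain j where "\<And>i. x \<in> E i \<longleftrightarrow> i = j" by blast
  then have "isum (\<lambda>j. indicator (E j) x) = isum (indicator {j})"
    by (intro nn_integral_cong) (simp add: indicator_def)
  then show ?thesis by simp
qed

text \<open>The partition is required almost everywhere only: levels miss the points where
  \<open>V\<close> is infinite, and cells miss the division points.\<close>

lemma nn_integral_partition: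
  assumes [measurable]: "h \<in> borel_measurable M" "\<And>j::int. E j \<in> sets M"
    and E: "AE x in M. \<exists>!j. x \<in> E j"
  shows "(\<integral>\<^sup>+ x. h x \<partial>M) = isum (\<lambda>j. \<integral>\<^sup>+ x. h x * indicator (E j) x \<partial>M)"
proof -
  have "(\<integral>\<^sup>+ x. h x \<partial>M) = (\<integral>\<^sup>+ x. isum (\<lambda>j. h x * indicator (E j) x) \<partial>M)"
    by (rule nn_integral_cong_AE, use E in eventually_elim)
       (simp add: isum_cmult isum_indicator_unique)
  then show ?thesis by (simp add: nn_integral_count_space_nn_integral)
qed

lemma isum_nn_integral_disjoint_le:
  assumes [measurable]: "h \<in> borel_measurable M" "\<And>j::int. E j \<in> sets M"
    and E: "disjoint_family E"
  shows "isum (\<lambda>j. \<integral>\<^sup>+ x. h x * indicator (E j) x \<partial>M) \<le> (\<integral>\<^sup>+ x. h x \<partial>M)"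
proof -
  have "isum (\<lambda>j. \<integral>\<^sup>+ x. h x * indicator (E j) x \<partial>M) =
      (\<integral>\<^sup>+ x. isum (\<lambda>j. h x * indicator (E j) x) \<partial>M)"
    by (simp add: nn_integral_count_space_nn_integral)
  also have "\<dots> \<le> (\<integral>\<^sup>+ x. h x \<partial>M)"
  proof (rule nn_integral_mono)
    fix x
    show "isum (\<lambda>j. h x * indicator (E j) x) \<le> h x"
    proof (cases "\<exists>j. x \<in> E j")
      case True
      then have "\<exists>!j. x \<in> E j" using E by (auto simp: disjoint_family_on_def)
      then show ?thesis by (simp add: isum_cmult isum_indicator_unique)
    qed simp
  qed
  finally show ?thesis .
qed

text \<open>A substitute for \<open>\<integral> U\<^bsup>s-1\<^esup> d(-U) = U\<^bsup>s\<^esup>/s\<close> in the presence of atoms: cut at the median.\<close>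

lemma emeasure_epowr_le_tail_integral:
  fixes M :: "real measure"
  assumes M: "sets M = sets borel" and E [measurable]: "E \<in> sets M" and s: "1 < s"
  shows "emeasure M E epowr s \<le>
    ennreal (2 powr s) * (\<integral>\<^sup>+ t. emeasure M (E \<inter> {t..}) epowr (s - 1) * indicator E t \<partial>M)"
    (is "_ \<le> _ * ?I")
proof -
  have anti: "emeasure M (E \<inter> {t..}) \<le> emeasure M (E \<inter> {r..})" if "r \<le> t" for r t
    using that M E by (intro emeasure_mono) auto
  have meas: "(\<lambda>t. emeasure M (E \<inter> {t..})) \<in> borel_measurable M"
    using borel_measurable_antimono_ennreal[OF anti] by (simp add: measurable_cong_sets[OF M refl])
  note [measurable] = meas
  \<comment> \<open>The points whose tail inside \<open>E\<close> is lighter than m. By exhaustion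
    the whole of \<open>D m\<close> has mass at most m, atoms or not, while on
    \<open>E - D m\<close> the tail is at least m.\<close>
  define D where "D = (\<lambda>m. {t \<in> E. emeasure M (E \<inter> {t..}) < m})"
  have D_eq: "D m = E \<inter> {t \<in> space M. emeasure M (E \<inter> {t..}) < m}" for m
    using sets.sets_into_space[OF E] by (auto simp: D_def)
  have [measurable]: "D m \<in> sets M" for m unfolding D_eq by measurable
  have D: "emeasure M (D m) \<le> m" for m
  proof (rule emeasure_le_if_upper_segments)
    fix t assume t: "t \<in> D m"
    have "emeasure M (D m \<inter> {t..}) \<le> emeasure M (E \<inter> {t..})"
      using M E by (intro emeasure_mono) (auto simp: D_def)
    also have "\<dots> < m" using t by (simp add: D_def)
    finally show "emeasure M (D m \<inter> {t..}) \<le> m" by (rule less_imp_le)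
  next
    show "sets borel \<subseteq> sets M" using M by simp
    show "D m \<in> sets M" by measurable
  qed
  have I: "m epowr (s - 1) * emeasure M (E - D m) \<le> ?I" for m
  proof -
    have "m epowr (s - 1) * emeasure M (E - D m) = (\<integral>\<^sup>+ t. m epowr (s - 1) * indicator (E - D m) t \<partial>M)"
      by (simp add: nn_integral_cmult_indicator)
    also have "\<dots> \<le> ?I"
      using s by (intro nn_integral_mono) (auto simp: D_def not_less epowr_mono split: split_indicator)
    finally show ?thesis .
  qed
  have split: "emeasure M E \<le> emeasure M (D m) + emeasure M (E - D m)" for m
  proof -
    have "E = D m \<union> (E - D m)" by (auto simp: D_def)
    then have "emeasure M E = emeasure M (D m \<union> (E - D m))" by simp
    also have "\<dots> \<le> emeasure M (D m) + emeasure M (E - D m)" by (intro emeasure_subadditive) auto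
    finally show ?thesis .
  qed
  show ?thesis
  proof (cases "emeasure M E")
    case (real e)
    \<comment> \<open>Half the mass as threshold: at least half of \<open>E\<close> remains, and
      there the integrand is at least (e/2)^(s-1).\<close>
    have "ennreal e \<le> ennreal (e / 2) + emeasure M (E - D (ennreal (e / 2)))"
      using order_trans[OF split add_right_mono[OF D]] real by simp
    moreover have "ennreal e = ennreal (e / 2) + ennreal (e / 2)"
      using real by (simp add: ennreal_plus[symmetric] del: ennreal_plus)
    ultimately have "ennreal (e / 2) \<le> emeasure M (E - D (ennreal (e / 2)))"
      by (simp add: ennreal_add_left_cancel_le)
    from order_trans[OF mult_left_mono[OF this] I]
    have "ennreal (e / 2) epowr (s - 1) * ennreal (e / 2) \<le> ?I" by simp
    then have "ennreal (e / 2) epowr s \<le> ?I"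
      using epowr_add[of "ennreal (e / 2)" "s - 1" 1] by simp
    then have "ennreal (2 powr s) * ennreal (e / 2) epowr s \<le> ennreal (2 powr s) * ?I"
      by (rule mult_left_mono) simp
    also have "ennreal (2 powr s) * ennreal (e / 2) epowr s = ennreal e epowr s"
      using real by (simp add: powr_divide ennreal_mult[symmetric])
    finally show ?thesis using real by simp
  next
    case top
    \<comment> \<open>A set of infinite mass has no median, but the threshold 1 leaves infinite mass
      on which the integrand is at least 1.\<close>
    have "emeasure M (D 1) < top" by (rule order_le_less_trans[OF D]) simp
    then have "emeasure M (E - D 1) = top"
      using split[of 1] top by (auto simp: top_unique)
    then have "?I = top" using I[of 1] by (simp add: top_unique)
    then show ?thesis by (simp add: ennreal_mult_top)
  qed
qed

section \<open>The Hardy inequality for a Borel measure\<close>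

lemma Mplus_indicator: "f \<in> Mplus a b \<Longrightarrow> A \<in> sets borel \<Longrightarrow> (\<lambda>t. f t * indicator A t) \<in> Mplus a b"
proof -
  assume f: "f \<in> Mplus a b" and A: "A \<in> sets borel"
  have [measurable]: "(\<lambda>t. f t * indicator (einterval a b) t) \<in> borel_measurable lebesgue"
    using f by (simp add: Mplus_iff)
  have [measurable]: "A \<in> sets lebesgue" using A by simp
  have "(\<lambda>t. f t * indicator (einterval a b) t * indicator A t) \<in> borel_measurable lebesgue"
    by measurable
  then show ?thesis unfolding Mplus_iff by (simp add: mult_ac)
qed

lemma borel_measurable_primitive [measurable]: "(\<lambda>t. integ a (ereal t) f) \<in> borel_measurable borel"
  using borel_measurable_mono_ennreal[of UNIV "\<lambda>t. integ a (ereal t) f"]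
  by (simp add: integ_mono_interval)

text \<open>One constant for both ranges of q: 2^q is the price of treating \<open>V\<close> as
  constant on a dyadic level, the powers of \<open>geo\<close> come from convolving the level
  energies, and the factor 2 is the constant of the median argument after its root is taken.\<close>

definition KU :: "real \<Rightarrow> real \<Rightarrow> ennreal" where
  "KU p q = ennreal (2 powr q) * 2 * (geo (1 / 2) epowr p * geo (p / 2)) epowr (q / p)"

text \<open>For q < p the factor 2 stems from test functions that capture only half of a level, the
  rest from estimating tails by the masses of levels. For p \<le> q single test functions already
  give 1.\<close>

definition KL :: "real \<Rightarrow> real \<Rightarrow> ennreal" where
  "KL p q = (if p \<le> q then 1 else
    2 * (ennreal (2 powr (p * q / (p - q))) *
      (geo (q / 2) epowr (p / (p - q)) * geo (q * (p / (p - q)) / 2))) epowr ((p - q) / p))"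

lemma KU_less_top: "1 \<le> p \<Longrightarrow> 0 < q \<Longrightarrow> KU p q < top"
  by (auto simp: KU_def ennreal_mult_less_top geo_less_top)

lemma KL_less_top: "1 \<le> p \<Longrightarrow> 0 < q \<Longrightarrow> KL p q < top"
  by (auto simp: KL_def ennreal_mult_less_top geo_less_top)

text \<open>The operator under study maps f to its primitive t \<mapsto> \<integral> f over (a, t),
  with values in L^q(M). The exponent q is not fixed in the locale because the results are used with
  q on the cells and with r for the atomic measure.\<close>

locale hardy_measure =
  fixes p :: real and a b :: ereal and v :: "real \<Rightarrow> real" and M :: "real measure"
  assumes p: "1 \<le> p" and v: "weight a b v"
    and sets_M [measurable_cong, simp]: "sets M = sets borel"
    and AE_interval: "AE t in M. t \<in> einterval a b"
begin

abbreviation Va :: "real \<Rightarrow> ennreal" where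
  "Va t \<equiv> V p v a (ereal t)"

abbreviation tail :: "real \<Rightarrow> ennreal" where
  "tail t \<equiv> emeasure M {t..}"

abbreviation energy :: "(real \<Rightarrow> ennreal) \<Rightarrow> ennreal" where
  "energy f \<equiv> integ a b (\<lambda>t. f t epowr p * ennreal (v t))"

text \<open>Left-open, so that \<open>Va\<close> strictly exceeds 2^j and from any point of the
  level on some function of energy at most 1 has primitive at least 2^j; right-closed, so that
  2^(j+1) is an upper bound. A level is empty when \<open>Va\<close> jumps over its range.\<close>

definition level :: "int \<Rightarrow> real set" where
  "level j = {t \<in> einterval a b. ennreal (2 powr real_of_int j) < Va t \<and> Va t \<le> ennreal (2 powr (real_of_int j + 1))}"

text \<open>Up to the factor 2^q this is the integral of the q-th power of \<open>Va\<close> over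
  the level. These are the coefficients of the diagonal operator.\<close>

definition mass :: "real \<Rightarrow> int \<Rightarrow> ennreal" where
  "mass q j = ennreal (2 powr (real_of_int j * q)) * emeasure M (level j)"

section \<open>Dyadic levels and the primitive on them\<close>

lemma space_M [simp]: "space M = UNIV"
  using sets_eq_imp_space_eq[OF sets_M] by simp

lemma Va_mono:
  assumes "s \<le> t" "t \<in> einterval a b"
  shows "Va s \<le> Va t"
  using assms weight_mono[OF v, of a "ereal t"] p
  by (intro V_mono[where a=a and b="ereal t"]) (auto simp: einterval_iff)

lemma Va_pos: "t \<in> einterval a b \<Longrightarrow> 0 < Va t"
  using p by (intro V_pos weight_mono[OF v]) (auto simp: einterval_iff)

lemma Va_measurable [measurable]: "(\<lambda>t. Va t * indicator (einterval a b) t) \<in> borel_measurable borel"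
  by (rule borel_measurable_mono_ennreal) (auto simp: Va_mono is_interval_einterval)

lemma tail_measurable [measurable]: "tail \<in> borel_measurable borel"
  by (rule borel_measurable_antimono_ennreal) (auto intro!: emeasure_mono)

lemma level_sets [measurable]: "level j \<in> sets borel"
proof -
  have "level j = {t \<in> space borel. t \<in> einterval a b \<and> ennreal (2 powr real_of_int j) < Va t * indicator (einterval a b) t \<and>
      Va t * indicator (einterval a b) t \<le> ennreal (2 powr (real_of_int j + 1))}"
    by (auto simp: level_def)
  also have "\<dots> \<in> sets borel" by measurable
  finally show ?thesis .
qed

lemma disjoint_level: "disjoint_family level"
proof -
  have "i = j" if "t \<in> level i" "t \<in> level j" for t i j
  proof -
    have "ennreal (2 powr real_of_int i) < ennreal (2 powr (real_of_int j + 1))" "ennreal (2 powr real_of_int j) < ennreal (2 powr (real_of_int i + 1))"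
      using that unfolding level_def by (auto intro: less_le_trans)
    then show ?thesis by (simp add: ennreal_less_iff)
  qed
  then show ?thesis by (auto simp: disjoint_family_on_def)
qed

lemma ex1_level:
  assumes "t \<in> einterval a b" "Va t < top"
  shows "\<exists>!j. t \<in> level j"
proof -
  obtain y where y: "Va t = ennreal y" "0 < y"
    using Va_pos[OF assms(1)] assms(2) by (cases "Va t") (auto simp: ennreal_eq_0_iff)
  define j where "j = \<lceil>log 2 y\<rceil> - 1"
  have "real_of_int j < log 2 y" "log 2 y \<le> real_of_int j + 1"
    unfolding j_def by linarith+
  then have "2 powr real_of_int j < y" "y \<le> 2 powr (real_of_int j + 1)"
    using y by (auto simp: less_log_iff log_le_iff)
  then have "t \<in> level j"
    using assms y by (auto simp: level_def ennreal_less_iff ennreal_leI)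
  then show ?thesis using disjoint_level by (auto simp: disjoint_family_on_def)
qed

lemma primitive_level_le:
  assumes f: "f \<in> Mplus a b"
  shows "(\<integral>\<^sup>+ s. f s * indicator (einterval a b) s * indicator (level i) s \<partial>lebesgue) \<le>
    ennreal (2 powr (real_of_int i + 1)) * energy (\<lambda>s. f s * indicator (level i) s) epowr (1 / p)" (is "?L \<le> ?R")
proof -
  let ?g = "\<lambda>s. f s * indicator (einterval a b) s"
  let ?h = "\<lambda>s. f s * indicator (level i) s"
  have g [measurable]: "?g \<in> borel_measurable lebesgue" using f by (simp add: Mplus_iff)
  have h: "?h \<in> Mplus a b" using f by (rule Mplus_indicator) simp
  have "?L = emeasure (density lebesgue ?g) (level i)"
    by (simp add: emeasure_density)
  also have "\<dots> \<le> ?R"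
  \<comment> \<open>The upper bound on \<open>Va\<close> holds at points t of the level, so
    Hoelder's inequality is applied on (a, t) and the level is exhausted by the parts to the left of
    such t.\<close>
  proof (rule emeasure_le_if_lower_segments)
    fix t assume t: "t \<in> level i"
    then have tI: "a < ereal t" "ereal t < b" by (auto simp: level_def einterval_iff)
    have "emeasure (density lebesgue ?g) (level i \<inter> {..t}) =
        (\<integral>\<^sup>+ s. ?g s * indicator (level i \<inter> {..t}) s \<partial>lebesgue)"
      by (simp add: emeasure_density)
    also have "\<dots> \<le> (\<integral>\<^sup>+ s. ?h s * indicator (einterval a t) s \<partial>lebesgue)"
    proof (rule nn_integral_mono_AE)
      have "AE s in lebesgue. s \<noteq> t"
        by (intro AE_I'[of "{t}"]) (auto simp: null_sets_def)
      then show "AE s in lebesgue. ?g s * indicator (level i \<inter> {..t}) s \<le> ?h s * indicator (einterval a t) s"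
        by eventually_elim (auto simp: einterval_iff split: split_indicator)
    qed
    also have "\<dots> = integ a t ?h" by (simp add: integ_eq)
    also have "\<dots> \<le> integ a t (\<lambda>s. ?h s epowr p * ennreal (v s)) epowr (1 / p) * Va t"
      using tI p by (intro integ_le_V weight_mono[OF v] Mplus_mono[OF h]) auto
    also have "\<dots> \<le> energy ?h epowr (1 / p) * ennreal (2 powr (real_of_int i + 1))"
      using t tI p by (intro mult_mono epowr_mono integ_mono_interval) (auto simp: level_def)
    finally show "emeasure (density lebesgue ?g) (level i \<inter> {..t}) \<le> ?R"
      by (simp add: mult.commute)
  qed auto
  finally show ?thesis .
qed

text \<open>Below t only levels i \<le> j occur. Level i contributes at most 2^(i+1) times the p-th
  root of its energy, and 2^(i+1) = 2^(j+1) 2^(-(j-i)) exhibits the geometric kernel.\<close>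

lemma primitive_le_on_level:
  assumes f: "f \<in> Mplus a b" and t: "t \<in> level j"
  shows "integ a (ereal t) f \<le> ennreal (2 powr (real_of_int j + 1)) *
    isum (\<lambda>i. ennreal (2 powr (- 1 * \<bar>real_of_int (j - i)\<bar>)) *
      energy (\<lambda>s. f s * indicator (level i) s) epowr (1 / p))"
proof -
  have tI: "t \<in> einterval a b" and Vt: "Va t < top"
    using t by (auto simp: level_def intro: le_less_trans)
  have ft [measurable]: "f \<in> borel_measurable (lebesgue_on (einterval a t))"
    using Mplus_mono[OF f, of a t] tI by (auto simp: Mplus_def einterval_iff)
  have "integ a t f = isum (\<lambda>i. \<integral>\<^sup>+ s. f s * indicator (level i \<inter> einterval a t) s \<partial>lebesgue_on (einterval a t))"
    unfolding integ_def
  proof (rule nn_integral_partition[OF ft])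
    show "level i \<inter> einterval a t \<in> sets (lebesgue_on (einterval a t))" for i
      by (auto simp: sets_restrict_space_iff)
    show "AE s in lebesgue_on (einterval a t). \<exists>!i. s \<in> level i \<inter> einterval a t"
    proof (rule AE_lebesgue_onI)
      fix s assume s: "s \<in> einterval a t"
      have "\<exists>!i. s \<in> level i"
        using s tI Va_mono[of s t] Vt less_trans[of "ereal s" "ereal t" b]
        by (intro ex1_level) (auto simp: einterval_iff intro: le_less_trans)
      then show "\<exists>!i. s \<in> level i \<inter> einterval a t" using s by simp
    qed
  qed
  also have "\<dots> = isum (\<lambda>i. \<integral>\<^sup>+ s. f s * indicator (level i) s * indicator (einterval a t) s \<partial>lebesgue)"
    by (subst nn_integral_restrict_space) (auto intro!: nn_integral_cong split: split_indicator)
  also have "\<dots> \<le> isum (\<lambda>i. ennreal (2 powr (real_of_int j + 1)) *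
      (ennreal (2 powr (- 1 * \<bar>real_of_int (j - i)\<bar>)) *
      energy (\<lambda>s. f s * indicator (level i) s) epowr (1 / p)))"
  proof (rule isum_mono)
    fix i
    show "(\<integral>\<^sup>+ s. f s * indicator (level i) s * indicator (einterval a t) s \<partial>lebesgue) \<le>
      ennreal (2 powr (real_of_int j + 1)) * (ennreal (2 powr (- 1 * \<bar>real_of_int (j - i)\<bar>)) *
      energy (\<lambda>s. f s * indicator (level i) s) epowr (1 / p))"
    proof (cases "i \<le> j")
      case True
      have "(\<integral>\<^sup>+ s. f s * indicator (level i) s * indicator (einterval a t) s \<partial>lebesgue) \<le>
          (\<integral>\<^sup>+ s. f s * indicator (einterval a b) s * indicator (level i) s \<partial>lebesgue)"
        using tI less_trans[of "ereal _" "ereal t" b]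
        by (intro nn_integral_mono) (auto simp: einterval_iff split: split_indicator)
      also have "\<dots> \<le> ennreal (2 powr (real_of_int i + 1)) * energy (\<lambda>s. f s * indicator (level i) s) epowr (1 / p)"
        by (rule primitive_level_le[OF f])
      also have "ennreal (2 powr (real_of_int i + 1)) =
          ennreal (2 powr (real_of_int j + 1)) * ennreal (2 powr (- 1 * \<bar>real_of_int (j - i)\<bar>))"
        using True by (simp add: ennreal_mult[symmetric] powr_add[symmetric] add.commute)
      finally show ?thesis by (simp add: mult.assoc)
    next
      case False
      have "f s * indicator (level i) s * indicator (einterval a t) s = 0" for s
      proof (rule ccontr)
        assume "f s * indicator (level i) s * indicator (einterval a t) s \<noteq> 0"
        then have s: "s \<in> level i" "s \<le> t"
          by (auto simp: einterval_iff split: split_indicator_asm)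
        then have "ennreal (2 powr real_of_int i) < ennreal (2 powr (real_of_int j + 1))"
          using Va_mono[OF s(2) tI] t unfolding level_def by (auto intro: less_le_trans le_less_trans)
        then show False using False by (simp add: ennreal_less_iff)
      qed
      then have "(\<integral>\<^sup>+ s. f s * indicator (level i) s * indicator (einterval a t) s \<partial>lebesgue) = 0"
        by (simp only: nn_integral_const mult_zero_left)
      then show ?thesis by simp
    qed
  qed
  finally show ?thesis by (simp add: isum_cmult)
qed

lemma isum_energy_level_le:
  assumes f: "f \<in> Mplus a b"
  shows "isum (\<lambda>i. energy (\<lambda>s. f s * indicator (level i) s)) \<le> energy f"
proof -
  let ?L = "lebesgue_on (einterval a b)"
  have E: "(\<lambda>t. f t epowr p * ennreal (v t)) \<in> borel_measurable ?L"
    using Mplus_energy[OF f v] by (simp add: Mplus_def)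
  have "energy (\<lambda>s. f s * indicator (level i) s) =
      (\<integral>\<^sup>+ s. (f s epowr p * ennreal (v s)) * indicator (level i) s \<partial>?L)" for i
    unfolding integ_def by (intro nn_integral_cong) (auto split: split_indicator)
  then have "isum (\<lambda>i. energy (\<lambda>s. f s * indicator (level i) s)) =
      isum (\<lambda>i. \<integral>\<^sup>+ s. (f s epowr p * ennreal (v s)) * indicator (level i) s \<partial>?L)" by simp
  also have "\<dots> \<le> (\<integral>\<^sup>+ s. f s epowr p * ennreal (v s) \<partial>?L)"
  proof (rule isum_nn_integral_disjoint_le[OF E _ disjoint_level])
    show "level j \<in> sets ?L" for j
      by (auto simp: sets_restrict_space_iff level_def[symmetric]) (auto simp: level_def)
  qed
  finally show ?thesis by (simp add: integ_def)
qed

lemma AE_level: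
  assumes "AE t in M. Va t < top"
  shows "AE t in M. \<exists>!j. t \<in> level j"
  using assms AE_interval by eventually_elim (rule ex1_level)

text \<open>Level energies after convolution, as p-th powers. By \<open>isum_smooth_le\<close> their
  total is controlled by the energy of f, so they can serve as the sequence \<open>h\<close> of the
  diagonal estimates.\<close>

definition smooth :: "(real \<Rightarrow> ennreal) \<Rightarrow> int \<Rightarrow> ennreal" where
  "smooth f j = isum (\<lambda>i. ennreal (2 powr (- 1 * \<bar>real_of_int (j - i)\<bar>)) *
      energy (\<lambda>s. f s * indicator (level i) s) epowr (1 / p)) epowr p"

lemma isum_smooth_le:
  assumes "f \<in> Mplus a b"
  shows "isum (smooth f) \<le> geo (1 / 2) epowr p * geo (p / 2) * energy f"
proof -
  have "isum (smooth f) \<le> geo (1 / 2) epowr p * geo (1 * p / 2) *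
      isum (\<lambda>i. (energy (\<lambda>s. f s * indicator (level i) s) epowr (1 / p)) epowr p)"
    unfolding smooth_def using p by (intro isum_convolution) auto
  also have "\<dots> \<le> geo (1 / 2) epowr p * geo (p / 2) * energy f"
    using p isum_energy_level_le[OF assms] by (auto intro!: mult_left_mono)
  finally show ?thesis .
qed

lemma integral_primitive_le:
  assumes f: "f \<in> Mplus a b" and q: "0 < q" and fin: "AE t in M. Va t < top"
  shows "(\<integral>\<^sup>+ t. integ a (ereal t) f epowr q \<partial>M) \<le>
    ennreal (2 powr q) * isum (\<lambda>j. mass q j * smooth f j epowr (q / p))"
proof -
  have "(\<integral>\<^sup>+ t. integ a (ereal t) f epowr q \<partial>M) =
      isum (\<lambda>j. \<integral>\<^sup>+ t. integ a (ereal t) f epowr q * indicator (level j) t \<partial>M)"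
    by (rule nn_integral_partition[OF _ _ AE_level[OF fin]]) auto
  also have "\<dots> \<le> isum (\<lambda>j. ennreal (2 powr q) * (mass q j * smooth f j epowr (q / p)))"
  proof (rule isum_mono)
    fix j
    have "(\<integral>\<^sup>+ t. integ a (ereal t) f epowr q * indicator (level j) t \<partial>M) \<le>
        (\<integral>\<^sup>+ t. (ennreal (2 powr (real_of_int j + 1)) * smooth f j epowr (1 / p)) epowr q * indicator (level j) t \<partial>M)"
    proof (rule nn_integral_mono)
      fix t
      show "integ a (ereal t) f epowr q * indicator (level j) t \<le>
          (ennreal (2 powr (real_of_int j + 1)) * smooth f j epowr (1 / p)) epowr q * indicator (level j) t"
      proof (cases "t \<in> level j")
        case True
        then show ?thesis
          using primitive_le_on_level[OF f True] p q
          by (simp add: smooth_def epowr_mono)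
      qed simp
    qed
    also have "\<dots> = (ennreal (2 powr (real_of_int j + 1)) * smooth f j epowr (1 / p)) epowr q * emeasure M (level j)"
      by (rule nn_integral_cmult_indicator) simp
    also have "\<dots> = ennreal (2 powr q) * (mass q j * smooth f j epowr (q / p))"
    proof -
      have "ennreal (2 powr (real_of_int j + 1)) epowr q = ennreal (2 powr q) * ennreal (2 powr (real_of_int j * q))"
        by (simp add: powr_powr ennreal_mult[symmetric] powr_add[symmetric] algebra_simps)
      then show ?thesis
        by (simp add: epowr_mult epowr_epowr mass_def mult_ac)
    qed
    finally show "(\<integral>\<^sup>+ t. integ a (ereal t) f epowr q * indicator (level j) t \<partial>M) \<le>
        ennreal (2 powr q) * (mass q j * smooth f j epowr (q / p))" .
  qed
  finally show ?thesis by (simp add: isum_cmult)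
qed

text \<open>For t in level j, the part of the level beyond t weighs at most \<open>tail t\<close>,
  while \<open>Va t\<close> exceeds 2^j; exhaustion by such parts covers the level.\<close>

lemma mass_le:
  assumes B: "AE t in M. tail t * Va t epowr q \<le> B" and q: "0 < q"
  shows "mass q j \<le> B"
proof -
  \<comment> \<open>The hypothesis holds almost everywhere only, so the segments have to start at
    good points. The indicator makes this set Borel.\<close>
  define G where "G = level j \<inter> {t. tail t * (Va t * indicator (einterval a b) t) epowr q \<le> B}"
  have G [measurable]: "G \<in> sets M" unfolding G_def by measurable
  have "emeasure M (level j) = emeasure M G"
  proof (rule emeasure_eq_AE)
    show "AE t in M. (t \<in> level j) = (t \<in> G)"
      using B by eventually_elim (auto simp: G_def level_def)
  qed (use G in auto)
  also have "\<dots> \<le> ennreal (2 powr (- real_of_int j * q)) * B"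
  proof (rule emeasure_le_if_upper_segments[OF _ G])
    fix t assume t: "t \<in> G"
    then have tI: "t \<in> einterval a b" and tG: "tail t * Va t epowr q \<le> B"
      and Vt: "ennreal (2 powr real_of_int j) \<le> Va t"
      by (auto simp: G_def level_def)
    have "emeasure M (G \<inter> {t..}) \<le> tail t" by (intro emeasure_mono) auto
    also have "tail t = ennreal (2 powr (- real_of_int j * q)) * (tail t * ennreal (2 powr real_of_int j) epowr q)"
    proof -
      have "ennreal (2 powr (- real_of_int j * q)) * ennreal (2 powr (real_of_int j * q)) = 1"
        by (simp add: ennreal_mult[symmetric] powr_add[symmetric])
      then have "tail t = ennreal (2 powr (- real_of_int j * q)) * ennreal (2 powr (real_of_int j * q)) * tail t" by simp
      then show ?thesis
        by (simp add: powr_powr mult_ac)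
    qed
    also have "\<dots> \<le> ennreal (2 powr (- real_of_int j * q)) * (tail t * Va t epowr q)"
      using Vt q by (intro mult_left_mono epowr_mono) auto
    also have "\<dots> \<le> ennreal (2 powr (- real_of_int j * q)) * B"
      using tG by (intro mult_left_mono) auto
    finally show "emeasure M (G \<inter> {t..}) \<le> ennreal (2 powr (- real_of_int j * q)) * B" .
  qed simp
  finally have "mass q j \<le> ennreal (2 powr (real_of_int j * q)) * (ennreal (2 powr (- real_of_int j * q)) * B)"
    unfolding mass_def by (rule mult_left_mono) simp
  also have "\<dots> = B"
    by (simp add: mult.assoc[symmetric] ennreal_mult[symmetric] powr_add[symmetric])
  finally show ?thesis .
qed

text \<open>A finite \<open>B\<close> forces the tail to vanish wherever \<open>Va\<close> is
  infinite, and by exhaustion a set of points with vanishing tails is null.\<close>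

lemma AE_Va_finite_of_sup:
  assumes B: "AE t in M. tail t * Va t epowr q \<le> B" "B < top"
  shows "AE t in M. Va t < top"
proof -
  define G where "G = {t. Va t * indicator (einterval a b) t = top \<and> tail t = 0}"
  have G [measurable]: "G \<in> sets M" unfolding G_def by measurable
  have "emeasure M G \<le> 0"
  proof (rule emeasure_le_if_upper_segments[OF _ G])
    fix t assume t: "t \<in> G"
    have "emeasure M (G \<inter> {t..}) \<le> tail t" by (intro emeasure_mono) auto
    then show "emeasure M (G \<inter> {t..}) \<le> 0" using t by (simp add: G_def)
  qed simp
  then have "AE t in M. t \<notin> G"
    using G by (intro AE_not_in) (auto simp: null_sets_def)
  then show ?thesis using B(1) AE_interval
  proof eventually_elim
    fix t assume *: "t \<notin> G" "tail t * Va t epowr q \<le> B" "t \<in> einterval a b"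
    show "Va t < top"
    proof (rule ccontr)
      assume "\<not> Va t < top"
      then have "Va t = top" using less_top by blast
      with * B(2) show False
        by (auto simp: G_def ennreal_mult_top top_unique split: if_splits)
    qed
  qed
qed

lemma upper_sup:
  assumes f: "f \<in> Mplus a b" and q: "p \<le> q"
    and B: "AE t in M. tail t * Va t epowr q \<le> B" "B < top"
  shows "(\<integral>\<^sup>+ t. integ a (ereal t) f epowr q \<partial>M) \<le> KU p q * B * energy f epowr (q / p)"
proof -
  have q0: "0 < q" and qp: "1 \<le> q / p" using p q by auto
  have "(\<integral>\<^sup>+ t. integ a (ereal t) f epowr q \<partial>M) \<le>
      ennreal (2 powr q) * isum (\<lambda>j. mass q j * smooth f j epowr (q / p))"
    by (rule integral_primitive_le[OF f q0 AE_Va_finite_of_sup[OF B]])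
  also have "\<dots> \<le> ennreal (2 powr q) * (B * isum (smooth f) epowr (q / p))"
    by (intro mult_left_mono diagonal_le_sup[OF mass_le[OF B(1) q0] qp]) simp
  also have "\<dots> \<le> ennreal (2 powr q) * (B * (geo (1 / 2) epowr p * geo (p / 2) * energy f) epowr (q / p))"
    using qp by (intro mult_left_mono epowr_mono isum_smooth_le[OF f]) auto
  \<comment> \<open>The literal 1 marks the place of the factor 2 in \<open>KU\<close>, so that the
    next step is plain monotonicity.\<close>
  also have "\<dots> = (ennreal (2 powr q) * 1 * (geo (1 / 2) epowr p * geo (p / 2)) epowr (q / p)) * B * energy f epowr (q / p)"
    by (simp add: epowr_mult mult_ac)
  also have "\<dots> \<le> KU p q * B * energy f epowr (q / p)"
    unfolding KU_def by (intro mult_right_mono mult_left_mono) auto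
  finally show ?thesis .
qed

lemma test_function:
  assumes t: "t \<in> einterval a b" and \<kappa>: "\<kappa> < Va t"
  obtains f where "f \<in> Mplus a b" "energy f \<le> 1" "\<And>s. t \<le> s \<Longrightarrow> \<kappa> \<le> integ a (ereal s) f"
proof -
  have ab: "a < ereal t" "ereal t < b" using t by (auto simp: einterval_iff)
  obtain f where f: "f \<in> borel_measurable lebesgue" "\<And>s. s \<notin> einterval a t \<Longrightarrow> f s = 0"
    "integ a t (\<lambda>t. f t epowr p * ennreal (v t)) \<le> 1" "\<kappa> \<le> integ a t f"
    using V_saturated[OF weight_mono[OF v order_refl less_imp_le[OF ab(2)]] p \<kappa>] by blast
  show ?thesis
  proof (rule that[of f])
    show "f \<in> Mplus a b" by (rule borel_measurable_lebesgue_Mplus[OF f(1)])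
    have "energy f = integ a t (\<lambda>t. f t epowr p * ennreal (v t))"
      unfolding integ_eq using f(2) ab less_trans[of "ereal _" "ereal t" b]
      by (intro nn_integral_cong) (auto simp: einterval_iff split: split_indicator)
    then show "energy f \<le> 1" using f(3) by simp
    show "\<kappa> \<le> integ a (ereal s) f" if "t \<le> s" for s
      using f(4) integ_mono_interval[of a a "ereal t" "ereal s" f] that by (auto intro: order_trans)
  qed
qed

text \<open>A function saturating \<open>V\<close> on (a, t) keeps its primitive beyond t, so the
  whole tail is counted. Passing to the supremum over \<kappa> < \<open>Va t\<close> also covers an
  infinite \<open>Va t\<close>.\<close>

lemma lower_sup:
  assumes q: "0 < q"
    and B: "\<And>f. f \<in> Mplus a b \<Longrightarrow> energy f \<le> 1 \<Longrightarrow> (\<integral>\<^sup>+ t. integ a (ereal t) f epowr q \<partial>M) \<le> B"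
    and t: "t \<in> einterval a b"
  shows "tail t * Va t epowr q \<le> B"
proof -
  have *: "tail t * \<kappa> epowr q \<le> B" if \<kappa>: "\<kappa> < Va t" for \<kappa>
  proof -
    obtain f where f: "f \<in> Mplus a b" "energy f \<le> 1" "\<And>s. t \<le> s \<Longrightarrow> \<kappa> \<le> integ a (ereal s) f"
      using test_function[OF t \<kappa>] by blast
    have "tail t * \<kappa> epowr q = (\<integral>\<^sup>+ s. \<kappa> epowr q * indicator {t..} s \<partial>M)"
      by (simp add: nn_integral_cmult_indicator mult.commute)
    also have "\<dots> \<le> (\<integral>\<^sup>+ s. integ a (ereal s) f epowr q \<partial>M)"
      using f(3) q by (intro nn_integral_mono) (auto simp: epowr_mono split: split_indicator)
    also have "\<dots> \<le> B" by (rule B[OF f(1,2)])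
    finally show ?thesis .
  qed
  have "Va t = (SUP \<kappa>\<in>{..<Va t}. \<kappa>)"
  proof (rule antisym)
    show "Va t \<le> (SUP \<kappa>\<in>{..<Va t}. \<kappa>)"
      by (rule dense_le) (auto intro: SUP_upper)
  qed (auto intro: SUP_least)
  then have "tail t * Va t epowr q = tail t * (SUP \<kappa>\<in>{..<Va t}. \<kappa>) epowr q" by simp
  also have "\<dots> = (SUP \<kappa>\<in>{..<Va t}. tail t * \<kappa> epowr q)"
    unfolding epowr_SUP[OF q] by (simp only: SUP_mult_left_ennreal)
  also have "\<dots> \<le> B" using * by (auto intro: SUP_least)
  finally show ?thesis .
qed

text \<open>Maz'ya's functional for q < p, before its root is taken: for the measure u dt on a cell,
  its power (p-q)/(pq) is the local factor in \<open>A3\<close>.\<close>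

abbreviation mazya :: "real \<Rightarrow> ennreal" where
  "mazya q \<equiv> \<integral>\<^sup>+ t. tail t epowr (q / (p - q)) * Va t epowr (p * q / (p - q)) \<partial>M"

lemma mazya_eq:
  "mazya q = (\<integral>\<^sup>+ t. tail t epowr (q / (p - q)) *
      (Va t * indicator (einterval a b) t) epowr (p * q / (p - q)) \<partial>M)"
  by (rule nn_integral_cong_AE, use AE_interval in eventually_elim) simp

text \<open>On the set where \<open>Va\<close> is infinite the integrand is infinite unless the tail
  vanishes. So the tail integral over that set is 0, and the median argument makes the set
  null.\<close>

lemma AE_Va_finite_of_mazya:
  assumes q: "0 < q" "q < p" and B: "mazya q < top"
  shows "AE t in M. Va t < top"
proof -
  define s where "s = p / (p - q)"
  have s: "1 < s" "s - 1 = q / (p - q)" using q by (auto simp: s_def field_simps)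
  define G where "G = {t. Va t * indicator (einterval a b) t = top}"
  have [measurable]: "G \<in> sets M" unfolding G_def by measurable
  let ?J = "\<integral>\<^sup>+ t. emeasure M (G \<inter> {t..}) epowr (s - 1) * indicator G t \<partial>M"
  have [measurable]: "(\<lambda>t. emeasure M (G \<inter> {t..})) \<in> borel_measurable borel"
    using \<open>G \<in> sets M\<close> by (intro borel_measurable_antimono_ennreal emeasure_mono) auto
  have "?J * top = (\<integral>\<^sup>+ t. emeasure M (G \<inter> {t..}) epowr (s - 1) * indicator G t * top \<partial>M)"
    by (rule nn_integral_multc[symmetric]) measurable
  also have "\<dots> \<le> mazya q"
    unfolding mazya_eq
  proof (rule nn_integral_mono)
    fix t
    have *: "emeasure M (G \<inter> {t..}) epowr (s - 1) \<le> tail t epowr (q / (p - q))"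
      unfolding s(2) using q by (intro epowr_mono emeasure_mono) auto
    show "emeasure M (G \<inter> {t..}) epowr (s - 1) * indicator G t * top \<le>
        tail t epowr (q / (p - q)) * (Va t * indicator (einterval a b) t) epowr (p * q / (p - q))"
    proof (cases "t \<in> G")
      case True
      then have "Va t * indicator (einterval a b) t = top" by (simp add: G_def)
      then show ?thesis using * True by (simp add: mult_right_mono)
    qed simp
  qed
  finally have "?J * top < top" using B by (rule le_less_trans)
  then have "?J = 0" by (simp add: ennreal_mult_top split: if_splits)
  then have "emeasure M G epowr s \<le> 0"
    using emeasure_epowr_le_tail_integral[OF sets_M \<open>G \<in> sets M\<close> s(1)] by simp
  then have "AE t in M. t \<notin> G"
    using \<open>G \<in> sets M\<close> by (intro AE_not_in) (auto simp: null_sets_def)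
  then show ?thesis using AE_interval
  proof eventually_elim
    fix t assume "t \<notin> G" "t \<in> einterval a b"
    then have "Va t \<noteq> top" by (simp add: G_def)
    then show "Va t < top" unfolding less_top .
  qed
qed

text \<open>The median argument on each level, with s = p/(p-q) chosen so that s - 1 is the exponent
  of the tail in \<open>mazya\<close>. Restricting the tail to the level and replacing
  \<open>Va\<close> by 2^j only decreases the integrand.\<close>

lemma isum_mass_le_mazya:
  assumes q: "0 < q" "q < p"
  shows "isum (\<lambda>j. mass q j epowr (p / (p - q))) \<le> ennreal (2 powr (p / (p - q))) * mazya q"
proof -
  define s where "s = p / (p - q)"
  have s: "1 < s" "s - 1 = q / (p - q)" "q * s = p * q / (p - q)"
    using q by (auto simp: s_def field_simps)
  let ?h = "\<lambda>t. tail t epowr (s - 1) * (Va t * indicator (einterval a b) t) epowr (q * s)"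
  have "mass q j epowr s \<le> ennreal (2 powr s) * (\<integral>\<^sup>+ t. ?h t * indicator (level j) t \<partial>M)" for j
  proof -
    have [measurable]: "(\<lambda>t. emeasure M (level j \<inter> {t..})) \<in> borel_measurable borel"
      by (intro borel_measurable_antimono_ennreal emeasure_mono) auto
    have "mass q j epowr s = ennreal (2 powr real_of_int j) epowr (q * s) * emeasure M (level j) epowr s"
      by (simp add: mass_def epowr_mult powr_powr mult_ac)
    also have "\<dots> \<le> ennreal (2 powr real_of_int j) epowr (q * s) * (ennreal (2 powr s) *
        (\<integral>\<^sup>+ t. emeasure M (level j \<inter> {t..}) epowr (s - 1) * indicator (level j) t \<partial>M))"
      using s by (intro mult_left_mono emeasure_epowr_le_tail_integral) auto
    also have "\<dots> = ennreal (2 powr s) * (\<integral>\<^sup>+ t. ennreal (2 powr real_of_int j) epowr (q * s) *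
        (emeasure M (level j \<inter> {t..}) epowr (s - 1) * indicator (level j) t) \<partial>M)"
      by (subst nn_integral_cmult) (auto simp: mult.left_commute)
    also have "\<dots> \<le> ennreal (2 powr s) * (\<integral>\<^sup>+ t. ?h t * indicator (level j) t \<partial>M)"
    proof (intro mult_left_mono nn_integral_mono)
      fix t
      show "ennreal (2 powr real_of_int j) epowr (q * s) *
        (emeasure M (level j \<inter> {t..}) epowr (s - 1) * indicator (level j) t) \<le> ?h t * indicator (level j) t"
      proof (cases "t \<in> level j")
        case True
        then have "ennreal (2 powr real_of_int j) \<le> Va t * indicator (einterval a b) t"
          by (auto simp: level_def)
        then have "ennreal (2 powr real_of_int j) epowr (q * s) * emeasure M (level j \<inter> {t..}) epowr (s - 1)
            \<le> (Va t * indicator (einterval a b) t) epowr (q * s) * tail t epowr (s - 1)"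
          using s q by (intro mult_mono epowr_mono emeasure_mono) auto
        then show ?thesis using True by (simp add: mult.commute)
      qed simp
    qed simp
    finally show ?thesis .
  qed
  then have "isum (\<lambda>j. mass q j epowr s) \<le>
      isum (\<lambda>j. ennreal (2 powr s) * (\<integral>\<^sup>+ t. ?h t * indicator (level j) t \<partial>M))"
    by (rule isum_mono)
  also have "\<dots> \<le> ennreal (2 powr s) * (\<integral>\<^sup>+ t. ?h t \<partial>M)"
    unfolding isum_cmult
    by (intro mult_left_mono isum_nn_integral_disjoint_le disjoint_level) auto
  also have "(\<integral>\<^sup>+ t. ?h t \<partial>M) = mazya q" unfolding mazya_eq s(2,3) ..
  finally show ?thesis by (simp add: s_def)
qed

lemma upper_mazya:
  assumes f: "f \<in> Mplus a b" and q: "0 < q" "q < p" and B: "mazya q < top"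
  shows "(\<integral>\<^sup>+ t. integ a (ereal t) f epowr q \<partial>M) \<le>
    KU p q * mazya q epowr ((p - q) / p) * energy f epowr (q / p)"
proof -
  have \<theta>: "0 < q / p" "q / p < 1" "1 / (1 - q / p) = p / (p - q)" "1 - q / p = (p - q) / p"
    using q by (auto simp: field_simps)
  have "(\<integral>\<^sup>+ t. integ a (ereal t) f epowr q \<partial>M) \<le>
      ennreal (2 powr q) * isum (\<lambda>j. mass q j * smooth f j epowr (q / p))"
    by (rule integral_primitive_le[OF f q(1) AE_Va_finite_of_mazya[OF q B]])
  also have "\<dots> \<le> ennreal (2 powr q) *
      (isum (\<lambda>j. mass q j epowr (p / (p - q))) epowr ((p - q) / p) * isum (smooth f) epowr (q / p))"
    using diagonal_le_sum[OF \<theta>(1,2), of "mass q" "smooth f"]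
    unfolding \<theta>(3) unfolding \<theta>(4) by (rule mult_left_mono) simp
  also have "\<dots> \<le> ennreal (2 powr q) *
      ((ennreal (2 powr (p / (p - q))) * mazya q) epowr ((p - q) / p) *
       (geo (1 / 2) epowr p * geo (p / 2) * energy f) epowr (q / p))"
    using q \<theta> by (intro mult_left_mono mult_mono epowr_mono isum_smooth_le[OF f] isum_mass_le_mazya) auto
  also have "(ennreal (2 powr (p / (p - q))) * mazya q) epowr ((p - q) / p) = 2 * mazya q epowr ((p - q) / p)"
    using q by (simp add: epowr_mult powr_powr)
  finally show ?thesis
    by (simp add: KU_def epowr_mult mult_ac)
qed

text \<open>Beyond t only levels i \<ge> j occur, and 2^(jq) = 2^(-q(i-j)) 2^(iq): up to scaling,
  the tail is dominated by a convolution of the masses.\<close>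

lemma tail_le_on_level:
  assumes fin: "AE t in M. Va t < top" and t: "t \<in> level j"
  shows "ennreal (2 powr (real_of_int j * q)) * tail t \<le>
    isum (\<lambda>i. ennreal (2 powr (- q * \<bar>real_of_int (j - i)\<bar>)) * mass q i)"
proof -
  have tI: "t \<in> einterval a b" using t by (simp add: level_def)
  have "tail t = (\<integral>\<^sup>+ s. indicator {t..} s \<partial>M)" by simp
  also have "\<dots> = isum (\<lambda>i. \<integral>\<^sup>+ s. indicator {t..} s * indicator (level i) s \<partial>M)"
    by (rule nn_integral_partition[OF _ _ AE_level[OF fin]]) auto
  finally have "ennreal (2 powr (real_of_int j * q)) * tail t =
      isum (\<lambda>i. ennreal (2 powr (real_of_int j * q)) * (\<integral>\<^sup>+ s. indicator {t..} s * indicator (level i) s \<partial>M))"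
    by (simp add: isum_cmult)
  also have "\<dots> \<le> isum (\<lambda>i. ennreal (2 powr (- q * \<bar>real_of_int (j - i)\<bar>)) * mass q i)"
  proof (rule isum_mono)
    fix i
    show "ennreal (2 powr (real_of_int j * q)) * (\<integral>\<^sup>+ s. indicator {t..} s * indicator (level i) s \<partial>M) \<le>
        ennreal (2 powr (- q * \<bar>real_of_int (j - i)\<bar>)) * mass q i"
    proof (cases "j \<le> i")
      case True
      have "(\<integral>\<^sup>+ s. indicator {t..} s * indicator (level i) s \<partial>M) \<le> (\<integral>\<^sup>+ s. indicator (level i) s \<partial>M)"
        by (intro nn_integral_mono) (auto split: split_indicator)
      then have *: "ennreal (2 powr (real_of_int j * q)) * (\<integral>\<^sup>+ s. indicator {t..} s * indicator (level i) s \<partial>M)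
          \<le> ennreal (2 powr (real_of_int j * q)) * emeasure M (level i)"
        by (intro mult_left_mono) auto
      have "real_of_int j * q = - q * \<bar>real_of_int (j - i)\<bar> + real_of_int i * q"
        using True by (simp add: algebra_simps)
      then have "ennreal (2 powr (real_of_int j * q)) =
          ennreal (2 powr (- q * \<bar>real_of_int (j - i)\<bar>)) * ennreal (2 powr (real_of_int i * q))"
        by (simp only: powr_add ennreal_mult powr_ge_zero)
      then have "ennreal (2 powr (real_of_int j * q)) * emeasure M (level i) =
          ennreal (2 powr (- q * \<bar>real_of_int (j - i)\<bar>)) * mass q i"
        by (simp only: mass_def mult.assoc)
      with * show ?thesis by (simp only:)
    next
      case False
      have "indicator {t..} s * indicator (level i) s = (0::ennreal)" for s
      proof (rule ccontr)
        assume "indicator {t..} s * indicator (level i) s \<noteq> (0::ennreal)"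
        then have s: "s \<in> level i" "t \<le> s" by (auto split: split_indicator_asm)
        then have "ennreal (2 powr real_of_int j) < ennreal (2 powr (real_of_int i + 1))"
          using Va_mono[OF s(2)] t unfolding level_def by (auto intro: less_le_trans le_less_trans)
        then show False using False by (simp add: ennreal_less_iff)
      qed
      then have "(\<integral>\<^sup>+ s. indicator {t..} s * indicator (level i) s \<partial>M) = 0"
        by (simp only: nn_integral_const mult_zero_left)
      then show ?thesis by simp
    qed
  qed
  finally show ?thesis .
qed

text \<open>On level j replace \<open>Va\<close> by 2^(j+1) and write 2^(jqs) = e e^(s-1) with e =
  2^(jq): the first factor turns the measure of the level into its mass, the second turns the power
  of the tail into a power of the convolution \<open>R\<close>. The mass itself is a term of
  \<open>R\<close>, so boundedness of the convolution in exponent s finishes.\<close>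

lemma mazya_le_isum_mass:
  assumes q: "0 < q" "q < p" and fin: "AE t in M. Va t < top"
  shows "mazya q \<le> ennreal (2 powr (p * q / (p - q))) *
    (geo (q / 2) epowr (p / (p - q)) * geo (q * (p / (p - q)) / 2)) *
    isum (\<lambda>j. mass q j epowr (p / (p - q)))"
proof -
  define s where "s = p / (p - q)"
  have s: "1 < s" "s - 1 = q / (p - q)" "q * s = p * q / (p - q)"
    using q by (auto simp: s_def field_simps)
  define R where "R = (\<lambda>j. isum (\<lambda>i. ennreal (2 powr (- q * \<bar>real_of_int (j - i)\<bar>)) * mass q i))"
  let ?h = "\<lambda>t. tail t epowr (s - 1) * (Va t * indicator (einterval a b) t) epowr (q * s)"
  have inv: "ennreal (2 powr (- (real_of_int j * q))) * ennreal (2 powr (real_of_int j * q)) = 1" for j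
    by (simp add: ennreal_mult[symmetric] powr_add[symmetric])
  have "mazya q = (\<integral>\<^sup>+ t. ?h t \<partial>M)" unfolding mazya_eq s(2,3) ..
  also have "\<dots> = isum (\<lambda>j. \<integral>\<^sup>+ t. ?h t * indicator (level j) t \<partial>M)"
    by (rule nn_integral_partition[OF _ _ AE_level[OF fin]]) auto
  also have "\<dots> \<le> isum (\<lambda>j. ennreal (2 powr (q * s)) * R j epowr s)"
  proof (rule isum_mono)
    fix j
    let ?e = "ennreal (2 powr (real_of_int j * q))"
    let ?k = "ennreal (2 powr (q * s)) * (?e * R j epowr (s - 1))"
    have "(\<integral>\<^sup>+ t. ?h t * indicator (level j) t \<partial>M) \<le> (\<integral>\<^sup>+ t. ?k * indicator (level j) t \<partial>M)"
    proof (rule nn_integral_mono)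
      fix t
      show "?h t * indicator (level j) t \<le> ?k * indicator (level j) t"
      proof (cases "t \<in> level j")
        case True
        have "?h t \<le> tail t epowr (s - 1) * ennreal (2 powr (real_of_int j + 1)) epowr (q * s)"
          using True s q by (intro mult_left_mono epowr_mono) (auto simp: level_def)
        also have "ennreal (2 powr (real_of_int j + 1)) epowr (q * s) =
            ennreal (2 powr (q * s)) * (?e * ?e epowr (s - 1))"
        proof -
          have "?e * ?e epowr (s - 1) = ?e epowr s"
            using epowr_add[of ?e 1 "s - 1"] by simp
          then show ?thesis
            by (simp add: powr_powr ennreal_mult[symmetric] powr_add[symmetric] algebra_simps)
        qed
        also have "tail t epowr (s - 1) * (ennreal (2 powr (q * s)) * (?e * ?e epowr (s - 1))) =
            ennreal (2 powr (q * s)) * (?e * (?e * tail t) epowr (s - 1))"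
          by (simp add: epowr_mult mult_ac)
        also have "\<dots> \<le> ?k"
          unfolding R_def using s by (intro mult_left_mono epowr_mono tail_le_on_level[OF fin True]) auto
        finally show ?thesis using True by simp
      qed simp
    qed
    also have "\<dots> = ?k * emeasure M (level j)"
      by (rule nn_integral_cmult_indicator) simp
    also have "\<dots> = ennreal (2 powr (q * s)) * (R j epowr (s - 1) * mass q j)"
      by (simp add: mass_def mult_ac)
    also have "\<dots> \<le> ennreal (2 powr (q * s)) * (R j epowr (s - 1) * R j)"
    proof -
      have "mass q j \<le> R j"
        using le_isum[of "\<lambda>i. ennreal (2 powr (- q * \<bar>real_of_int (j - i)\<bar>)) * mass q i" j]
        by (simp add: R_def)
      then show ?thesis by (intro mult_left_mono) auto
    qed
    also have "R j epowr (s - 1) * R j = R j epowr s"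
      using epowr_add[of "R j" "s - 1" 1] by simp
    finally show "(\<integral>\<^sup>+ t. ?h t * indicator (level j) t \<partial>M) \<le> ennreal (2 powr (q * s)) * R j epowr s" .
  qed
  also have "\<dots> \<le> ennreal (2 powr (q * s)) *
      (geo (q / 2) epowr s * geo (q * s / 2) * isum (\<lambda>j. mass q j epowr s))"
    unfolding isum_cmult R_def using q s by (intro mult_left_mono isum_convolution) auto
  finally show ?thesis unfolding s_def[symmetric] s(3)[symmetric] by (simp add: mult.assoc)
qed

text \<open>Each level gets a function whose primitive reaches 2^j on at least half of the level.
  Merging these with arbitrary weights reduces the claim to the converse for diagonal
  operators.\<close>

lemma lower_mazya:
  assumes q: "0 < q" "q < p" and Btop: "B < top"
    and B: "\<And>f. f \<in> Mplus a b \<Longrightarrow> energy f \<le> 1 \<Longrightarrow> (\<integral>\<^sup>+ t. integ a (ereal t) f epowr q \<partial>M) \<le> B"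
  shows "mazya q epowr ((p - q) / p) \<le> KL p q * B"
proof -
  have \<theta>: "0 < q / p" "q / p < 1" "1 / (1 - q / p) = p / (p - q)"
    using q by (auto simp: field_simps)
  have sup: "AE t in M. tail t * Va t epowr q \<le> B"
    using AE_interval by eventually_elim (rule lower_sup[OF q(1) B])
  define Q where "Q = (\<lambda>j f D. f \<in> Mplus a b \<and> energy f \<le> 1 \<and> D \<in> sets M \<and> D \<subseteq> level j \<and>
      emeasure M (level j) \<le> 2 * emeasure M D \<and> (\<forall>t\<in>D. ennreal (2 powr real_of_int j) \<le> integ a (ereal t) f))"
  have "\<exists>f D. Q j f D" for j
  proof (cases "emeasure M (level j) = 0")
    case True
    have "energy (\<lambda>t. 0) \<le> 1" by (simp add: integ_def)
    then show ?thesis using True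
      by (intro exI[of _ "\<lambda>t. 0"] exI[of _ "{}"]) (simp add: Q_def Mplus_def)
  next
    case False
    have "mass q j < top" using mass_le[OF sup q(1), of j] Btop by (rule le_less_trans)
    then have "emeasure M (level j) < top"
      by (auto simp: mass_def ennreal_mult_less_top)
    then obtain m where m: "emeasure M (level j) = ennreal m" "0 < m"
      using False by (cases "emeasure M (level j)") (auto simp: ennreal_eq_0_iff)
    \<comment> \<open>Otherwise exhaustion would bound the mass m of the level by m/2. Finiteness of
      m comes from the supremum bound \<open>sup\<close> and the finite \<open>B\<close>.\<close>
    have "\<exists>\<tau>\<in>level j. ennreal (m / 2) < emeasure M (level j \<inter> {\<tau>..})"
    proof (rule ccontr)
      assume "\<not> ?thesis"
      then have "emeasure M (level j \<inter> {t..}) \<le> ennreal (m / 2)" if "t \<in> level j" for t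
        using that not_le by blast
      then have "emeasure M (level j) \<le> ennreal (m / 2)"
        by (rule emeasure_le_if_upper_segments[rotated 2]) simp_all
      then show False using m by (simp add: ennreal_le_iff)
    qed
    then obtain \<tau> where \<tau>: "\<tau> \<in> level j" "ennreal (m / 2) < emeasure M (level j \<inter> {\<tau>..})" by blast
    then have "\<tau> \<in> einterval a b" "ennreal (2 powr real_of_int j) < Va \<tau>" by (auto simp: level_def)
    then obtain f where f: "f \<in> Mplus a b" "energy f \<le> 1"
      "\<And>s. \<tau> \<le> s \<Longrightarrow> ennreal (2 powr real_of_int j) \<le> integ a (ereal s) f"
      using test_function[of \<tau> "ennreal (2 powr real_of_int j)"] by blast
    have "emeasure M (level j) = 2 * ennreal (m / 2)"
      using m ennreal_mult[of 2 "m / 2"] by simp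
    also have "\<dots> \<le> 2 * emeasure M (level j \<inter> {\<tau>..})"
      using \<tau>(2) by (intro mult_left_mono less_imp_le) auto
    finally show ?thesis using f
      by (intro exI[of _ f] exI[of _ "level j \<inter> {\<tau>..}"]) (simp add: Q_def)
  qed
  then obtain g where "\<And>j. \<exists>D. Q j (g j) D" using choice[of "\<lambda>j f. \<exists>D. Q j f D"] by blast
  then obtain D where Q: "\<And>j. Q j (g j) (D j)" using choice[of "\<lambda>j. Q j (g j)"] by blast
  have g: "\<And>j. g j \<in> Mplus a b" "\<And>j. energy (g j) \<le> 1"
    and D: "\<And>j. D j \<in> sets M" "\<And>j. D j \<subseteq> level j" "\<And>j. emeasure M (level j) \<le> 2 * emeasure M (D j)"
    and gD: "\<And>j t. t \<in> D j \<Longrightarrow> ennreal (2 powr real_of_int j) \<le> integ a (ereal t) (g j)"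
    using Q unfolding Q_def by blast+
  have "isum (\<lambda>j. mass q j * c j epowr (q / p)) \<le> 2 * B" if c: "isum c \<le> 1" for c
  proof -
    \<comment> \<open>The functions \<open>g j\<close> may overlap; the supremum keeps the energy at
      most 1 and still dominates each weighted constituent. The sets \<open>D j\<close> on which
      they are evaluated are disjoint.\<close>
    define f where "f = (\<lambda>t. SUP j. c j epowr (1 / p) * g j t)"
    have f: "f \<in> Mplus a b" unfolding f_def by (rule Mplus_SUP[OF g(1)])
    have en: "energy f \<le> 1"
      unfolding f_def using p by (intro energy_SUP_le g v c) auto
    have "mass q j * c j epowr (q / p) \<le>
        2 * (\<integral>\<^sup>+ t. integ a (ereal t) f epowr q * indicator (D j) t \<partial>M)" for j
    proof -
      have "mass q j * c j epowr (q / p) \<le>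
          ennreal (2 powr (real_of_int j * q)) * (2 * emeasure M (D j)) * c j epowr (q / p)"
        unfolding mass_def by (intro mult_right_mono mult_left_mono D) auto
      also have "\<dots> = 2 * ((c j epowr (1 / p) * ennreal (2 powr real_of_int j)) epowr q * emeasure M (D j))"
        by (simp add: epowr_mult epowr_epowr powr_powr mult_ac)
      also have "\<dots> = 2 * (\<integral>\<^sup>+ t. (c j epowr (1 / p) * ennreal (2 powr real_of_int j)) epowr q * indicator (D j) t \<partial>M)"
        using D by (subst nn_integral_cmult_indicator) auto
      also have "\<dots> \<le> 2 * (\<integral>\<^sup>+ t. integ a (ereal t) f epowr q * indicator (D j) t \<partial>M)"
      proof (intro mult_left_mono nn_integral_mono)
        fix t
        show "(c j epowr (1 / p) * ennreal (2 powr real_of_int j)) epowr q * indicator (D j) t \<le>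
            integ a (ereal t) f epowr q * indicator (D j) t"
        proof (cases "t \<in> D j")
          case True
          then have tb: "ereal t \<le> b" using D(2)[of j] by (auto simp: level_def einterval_iff)
          have "c j epowr (1 / p) * ennreal (2 powr real_of_int j) \<le> c j epowr (1 / p) * integ a (ereal t) (g j)"
            by (intro mult_left_mono gD True) simp
          also have "\<dots> = integ a (ereal t) (\<lambda>s. c j epowr (1 / p) * g j s)"
            by (rule integ_cmult[symmetric, OF Mplus_mono[OF g(1) order_refl tb]])
          also have "\<dots> \<le> integ a (ereal t) f"
            unfolding f_def by (intro integ_mono SUP_upper) simp
          finally show ?thesis using q True by (simp add: epowr_mono)
        qed simp
      qed simp
      finally show ?thesis .
    qed
    then have "isum (\<lambda>j. mass q j * c j epowr (q / p)) \<le>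
        isum (\<lambda>j. 2 * (\<integral>\<^sup>+ t. integ a (ereal t) f epowr q * indicator (D j) t \<partial>M))"
      by (rule isum_mono)
    also have "\<dots> \<le> 2 * (\<integral>\<^sup>+ t. integ a (ereal t) f epowr q \<partial>M)"
      unfolding isum_cmult
    proof (rule mult_left_mono)
      have "disjoint_family D"
        using disjoint_level D(2) unfolding disjoint_family_on_def by blast
      then show "isum (\<lambda>j. \<integral>\<^sup>+ t. integ a (ereal t) f epowr q * indicator (D j) t \<partial>M)
          \<le> (\<integral>\<^sup>+ t. integ a (ereal t) f epowr q \<partial>M)"
        by (intro isum_nn_integral_disjoint_le D) measurable
    qed simp
    also have "\<dots> \<le> 2 * B" by (intro mult_left_mono B f en) simp
    finally show ?thesis .
  qed
  then have "isum (\<lambda>j. mass q j epowr (1 / (1 - q / p))) \<le> (2 * B) epowr (1 / (1 - q / p))"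
    by (rule diagonal_sum_le[OF \<theta>(1,2)])
  then have "isum (\<lambda>j. mass q j epowr (p / (p - q))) \<le> (2 * B) epowr (p / (p - q))"
    unfolding \<theta>(3) .
  then have mazya: "mazya q \<le> ennreal (2 powr (p * q / (p - q))) *
    (geo (q / 2) epowr (p / (p - q)) * geo (q * (p / (p - q)) / 2)) * (2 * B) epowr (p / (p - q))"
    by (intro order_trans[OF mazya_le_isum_mass[OF q AE_Va_finite_of_sup[OF sup Btop]]] mult_left_mono) simp_all
  have "mazya q epowr ((p - q) / p) \<le> (ennreal (2 powr (p * q / (p - q))) *
    (geo (q / 2) epowr (p / (p - q)) * geo (q * (p / (p - q)) / 2)) * (2 * B) epowr (p / (p - q))) epowr ((p - q) / p)"
    using q by (intro epowr_mono mazya) auto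
  also have "\<dots> = (ennreal (2 powr (p * q / (p - q))) *
    (geo (q / 2) epowr (p / (p - q)) * geo (q * (p / (p - q)) / 2))) epowr ((p - q) / p) * (2 * B)"
    using q by (simp only: epowr_mult[of _ "(2 * B) epowr _"] epowr_epowr) simp
  also have "\<dots> = KL p q * B" using q by (simp add: KL_def mult_ac)
  finally show ?thesis .
qed

end

section \<open>Discretization of the iterated operator\<close>

lemma AE_lebesgue_on_notin_countable:
  assumes "countable A"
  shows "AE t in lebesgue_on (einterval c d). t \<notin> A"
proof -
  have "A \<in> null_sets lebesgue"
    using assms by (simp add: countable_imp_null_set_lborel null_sets_completionI)
  then have "AE t in lebesgue. t \<notin> A" by (rule AE_not_in)
  then show ?thesis by (auto simp: AE_restrict_space_iff elim: eventually_mono)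
qed

lemma integ_split:
  assumes g: "g \<in> Mplus x z" and xy: "x \<le> y" "y \<le> z"
  shows "integ x z g = integ x y g + integ y z g"
proof -
  have m: "(\<lambda>t. g t * indicator (einterval c d) t) \<in> borel_measurable lebesgue" if "x \<le> c" "d \<le> z" for c d
    using Mplus_mono[OF g that] by (simp add: Mplus_iff)
  \<comment> \<open>For infinite y the value \<open>real_of_ereal y\<close> is 0, a harmless null
    point; for finite y it is the point lost between the two open intervals.\<close>
  have "AE t in lebesgue. t \<noteq> real_of_ereal y"
    by (intro AE_I'[of "{real_of_ereal y}"]) (auto simp: null_sets_def)
  then have "AE t in lebesgue. g t * indicator (einterval x z) t =
      g t * indicator (einterval x y) t + g t * indicator (einterval y z) t"
  proof eventually_elim
    fix t assume "t \<noteq> real_of_ereal y"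
    then have "ereal t < y \<or> y < ereal t" by (cases y) auto
    then show "g t * indicator (einterval x z) t =
      g t * indicator (einterval x y) t + g t * indicator (einterval y z) t"
    proof
      assume t: "ereal t < y"
      then have "\<not> y < ereal t" "ereal t < z" using xy(2) by auto
      with t show ?thesis by (simp add: einterval_iff indicator_def)
    next
      assume t: "y < ereal t"
      then have "\<not> ereal t < y" "x < ereal t" using xy(1) by auto
      with t show ?thesis by (simp add: einterval_iff indicator_def)
    qed
  qed
  then have "integ x z g = (\<integral>\<^sup>+ t. g t * indicator (einterval x y) t + g t * indicator (einterval y z) t \<partial>lebesgue)"
    unfolding integ_eq by (rule nn_integral_cong_AE)
  then show ?thesis
    unfolding integ_eq using m[of x y] m[of y z] xy by (simp add: nn_integral_add)
qed

lemma borel_Mplus: "g \<in> borel_measurable borel \<Longrightarrow> g \<in> Mplus a b"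
  by (intro borel_measurable_lebesgue_Mplus measurable_completion) simp

lemma Mplus_times: "f \<in> Mplus a b \<Longrightarrow> g \<in> Mplus a b \<Longrightarrow> (\<lambda>t. f t * g t) \<in> Mplus a b"
  unfolding Mplus_def by (rule borel_measurable_times_ennreal)

text \<open>What is kept of a discretizing sequence after its extension to all integers. It may
  equal a at its lower end, hence strictness and the bounds on w only above a. The 2 in
  \<open>W_upper\<close> accounts for the index k - 1. In \<open>W_lower\<close> m cells are taken
  together, because a single cell may carry too little of w when the constant of the equivalence is
  large.\<close>

locale discretization =
  fixes p q r c :: real and m :: nat and a b :: ereal and u v w :: "real \<Rightarrow> real" and y :: "int \<Rightarrow> ereal"
  assumes p: "1 \<le> p" and q: "0 < q" and r: "0 < r" and c: "0 < c"
    and u: "weight a b u" and v: "weight a b v" and w: "weight a b w"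
    and y_mono: "\<And>i j. i \<le> j \<Longrightarrow> y i \<le> y j"
    and y_strict: "\<And>i j. i < j \<Longrightarrow> a < y j \<Longrightarrow> y i < y j"
    and y_ge: "\<And>k. a \<le> y k" and y_less: "\<And>k. y k < b"
    and y_low: "\<And>t. a < ereal t \<Longrightarrow> \<exists>k. y k < ereal t"
    and y_high: "\<And>t. ereal t < b \<Longrightarrow> \<exists>k. ereal t < y k"
    and W_upper: "\<And>k. a < y k \<Longrightarrow> integ (y (k - 1)) b (\<lambda>s. ennreal (w s)) \<le> ennreal (2 * c * 2 powr - real_of_int k)"
    and W_lower: "\<And>k. a < y k \<Longrightarrow>
      ennreal (2 powr - real_of_int k) \<le> ennreal (2 * c) * integ (y k) (y (k + int m)) (\<lambda>s. ennreal (w s))"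
begin

abbreviation I :: "int \<Rightarrow> real set" where
  "I k \<equiv> einterval (y (k - 1)) (y k)"

abbreviation E :: "int \<Rightarrow> ennreal" where
  "E k \<equiv> ennreal (2 powr - real_of_int k)"

lemma ex1_cell:
  assumes t: "t \<in> einterval a b" "\<And>k. ereal t \<noteq> y k"
  shows "\<exists>!k. t \<in> I k"
proof -
  have "\<exists>k. ereal t < y k" "\<exists>k. y k < ereal t"
    using t y_low y_high by (auto simp: einterval_iff)
  then obtain l h where l: "y l < ereal t" and h: "ereal t < y h" by blast
  have lh: "l < h" using l h y_mono[of h l] by (meson less_trans not_le less_le_not_le)
  \<comment> \<open>The sequence may have no first index, so counting starts at a point l of it
    below t; the first point beyond t then closes the cell.\<close>
  define k where "k = (LEAST n. ereal t < y (l + int n))"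
  have "ereal t < y (l + int (nat (h - l)))" using h lh by simp
  then have k1: "ereal t < y (l + int k)" unfolding k_def by (rule LeastI)
  have "k \<noteq> 0" using k1 l by (auto intro: ccontr)
  then have "\<not> ereal t < y (l + int (k - 1))" unfolding k_def by (intro not_less_Least) simp
  then have "y (l + int (k - 1)) < ereal t"
    using t(2)[of "l + int (k - 1)"] by (simp add: not_less order.order_iff_strict)
  moreover have "l + int (k - 1) = l + int k - 1" using \<open>k \<noteq> 0\<close> by simp
  ultimately have "y (l + int k - 1) < ereal t" by (simp only:)
  then have "t \<in> I (l + int k)" using k1 by (simp add: einterval_iff)
  moreover have "i = j" if "t \<in> I i" "t \<in> I j" for i j
  proof (rule ccontr)
    assume "i \<noteq> j"
    then consider "i \<le> j - 1" | "j \<le> i - 1" by linarith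
    then show False
      using that y_mono[of i "j - 1"] y_mono[of j "i - 1"] by cases (auto simp: einterval_iff)
  qed
  ultimately show ?thesis by blast
qed

lemma AE_cell: "AE t in lebesgue_on (einterval a b). \<exists>!k. t \<in> I k"
proof -
  have "countable (range (real_of_ereal \<circ> y))" by simp
  from AE_lebesgue_on_notin_countable[OF this]
  have "AE t in lebesgue_on (einterval a b). t \<notin> range (real_of_ereal \<circ> y)" .
  moreover have "AE t in lebesgue_on (einterval a b). t \<in> einterval a b"
    by (intro AE_lebesgue_onI)
  ultimately show ?thesis
  proof eventually_elim
    fix t assume t: "t \<notin> range (real_of_ereal \<circ> y)" "t \<in> einterval a b"
    have "ereal t \<noteq> y k" for k
    proof
      assume "ereal t = y k"
      then have "t = real_of_ereal (y k)" by (metis real_of_ereal.simps(1))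
      then show False using t(1) by auto
    qed
    with t(2) show "\<exists>!k. t \<in> I k" by (rule ex1_cell)
  qed
qed

lemma integ_cells:
  assumes g: "g \<in> Mplus a b" and d: "d \<le> b"
  shows "integ a d g = isum (\<lambda>k. \<integral>\<^sup>+ t. g t * indicator (I k \<inter> einterval a d) t \<partial>lebesgue)"
proof -
  let ?L = "lebesgue_on (einterval a d)"
  have "integ a d g = isum (\<lambda>k. \<integral>\<^sup>+ t. g t * indicator (I k \<inter> einterval a d) t \<partial>?L)"
    unfolding integ_def
  proof (rule nn_integral_partition)
    show "g \<in> borel_measurable ?L" using Mplus_mono[OF g order_refl d] by (simp add: Mplus_def)
    show "I k \<inter> einterval a d \<in> sets ?L" for k by (simp add: sets_restrict_space_iff)
    have "AE t in ?L. t \<in> einterval a d" by (intro AE_lebesgue_onI)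
    with AE_lebesgue_on_mono[OF AE_cell order_refl d]
    show "AE t in ?L. \<exists>!k. t \<in> I k \<inter> einterval a d" by eventually_elim simp
  qed
  also have "\<dots> = isum (\<lambda>k. \<integral>\<^sup>+ t. g t * indicator (I k \<inter> einterval a d) t \<partial>lebesgue)"
    by (subst nn_integral_restrict_space) (auto intro!: nn_integral_cong split: split_indicator)
  finally show ?thesis .
qed

lemma I_subset: "I k \<subseteq> einterval a b"
  using y_ge[of "k - 1"] y_less[of k] by (intro einterval_mono) auto

lemma integ_all_cells:
  assumes g: "g \<in> Mplus a b"
  shows "integ a b g = isum (\<lambda>k. integ (y (k - 1)) (y k) g)"
proof -
  have "I k \<inter> einterval a b = I k" for k using I_subset by blast
  then show ?thesis using integ_cells[OF g order_refl] by (simp add: integ_eq)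
qed

lemma integ_cells_upto:
  assumes g: "g \<in> Mplus a b"
  shows "integ a (y n) g = isum (\<lambda>k. integ (y (k - 1)) (y k) g * indicator {..n} k)"
proof -
  have "(\<integral>\<^sup>+ t. g t * indicator (I k \<inter> einterval a (y n)) t \<partial>lebesgue) =
      integ (y (k - 1)) (y k) g * indicator {..n} k" for k
  proof (cases "k \<le> n")
    case True
    then have "I k \<inter> einterval a (y n) = I k"
      using y_ge[of "k - 1"] y_mono[of k n] einterval_mono[of a "y (k - 1)" "y k" "y n"] by blast
    then show ?thesis using True by (simp add: integ_eq)
  next
    case False
    then have "I k \<inter> einterval a (y n) = {}"
      using y_mono[of n "k - 1"] by (auto simp: einterval_iff)
    then show ?thesis using False by simp
  qed
  then show ?thesis using integ_cells[OF g less_imp_le[OF y_less[of n]]] by simp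
qed

text \<open>The interval from y k to y (k + n) consists of n consecutive cells, so each cell is
  counted n times.\<close>

lemma isum_overlap_le:
  assumes g: "g \<in> Mplus a b"
  shows "isum (\<lambda>k. integ (y k) (y (k + int n)) g) \<le> of_nat n * integ a b g"
proof (induction n)
  case (Suc n)
  have "integ (y k) (y (k + int (Suc n))) g =
      integ (y k) (y (k + int n)) g + integ (y (k + int (Suc n) - 1)) (y (k + int (Suc n))) g" for k
  proof -
    have e: "k + int (Suc n) - 1 = k + int n" by simp
    show ?thesis
      unfolding e using y_ge y_mono y_less
      by (intro integ_split Mplus_mono[OF g]) (auto intro: less_imp_le)
  qed
  then have "isum (\<lambda>k. integ (y k) (y (k + int (Suc n))) g) =
      isum (\<lambda>k. integ (y k) (y (k + int n)) g) + isum (\<lambda>k. integ (y (k + int (Suc n) - 1)) (y (k + int (Suc n))) g)"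
    by (simp only: isum_add)
  also have "isum (\<lambda>k. integ (y (k + int (Suc n) - 1)) (y (k + int (Suc n))) g) = integ a b g"
    unfolding integ_all_cells[OF g] by (rule isum_shift[of "\<lambda>k. integ (y (k - 1)) (y k) g"])
  also have "isum (\<lambda>k. integ (y k) (y (k + int n)) g) + integ a b g \<le> of_nat (Suc n) * integ a b g"
    using add_right_mono[OF Suc] by (simp add: distrib_right add.commute)
  finally show ?case .
qed simp

section \<open>The iterated operator and its comparison with two sums\<close>

definition inner :: "(real \<Rightarrow> ennreal) \<Rightarrow> ereal \<Rightarrow> ennreal" where
  "inner f z = integ a z (\<lambda>t. integ a (ereal t) f epowr q * ennreal (u t))"

definition T :: "(real \<Rightarrow> ennreal) \<Rightarrow> ennreal" where
  "T f = integ a b (\<lambda>x. inner f (ereal x) epowr (r / q) * ennreal (w x))"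

text \<open>The primitive restarts at the left end of the cell; what f has accumulated before it is
  left to \<open>S2\<close>.\<close>

definition loc :: "(real \<Rightarrow> ennreal) \<Rightarrow> int \<Rightarrow> ennreal" where
  "loc f k = integ (y (k - 1)) (y k) (\<lambda>t. integ (y (k - 1)) (ereal t) f epowr q * ennreal (u t))"

text \<open>Mind the shift: \<open>loc f k\<close> lives on the cell that ends at y k,
  \<open>um k\<close> is the mass of the cell that starts there.\<close>

definition um :: "int \<Rightarrow> ennreal" where
  "um k = integ (y k) (y (k + 1)) (\<lambda>s. ennreal (u s))"

definition S1 :: "(real \<Rightarrow> ennreal) \<Rightarrow> ennreal" where
  "S1 f = isum (\<lambda>k. E k * loc f k epowr (r / q))"

definition S2 :: "(real \<Rightarrow> ennreal) \<Rightarrow> ennreal" where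
  "S2 f = isum (\<lambda>k. E k * um k epowr (r / q) * integ a (y k) f epowr r)"

lemma inner_mono: "z \<le> z' \<Longrightarrow> inner f z \<le> inner f z'"
  unfolding inner_def by (intro integ_mono_interval) auto

lemma inner_integrand_Mplus: "(\<lambda>t. integ a (ereal t) f epowr q * ennreal (u t)) \<in> Mplus a b"
  by (intro Mplus_times[OF borel_Mplus weight_Mplus[OF u]] borel_measurable_epowr borel_measurable_primitive)

lemma outer_integrand_Mplus: "(\<lambda>x. inner f (ereal x) epowr (r / q) * ennreal (w x)) \<in> Mplus a b"
  unfolding inner_def
  by (intro Mplus_times[OF borel_Mplus weight_Mplus[OF w]] borel_measurable_epowr borel_measurable_primitive)

lemma cell_Mplus: "g \<in> Mplus a b \<Longrightarrow> g \<in> Mplus (y (k - 1)) (y k)"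
  using Mplus_mono y_ge y_less less_imp_le by blast

lemma T_le: "T f \<le> ennreal (2 * c) * isum (\<lambda>k. E k * inner f (y k) epowr (r / q))"
proof -
  have "T f = isum (\<lambda>k. integ (y (k - 1)) (y k) (\<lambda>x. inner f (ereal x) epowr (r / q) * ennreal (w x)))"
    unfolding T_def by (rule integ_all_cells[OF outer_integrand_Mplus])
  also have "\<dots> \<le> isum (\<lambda>k. ennreal (2 * c) * (E k * inner f (y k) epowr (r / q)))"
  proof (rule isum_mono)
    fix k
    have "integ (y (k - 1)) (y k) (\<lambda>x. inner f (ereal x) epowr (r / q) * ennreal (w x)) \<le>
        integ (y (k - 1)) (y k) (\<lambda>x. inner f (y k) epowr (r / q) * ennreal (w x))"
      using q r by (intro integ_mono mult_right_mono epowr_mono inner_mono) (auto simp: einterval_iff)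
    also have "\<dots> = inner f (y k) epowr (r / q) * integ (y (k - 1)) (y k) (\<lambda>x. ennreal (w x))"
      by (intro integ_cmult cell_Mplus weight_Mplus w)
    also have "\<dots> \<le> inner f (y k) epowr (r / q) * ennreal (2 * c * 2 powr - real_of_int k)"
    proof (cases "a < y k")
      case True
      have "integ (y (k - 1)) (y k) (\<lambda>x. ennreal (w x)) \<le> integ (y (k - 1)) b (\<lambda>x. ennreal (w x))"
        using y_less[of k] by (intro integ_mono_interval) auto
      also have "\<dots> \<le> ennreal (2 * c * 2 powr - real_of_int k)" by (rule W_upper[OF True])
      finally show ?thesis by (rule mult_left_mono) simp
    next
      case False
      then have "y k = a" using y_ge[of k] by auto
      then show ?thesis by (simp add: inner_def)
    qed
    also have "\<dots> = ennreal (2 * c) * (E k * inner f (y k) epowr (r / q))"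
      using c by (simp add: ennreal_mult mult_ac)
    finally show "integ (y (k - 1)) (y k) (\<lambda>x. inner f (ereal x) epowr (r / q) * ennreal (w x)) \<le>
        ennreal (2 * c) * (E k * inner f (y k) epowr (r / q))" .
  qed
  finally show ?thesis by (simp only: isum_cmult)
qed

text \<open>On the m cells following y k the inner integral is at least its value at y k, and
  together they carry enough of w.\<close>

lemma le_T: "isum (\<lambda>k. E k * inner f (y k) epowr (r / q)) \<le> ennreal (2 * c) * of_nat m * T f"
proof -
  have "isum (\<lambda>k. E k * inner f (y k) epowr (r / q)) \<le>
      isum (\<lambda>k. ennreal (2 * c) * integ (y k) (y (k + int m)) (\<lambda>x. inner f (ereal x) epowr (r / q) * ennreal (w x)))"
  proof (rule isum_mono)
    fix k
    show "E k * inner f (y k) epowr (r / q) \<le>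
        ennreal (2 * c) * integ (y k) (y (k + int m)) (\<lambda>x. inner f (ereal x) epowr (r / q) * ennreal (w x))"
    proof (cases "a < y k")
      case True
      have "E k * inner f (y k) epowr (r / q) \<le>
          (ennreal (2 * c) * integ (y k) (y (k + int m)) (\<lambda>s. ennreal (w s))) * inner f (y k) epowr (r / q)"
        by (intro mult_right_mono W_lower[OF True]) simp
      also have "\<dots> = ennreal (2 * c) * integ (y k) (y (k + int m)) (\<lambda>s. inner f (y k) epowr (r / q) * ennreal (w s))"
        unfolding integ_cmult[OF Mplus_mono[OF weight_Mplus[OF w] y_ge less_imp_le[OF y_less]]]
        by (simp add: mult_ac)
      also have "\<dots> \<le> ennreal (2 * c) * integ (y k) (y (k + int m)) (\<lambda>x. inner f (ereal x) epowr (r / q) * ennreal (w x))"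
        using q r
        by (intro mult_left_mono integ_mono mult_right_mono epowr_mono inner_mono) (auto simp: einterval_iff)
      finally show ?thesis .
    next
      case False
      then have "y k = a" using y_ge[of k] by auto
      then show ?thesis by (simp add: inner_def)
    qed
  qed
  also have "\<dots> \<le> ennreal (2 * c) * (of_nat m * T f)"
    unfolding isum_cmult T_def by (intro mult_left_mono isum_overlap_le[OF outer_integrand_Mplus]) simp
  finally show ?thesis by (simp add: mult.assoc)
qed

lemma S1_le_T: "S1 f \<le> ennreal (2 * c) * of_nat m * T f"
proof -
  have "loc f k \<le> inner f (y k)" for k
  proof -
    have "loc f k \<le> integ (y (k - 1)) (y k) (\<lambda>t. integ a (ereal t) f epowr q * ennreal (u t))"
      unfolding loc_def using q y_ge
      by (intro integ_mono mult_right_mono epowr_mono integ_mono_interval) auto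
    also have "\<dots> \<le> inner f (y k)"
      unfolding inner_def using y_ge by (intro integ_mono_interval) auto
    finally show ?thesis .
  qed
  then have "S1 f \<le> isum (\<lambda>k. E k * inner f (y k) epowr (r / q))"
    unfolding S1_def using q r by (intro isum_mono mult_left_mono epowr_mono) auto
  then show ?thesis using le_T by (rule order_trans)
qed

text \<open>On the cell after y k the primitive of f is at least its value at y k, so the k-th term
  is bounded by the inner integral up to y (k + 1). The leading 2 is the ratio of neighbouring
  weights.\<close>

lemma S2_le_T: "S2 f \<le> 2 * (ennreal (2 * c) * of_nat m * T f)"
proof -
  have "E k * um k epowr (r / q) * integ a (y k) f epowr r \<le>
      2 * (E (k + 1) * inner f (y (k + 1)) epowr (r / q))" for k
  proof -
    have "integ a (y k) f epowr q * um k =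
        integ (y k) (y (k + 1)) (\<lambda>t. integ a (y k) f epowr q * ennreal (u t))"
      unfolding um_def
      by (rule integ_cmult[symmetric, OF Mplus_mono[OF weight_Mplus[OF u] y_ge less_imp_le[OF y_less]]])
    also have "\<dots> \<le> integ (y k) (y (k + 1)) (\<lambda>t. integ a (ereal t) f epowr q * ennreal (u t))"
      using q by (intro integ_mono mult_right_mono epowr_mono integ_mono_interval) (auto simp: einterval_iff)
    also have "\<dots> \<le> inner f (y (k + 1))"
      unfolding inner_def using y_ge by (intro integ_mono_interval) auto
    finally have "(integ a (y k) f epowr q * um k) epowr (r / q) \<le> inner f (y (k + 1)) epowr (r / q)"
      using q r by (intro epowr_mono) auto
    moreover have "(integ a (y k) f epowr q * um k) epowr (r / q) = um k epowr (r / q) * integ a (y k) f epowr r"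
      using q by (simp add: epowr_mult epowr_epowr mult.commute)
    ultimately have "um k epowr (r / q) * integ a (y k) f epowr r \<le> inner f (y (k + 1)) epowr (r / q)" by simp
    then have *: "E k * (um k epowr (r / q) * integ a (y k) f epowr r) \<le> E k * inner f (y (k + 1)) epowr (r / q)"
      by (rule mult_left_mono) simp
    have "2 powr - real_of_int k = 2 * 2 powr - real_of_int (k + 1)"
      using powr_add[of 2 1 "- real_of_int (k + 1)"] by simp
    then have "E k = 2 * E (k + 1)" using ennreal_mult[of 2 "2 powr - real_of_int (k + 1)"] by simp
    then have "E k * inner f (y (k + 1)) epowr (r / q) = 2 * (E (k + 1) * inner f (y (k + 1)) epowr (r / q))"
      by (simp only: mult.assoc)
    with * show ?thesis by (simp only: mult.assoc)
  qed
  then have "S2 f \<le> isum (\<lambda>k. 2 * (E (k + 1) * inner f (y (k + 1)) epowr (r / q)))"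
    unfolding S2_def by (rule isum_mono)
  also have "\<dots> = 2 * isum (\<lambda>k. E k * inner f (y k) epowr (r / q))"
    using isum_shift[of "\<lambda>k. E k * inner f (y k) epowr (r / q)" 1] by (simp only: isum_cmult)
  also have "\<dots> \<le> 2 * (ennreal (2 * c) * of_nat m * T f)"
    by (intro mult_left_mono le_T) simp
  finally show ?thesis .
qed

definition cell :: "(real \<Rightarrow> ennreal) \<Rightarrow> int \<Rightarrow> ennreal" where
  "cell f k = integ (y (k - 1)) (y k) (\<lambda>t. integ a (ereal t) f epowr q * ennreal (u t))"

text \<open>The inner integral up to y k sums the cells i \<le> k, against decaying weights. With
  2^(-k q/r), whose power r/q is the weight, this is a convolution of rate q/r measured in exponent
  r/q; their product 1 explains the \<open>geo (1 / 2)\<close>.\<close>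

lemma isum_inner_le:
  "isum (\<lambda>k. E k * inner f (y k) epowr (r / q)) \<le>
    geo (q / r / 2) epowr (r / q) * geo (1 / 2) * isum (\<lambda>k. E k * cell f k epowr (r / q))"
proof -
  let ?s = "r / q" and ?d = "q / r"
  let ?e = "\<lambda>k. ennreal (2 powr (- real_of_int k * ?d))"
  have s: "0 < ?s" "0 < ?d" "?d * ?s = 1" using q r by auto
  have Ee: "?e k epowr ?s = E k" for k
    using q r by (simp add: powr_powr)
  have "E k * inner f (y k) epowr ?s \<le>
      isum (\<lambda>i. ennreal (2 powr (- ?d * \<bar>real_of_int (k - i)\<bar>)) * (?e i * cell f i)) epowr ?s" for k
  proof -
    have "E k * inner f (y k) epowr ?s = (?e k * inner f (y k)) epowr ?s"
      by (simp only: epowr_mult Ee)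
    also have "?e k * inner f (y k) = isum (\<lambda>i. ?e k * (cell f i * indicator {..k} i))"
      unfolding inner_def integ_cells_upto[OF inner_integrand_Mplus] cell_def by (simp only: isum_cmult)
    also have "\<dots> epowr ?s \<le> isum (\<lambda>i. ennreal (2 powr (- ?d * \<bar>real_of_int (k - i)\<bar>)) * (?e i * cell f i)) epowr ?s"
    proof (intro epowr_mono isum_mono)
      fix i
      show "?e k * (cell f i * indicator {..k} i) \<le>
          ennreal (2 powr (- ?d * \<bar>real_of_int (k - i)\<bar>)) * (?e i * cell f i)"
      proof (cases "i \<le> k")
        case True
        have "- real_of_int k * ?d = - ?d * \<bar>real_of_int (k - i)\<bar> + - real_of_int i * ?d"
          using True by (simp add: algebra_simps)
        then have "?e k = ennreal (2 powr (- ?d * \<bar>real_of_int (k - i)\<bar>)) * ?e i"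
          by (simp only: powr_add ennreal_mult powr_ge_zero)
        then show ?thesis using True by (simp only: mult.assoc) simp
      qed simp
    qed (use s in simp)
    finally show ?thesis .
  qed
  then have "isum (\<lambda>k. E k * inner f (y k) epowr ?s) \<le>
      isum (\<lambda>k. isum (\<lambda>i. ennreal (2 powr (- ?d * \<bar>real_of_int (k - i)\<bar>)) * (?e i * cell f i)) epowr ?s)"
    by (rule isum_mono)
  also have "\<dots> \<le> geo (?d / 2) epowr ?s * geo (?d * ?s / 2) * isum (\<lambda>i. (?e i * cell f i) epowr ?s)"
    by (rule isum_convolution[OF s(2,1)])
  finally show ?thesis unfolding s(3) by (simp only: epowr_mult Ee)
qed

lemma cell_le: "cell f k \<le> ennreal (2 powr q) * (loc f k + integ a (y (k - 1)) f epowr q * um (k - 1))"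
  if f: "f \<in> Mplus a b"
proof -
  have "cell f k \<le> integ (y (k - 1)) (y k) (\<lambda>t. ennreal (2 powr q) *
      (integ (y (k - 1)) (ereal t) f epowr q * ennreal (u t) + integ a (y (k - 1)) f epowr q * ennreal (u t)))"
    unfolding cell_def
  proof (rule integ_mono)
    fix t assume t: "t \<in> I k"
    have "integ a (ereal t) f = integ a (y (k - 1)) f + integ (y (k - 1)) (ereal t) f"
      using t y_ge[of "k - 1"] y_less[of k] less_trans[of "ereal t" "y k" b]
      by (intro integ_split Mplus_mono[OF f]) (auto simp: einterval_iff intro: less_imp_le)
    then have "integ a (ereal t) f epowr q \<le> ennreal (2 powr q) *
        (integ a (y (k - 1)) f epowr q + integ (y (k - 1)) (ereal t) f epowr q)"
      using epowr_add_le[OF q] by simp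
    then have "integ a (ereal t) f epowr q * ennreal (u t) \<le> ennreal (2 powr q) *
        (integ a (y (k - 1)) f epowr q + integ (y (k - 1)) (ereal t) f epowr q) * ennreal (u t)"
      by (rule mult_right_mono) simp
    then show "integ a (ereal t) f epowr q * ennreal (u t) \<le> ennreal (2 powr q) *
      (integ (y (k - 1)) (ereal t) f epowr q * ennreal (u t) + integ a (y (k - 1)) f epowr q * ennreal (u t))"
      by (simp add: distrib_right mult.assoc add.commute)
  qed
  also have "\<dots> = ennreal (2 powr q) * (loc f k + integ a (y (k - 1)) f epowr q * um (k - 1))"
  proof -
    have u': "(\<lambda>t. ennreal (u t)) \<in> Mplus (y (k - 1)) (y k)" by (intro cell_Mplus weight_Mplus u)
    have m1: "(\<lambda>t. integ (y (k - 1)) (ereal t) f epowr q * ennreal (u t)) \<in> Mplus (y (k - 1)) (y k)"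
      by (intro Mplus_times[OF borel_Mplus u'] borel_measurable_epowr borel_measurable_primitive)
    have m2: "(\<lambda>t. integ a (y (k - 1)) f epowr q * ennreal (u t)) \<in> Mplus (y (k - 1)) (y k)"
      by (intro Mplus_times[OF borel_Mplus u']) simp
    have "integ (y (k - 1)) (y k) (\<lambda>t. integ (y (k - 1)) (ereal t) f epowr q * ennreal (u t) +
        integ a (y (k - 1)) f epowr q * ennreal (u t)) = loc f k + integ a (y (k - 1)) f epowr q * um (k - 1)"
      using m1 m2 integ_cmult[OF u'] unfolding loc_def um_def
      by (simp add: integ_def Mplus_def nn_integral_add)
    moreover have "(\<lambda>t. integ (y (k - 1)) (ereal t) f epowr q * ennreal (u t) +
        integ a (y (k - 1)) f epowr q * ennreal (u t)) \<in> Mplus (y (k - 1)) (y k)"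
      using m1 m2 unfolding Mplus_def by measurable
    ultimately show ?thesis by (simp add: integ_cmult)
  qed
  finally show ?thesis .
qed

text \<open>The factors come from \<open>T_le\<close>, from \<open>isum_inner_le\<close>, from
  \<open>cell_le\<close> raised to the power r/q, and from splitting a power of a sum.\<close>

definition KT :: ennreal where
  "KT = ennreal (2 * c) * (geo (q / r / 2) epowr (r / q) * geo (1 / 2)) * (ennreal (2 powr r) * ennreal (2 powr (r / q)))"

lemma KT_less_top: "KT < top"
  unfolding KT_def using q r by (auto simp: ennreal_mult_less_top geo_less_top)

lemma T_le_S: 
  assumes f: "f \<in> Mplus a b"
  shows "T f \<le> KT * (S1 f + S2 f)"
proof -
  let ?s = "r / q"
  have s: "0 < ?s" using q r by simp
  let ?K = "ennreal (2 powr r) * ennreal (2 powr ?s)"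
  have "E k * cell f k epowr ?s \<le> ?K * (E k * loc f k epowr ?s +
      E (k - 1) * um (k - 1) epowr ?s * integ a (y (k - 1)) f epowr r)" for k
  proof -
    have "cell f k epowr ?s \<le> (ennreal (2 powr q) * (loc f k + integ a (y (k - 1)) f epowr q * um (k - 1))) epowr ?s"
      using s by (intro epowr_mono cell_le f) auto
    also have "\<dots> = ennreal (2 powr r) * (loc f k + integ a (y (k - 1)) f epowr q * um (k - 1)) epowr ?s"
      using q by (simp add: epowr_mult powr_powr)
    also have "\<dots> \<le> ennreal (2 powr r) * (ennreal (2 powr ?s) * (loc f k epowr ?s + (integ a (y (k - 1)) f epowr q * um (k - 1)) epowr ?s))"
      by (intro mult_left_mono epowr_add_le s) simp
    also have "(integ a (y (k - 1)) f epowr q * um (k - 1)) epowr ?s = um (k - 1) epowr ?s * integ a (y (k - 1)) f epowr r"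
      using q by (simp add: epowr_mult epowr_epowr mult.commute)
    finally have "E k * cell f k epowr ?s \<le> E k * (ennreal (2 powr r) * (ennreal (2 powr ?s) *
        (loc f k epowr ?s + um (k - 1) epowr ?s * integ a (y (k - 1)) f epowr r)))"
      by (rule mult_left_mono) simp
    also have "\<dots> = ?K * (E k * loc f k epowr ?s + E k * (um (k - 1) epowr ?s * integ a (y (k - 1)) f epowr r))"
      by (simp add: distrib_left mult_ac)
    \<comment> \<open>Lowering the index of the weight enlarges it and turns the second sum into a
      shifted copy of \<open>S2\<close>.\<close>
    also have "\<dots> \<le> ?K * (E k * loc f k epowr ?s + E (k - 1) * (um (k - 1) epowr ?s * integ a (y (k - 1)) f epowr r))"
      by (intro mult_left_mono add_left_mono mult_right_mono ennreal_leI) auto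
    finally show ?thesis by (simp add: mult.assoc)
  qed
  then have "isum (\<lambda>k. E k * cell f k epowr ?s) \<le> isum (\<lambda>k. ?K * (E k * loc f k epowr ?s +
      E (k - 1) * um (k - 1) epowr ?s * integ a (y (k - 1)) f epowr r))"
    by (rule isum_mono)
  also have "\<dots> = ?K * (S1 f + isum (\<lambda>k. E (k - 1) * um (k - 1) epowr ?s * integ a (y (k - 1)) f epowr r))"
    unfolding S1_def by (simp only: isum_cmult isum_add)
  also have "isum (\<lambda>k. E (k - 1) * um (k - 1) epowr ?s * integ a (y (k - 1)) f epowr r) = S2 f"
    unfolding S2_def using isum_shift[of "\<lambda>k. E k * um k epowr ?s * integ a (y k) f epowr r" "- 1"] by simp
  finally have *: "isum (\<lambda>k. E k * cell f k epowr ?s) \<le> ?K * (S1 f + S2 f)" .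
  have "T f \<le> ennreal (2 * c) * isum (\<lambda>k. E k * inner f (y k) epowr ?s)" by (rule T_le)
  also have "\<dots> \<le> ennreal (2 * c) * (geo (q / r / 2) epowr ?s * geo (1 / 2) * isum (\<lambda>k. E k * cell f k epowr ?s))"
    by (intro mult_left_mono isum_inner_le) simp
  also have "\<dots> \<le> ennreal (2 * c) * (geo (q / r / 2) epowr ?s * geo (1 / 2) * (?K * (S1 f + S2 f)))"
    by (intro mult_left_mono *) auto
  finally show ?thesis by (simp add: KT_def mult.assoc)
qed

end

section \<open>Local inequalities on the cells\<close>

text \<open>The measure u dt is pushed forward from the Lebesgue sets to the Borel sets in order to
  fit \<open>hardy_measure\<close>.\<close>

definition udist :: "ereal \<Rightarrow> ereal \<Rightarrow> (real \<Rightarrow> real) \<Rightarrow> real measure" where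
  "udist x z u = distr (density (lebesgue_on (einterval x z)) (\<lambda>t. ennreal (u t))) borel (\<lambda>t. t)"

lemma sets_udist [simp, measurable_cong]: "sets (udist x z u) = sets borel"
  by (simp add: udist_def)

lemma id_measurable_lebesgue_on: "(\<lambda>t. t) \<in> borel_measurable (lebesgue_on (einterval x z))"
  by (intro measurable_restrict_space1 measurable_completion) simp

lemma nn_integral_udist:
  assumes u: "weight x z u" and g: "g \<in> borel_measurable borel"
  shows "(\<integral>\<^sup>+ t. g t \<partial>udist x z u) = integ x z (\<lambda>t. g t * ennreal (u t))"
proof -
  let ?L = "lebesgue_on (einterval x z)"
  have [measurable]: "u \<in> borel_measurable ?L" using u by (simp add: weight_def)
  have [measurable]: "g \<in> borel_measurable ?L"
    using g by (intro measurable_restrict_space1 measurable_completion) simp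
  have "(\<integral>\<^sup>+ t. g t \<partial>udist x z u) = (\<integral>\<^sup>+ t. g t \<partial>density ?L (\<lambda>t. ennreal (u t)))"
    unfolding udist_def using g id_measurable_lebesgue_on[of x z] by (subst nn_integral_distr) auto
  also have "\<dots> = (\<integral>\<^sup>+ t. ennreal (u t) * g t \<partial>?L)"
    by (rule nn_integral_density) auto
  finally show ?thesis by (simp add: integ_def mult.commute)
qed

lemma AE_udist:
  assumes u: "weight x z u" and P: "{t. P t} \<in> sets borel"
    and AE: "AE t in lebesgue_on (einterval x z). P t"
  shows "AE t in udist x z u. P t"
proof -
  let ?L = "lebesgue_on (einterval x z)"
  have [measurable]: "u \<in> borel_measurable ?L" using u by (simp add: weight_def)
  have "AE t in density ?L (\<lambda>t. ennreal (u t)). P t"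
    using AE by (subst AE_density) (auto elim: eventually_mono)
  then show ?thesis
    unfolding udist_def using P id_measurable_lebesgue_on[of x z] by (subst AE_distr_iff) auto
qed

lemma tail_udist:
  assumes u: "weight x z u" and t: "t \<in> einterval x z"
  shows "emeasure (udist x z u) {t..} = integ (ereal t) z (\<lambda>s. ennreal (u s))"
proof -
  have "emeasure (udist x z u) {t..} = (\<integral>\<^sup>+ s. indicator {t..} s \<partial>udist x z u)" by simp
  also have "\<dots> = (\<integral>\<^sup>+ s. indicator {t..} s * ennreal (u s) * indicator (einterval x z) s \<partial>lebesgue)"
    unfolding integ_eq[symmetric] by (rule nn_integral_udist[OF u]) simp
  also have "\<dots> = (\<integral>\<^sup>+ s. ennreal (u s) * indicator (einterval t z) s \<partial>lebesgue)"
  proof (rule nn_integral_cong_AE)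
    have "AE s in lebesgue. s \<noteq> t"
      by (intro AE_I'[of "{t}"]) (auto simp: null_sets_def)
    then show "AE s in lebesgue. indicator {t..} s * ennreal (u s) * indicator (einterval x z) s =
        ennreal (u s) * indicator (einterval t z) s"
    proof eventually_elim
      fix s assume "s \<noteq> t"
      have "x < ereal s" if "t < s" using that t less_trans[of x "ereal t" "ereal s"] by (simp add: einterval_iff)
      with \<open>s \<noteq> t\<close> show "indicator {t..} s * ennreal (u s) * indicator (einterval x z) s =
          ennreal (u s) * indicator (einterval t z) s"
        by (auto simp: einterval_iff split: split_indicator)
    qed
  qed
  finally show ?thesis by (simp add: integ_eq)
qed

section \<open>From constants on single cells to the sum over all cells\<close>

context discretization
begin

abbreviation nm :: "(real \<Rightarrow> ennreal) \<Rightarrow> ennreal" where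
  "nm f \<equiv> integ a b (\<lambda>t. f t epowr p * ennreal (v t))"

abbreviation nmk :: "(real \<Rightarrow> ennreal) \<Rightarrow> int \<Rightarrow> ennreal" where
  "nmk f k \<equiv> integ (y (k - 1)) (y k) (\<lambda>t. f t epowr p * ennreal (v t))"

lemma isum_nmk: "f \<in> Mplus a b \<Longrightarrow> isum (nmk f) = nm f"
  using integ_all_cells[OF Mplus_energy[OF _ v]] by simp

lemma E_inverse: "ennreal (2 powr real_of_int k) * E k = 1" "E k \<noteq> 0"
  by (auto simp: ennreal_mult[symmetric] powr_add[symmetric] ennreal_eq_0_iff)

text \<open>Here and below \<Psi> stands for the constant of the local inequality on a cell, later
  \<open>\<Phi>\<close> or \<open>\<Theta>\<close>.\<close>

lemma S1_term_le:
  assumes K: "loc f k \<le> K * \<Psi> epowr q * nmk f k epowr (q / p)"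
  shows "E k * loc f k epowr (r / q) \<le> K epowr (r / q) * ((E k * \<Psi> epowr r) * nmk f k epowr (r / p))"
proof -
  have "loc f k epowr (r / q) \<le> (K * \<Psi> epowr q * nmk f k epowr (q / p)) epowr (r / q)"
    using q r by (intro epowr_mono K) auto
  also have "\<dots> = K epowr (r / q) * \<Psi> epowr r * nmk f k epowr (r / p)"
    using q by (simp add: epowr_mult epowr_epowr)
  finally have "E k * loc f k epowr (r / q) \<le> E k * (K epowr (r / q) * \<Psi> epowr r * nmk f k epowr (r / p))"
    by (rule mult_left_mono) simp
  then show ?thesis by (simp add: mult_ac)
qed

lemma finite_of_E: "E k * \<Psi> epowr r < top \<Longrightarrow> \<Psi> < top"
  using E_inverse(2)[of k] r by (cases "\<Psi> = top") (simp_all add: ennreal_mult_top top.not_eq_extremum)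

lemma S1_upper_sup:
  assumes K: "\<And>f k. f \<in> Mplus a b \<Longrightarrow> \<Psi> k < top \<Longrightarrow> loc f k \<le> K * \<Psi> k epowr q * nmk f k epowr (q / p)"
    and f: "f \<in> Mplus a b" and pr: "p \<le> r"
    and A: "\<And>k. E k * \<Psi> k epowr r \<le> A epowr r" "A < top"
  shows "S1 f \<le> K epowr (r / q) * A epowr r * nm f epowr (r / p)"
proof -
  have fin: "\<Psi> k < top" for k
    by (rule finite_of_E[OF le_less_trans[OF A(1)]]) (simp add: A(2))
  have "S1 f \<le> isum (\<lambda>k. K epowr (r / q) * ((E k * \<Psi> k epowr r) * nmk f k epowr (r / p)))"
    unfolding S1_def by (intro isum_mono S1_term_le K f fin)
  also have "\<dots> \<le> K epowr (r / q) * (A epowr r * isum (nmk f) epowr (r / p))"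
    unfolding isum_cmult using p pr by (intro mult_left_mono diagonal_le_sup[OF A(1)]) simp_all
  finally show ?thesis by (simp only: isum_nmk[OF f] mult.assoc)
qed

lemma S1_upper_sum:
  assumes K: "\<And>f k. f \<in> Mplus a b \<Longrightarrow> \<Psi> k < top \<Longrightarrow> loc f k \<le> K * \<Psi> k epowr q * nmk f k epowr (q / p)"
    and f: "f \<in> Mplus a b" and rp: "r < p"
    and A: "isum (\<lambda>k. (E k * \<Psi> k epowr r) epowr (p / (p - r))) < top"
  shows "S1 f \<le> K epowr (r / q) * isum (\<lambda>k. (E k * \<Psi> k epowr r) epowr (p / (p - r))) epowr ((p - r) / p) *
    nm f epowr (r / p)"
proof -
  have \<theta>: "0 < r / p" "r / p < 1" "1 / (1 - r / p) = p / (p - r)" "1 - r / p = (p - r) / p"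
    using r rp by (auto simp: field_simps)
  have fin: "\<Psi> k < top" for k
  proof -
    have "(E k * \<Psi> k epowr r) epowr (p / (p - r)) < top"
      by (rule le_less_trans[OF le_isum A])
    then show ?thesis by (rule finite_of_E[OF epowr_less_top_iff[THEN iffD1]])
  qed
  have "S1 f \<le> isum (\<lambda>k. K epowr (r / q) * ((E k * \<Psi> k epowr r) * nmk f k epowr (r / p)))"
    unfolding S1_def by (intro isum_mono S1_term_le K f fin)
  also have "\<dots> \<le> K epowr (r / q) * (isum (\<lambda>k. (E k * \<Psi> k epowr r) epowr (p / (p - r))) epowr ((p - r) / p) *
      isum (nmk f) epowr (r / p))"
    unfolding isum_cmult
    using diagonal_le_sum[OF \<theta>(1,2), of "\<lambda>k. E k * \<Psi> k epowr r" "nmk f"]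
    unfolding \<theta>(3) unfolding \<theta>(4) by (rule mult_left_mono) simp
  finally show ?thesis by (simp only: isum_nmk[OF f] mult.assoc)
qed

lemma extend_cell:
  assumes f: "f \<in> Mplus (y (k - 1)) (y k)"
  shows "(\<lambda>t. f t * indicator (I k) t) \<in> Mplus a b"
    and "nm (\<lambda>t. f t * indicator (I k) t) = nmk f k"
    and "loc (\<lambda>t. f t * indicator (I k) t) k = loc f k"
proof -
  show "(\<lambda>t. f t * indicator (I k) t) \<in> Mplus a b"
    using f by (intro borel_measurable_lebesgue_Mplus) (simp add: Mplus_iff)
  show "nm (\<lambda>t. f t * indicator (I k) t) = nmk f k"
    unfolding integ_eq using I_subset[of k] by (intro nn_integral_cong) (auto split: split_indicator)
  show "loc (\<lambda>t. f t * indicator (I k) t) k = loc f k"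
    unfolding loc_def
  proof (rule integ_cong)
    fix t assume t: "t \<in> I k"
    have "integ (y (k - 1)) (ereal t) (\<lambda>t. f t * indicator (I k) t) = integ (y (k - 1)) (ereal t) f"
    proof (rule integ_cong)
      fix s assume "s \<in> einterval (y (k - 1)) (ereal t)"
      then have "s \<in> I k" using t less_trans[of "ereal s" "ereal t" "y k"] by (simp add: einterval_iff)
      then show "f s * indicator (I k) s = f s" by simp
    qed
    then show "integ (y (k - 1)) (ereal t) (\<lambda>t. f t * indicator (I k) t) epowr q * ennreal (u t) =
        integ (y (k - 1)) (ereal t) f epowr q * ennreal (u t)" by simp
  qed
qed

text \<open>A function living on one cell isolates the k-th term of \<open>S1\<close>. A global
  bound B thus limits \<open>loc\<close> by (2^k B)^(q/r), which is fed into the local lower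
  estimate.\<close>

lemma S1_lower_term:
  assumes K: "\<And>B. B < top \<Longrightarrow> (\<And>f. f \<in> Mplus (y (k - 1)) (y k) \<Longrightarrow> nmk f k \<le> 1 \<Longrightarrow> loc f k \<le> B) \<Longrightarrow>
      \<Psi> epowr q \<le> K * B"
    and B: "\<And>f. f \<in> Mplus a b \<Longrightarrow> nm f \<le> 1 \<Longrightarrow> S1 f \<le> B" "B < top"
  shows "E k * \<Psi> epowr r \<le> K epowr (r / q) * B"
proof -
  let ?e = "ennreal (2 powr real_of_int k)"
  have qr: "0 < q / r" "0 < r / q" using q r by auto
  have "loc f k \<le> (?e * B) epowr (q / r)" if f: "f \<in> Mplus (y (k - 1)) (y k)" "nmk f k \<le> 1" for f
  proof -
    have "E k * loc f k epowr (r / q) \<le> S1 (\<lambda>t. f t * indicator (I k) t)"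
      unfolding S1_def extend_cell(3)[OF f(1), symmetric]
      by (rule le_isum[of "\<lambda>i. E i * loc (\<lambda>t. f t * indicator (I k) t) i epowr (r / q)"])
    also have "\<dots> \<le> B" 
    proof (rule B(1)[OF extend_cell(1)[OF f(1)]])
      show "nm (\<lambda>t. f t * indicator (I k) t) \<le> 1" unfolding extend_cell(2)[OF f(1)] by (rule f(2))
    qed
    finally have "?e * (E k * loc f k epowr (r / q)) \<le> ?e * B" by (rule mult_left_mono) simp
    then have "loc f k epowr (r / q) \<le> ?e * B"
      by (simp only: mult.assoc[symmetric] E_inverse mult_1_left)
    then show ?thesis using epowr_le_iff_le_root[OF qr(2)] by simp
  qed
  then have "\<Psi> epowr q \<le> K * (?e * B) epowr (q / r)"
    using B(2) by (intro K) (auto simp: ennreal_mult_less_top)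
  then have "(\<Psi> epowr q) epowr (r / q) \<le> (K * (?e * B) epowr (q / r)) epowr (r / q)"
    using qr by (intro epowr_mono) auto
  then have "\<Psi> epowr r \<le> K epowr (r / q) * (?e * B)"
    using q r by (simp only: epowr_mult[of K] epowr_epowr) simp
  then have "E k * \<Psi> epowr r \<le> E k * (K epowr (r / q) * (?e * B))"
    by (rule mult_left_mono) simp
  also have "\<dots> = (?e * E k) * (K epowr (r / q) * B)" by (simp only: mult_ac)
  finally show ?thesis by (simp only: E_inverse mult_1_left)
qed

text \<open>Near-optimal functions on all cells, merged with weights \<open>d k\<close>, reduce the
  claim to the converse for diagonal operators with \<theta> = r/p.\<close>

lemma S1_lower_sum:
  assumes K: "\<And>k B. B < top \<Longrightarrow> (\<And>f. f \<in> Mplus (y (k - 1)) (y k) \<Longrightarrow> nmk f k \<le> 1 \<Longrightarrow> loc f k \<le> B) \<Longrightarrow>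
      \<Psi> k epowr q \<le> ennreal \<kappa> * B" and \<kappa>: "0 < \<kappa>"
    and B: "\<And>f. f \<in> Mplus a b \<Longrightarrow> nm f \<le> 1 \<Longrightarrow> S1 f \<le> B" "B < top"
    and rp: "r < p"
  shows "isum (\<lambda>k. (E k * \<Psi> k epowr r) epowr (p / (p - r))) epowr ((p - r) / p) \<le> ennreal ((2 * \<kappa>) powr (r / q)) * B"
proof -
  have \<theta>: "0 < r / p" "r / p < 1" "1 / (1 - r / p) = p / (p - r)" "1 - r / p = (p - r) / p"
    using r rp by (auto simp: field_simps)
  have "\<exists>f. f \<in> Mplus (y (k - 1)) (y k) \<and> nmk f k \<le> 1 \<and> \<Psi> k epowr q \<le> ennreal (2 * \<kappa>) * loc f k" for k
  proof (cases "\<Psi> k = 0")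
    case True
    then show ?thesis using p by (intro exI[of _ "\<lambda>t. 0"]) (simp add: Mplus_def integ_def)
  next
    case False
    have "E k * \<Psi> k epowr r \<le> ennreal \<kappa> epowr (r / q) * B"
      by (rule S1_lower_term[OF K B])
    also have "\<dots> < top" using B(2) by (simp add: ennreal_mult_less_top)
    finally have "\<Psi> k < top" by (rule finite_of_E)
    then have "\<Psi> k epowr q < top" "\<Psi> k epowr q \<noteq> 0" using False by auto
    then obtain s where s: "\<Psi> k epowr q = ennreal s" "0 < s"
      by (cases "\<Psi> k epowr q") (auto simp: ennreal_eq_0_iff simp del: epowr_eq_0_iff epowr_less_top_iff epowr_eq_top_iff)
    show ?thesis
    proof (rule ccontr)
      assume no: "\<not> ?thesis"
      \<comment> \<open>If every function fell short, the local lower estimate could be applied with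
        the bound s/(2\<kappa>) and would give s \<le> s/2.\<close>
      have "\<Psi> k epowr q \<le> ennreal \<kappa> * ennreal (s / (2 * \<kappa>))"
      proof (rule K)
        fix f assume f: "f \<in> Mplus (y (k - 1)) (y k)" "nmk f k \<le> 1"
        have "\<not> \<Psi> k epowr q \<le> ennreal (2 * \<kappa>) * loc f k" using no f by blast
        then have "ennreal (2 * \<kappa>) * loc f k \<le> ennreal s" unfolding s(1) by simp
        then have "ennreal (1 / (2 * \<kappa>)) * (ennreal (2 * \<kappa>) * loc f k) \<le> ennreal (1 / (2 * \<kappa>)) * ennreal s"
          by (rule mult_left_mono) simp
        then show "loc f k \<le> ennreal (s / (2 * \<kappa>))"
          using \<kappa> s(2) by (simp add: mult.assoc[symmetric] ennreal_mult[symmetric])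
      qed simp
      then have "ennreal s \<le> ennreal (s / 2)"
        unfolding s(1) using \<kappa> s(2) by (simp add: ennreal_mult[symmetric])
      then show False using s(2) by (simp add: ennreal_le_iff)
    qed
  qed
  then obtain g where g: "\<And>k. g k \<in> Mplus (y (k - 1)) (y k)" "\<And>k. nmk (g k) k \<le> 1"
    "\<And>k. \<Psi> k epowr q \<le> ennreal (2 * \<kappa>) * loc (g k) k"
    using choice[of "\<lambda>k f. f \<in> Mplus (y (k - 1)) (y k) \<and> nmk f k \<le> 1 \<and> \<Psi> k epowr q \<le> ennreal (2 * \<kappa>) * loc f k"]
    by blast
  define h where "h = (\<lambda>k t. g k t * indicator (I k) t)"
  have h: "\<And>k. h k \<in> Mplus a b" "\<And>k. nm (h k) \<le> 1" "\<And>k. loc (h k) k = loc (g k) k"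
    unfolding h_def using extend_cell[OF g(1)] g(2) by simp_all
  have "isum (\<lambda>k. (E k * \<Psi> k epowr r) * d k epowr (r / p)) \<le> ennreal ((2 * \<kappa>) powr (r / q)) * B"
    if d: "isum d \<le> 1" for d
  proof -
    \<comment> \<open>The weights have total at most 1, so the energy stays at most 1, while on cell
      k the primitive dominates that of the k-th constituent.\<close>
    define f where "f = (\<lambda>t. SUP k. d k epowr (1 / p) * h k t)"
    have f: "f \<in> Mplus a b" unfolding f_def by (rule Mplus_SUP[OF h(1)])
    have en: "nm f \<le> 1" unfolding f_def using p by (intro energy_SUP_le h v d) auto
    have "(E k * \<Psi> k epowr r) * d k epowr (r / p) \<le>
        ennreal ((2 * \<kappa>) powr (r / q)) * (E k * loc f k epowr (r / q))" for k
    proof -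
      have "d k epowr (q / p) * loc (h k) k = integ (y (k - 1)) (y k)
          (\<lambda>t. d k epowr (q / p) * (integ (y (k - 1)) (ereal t) (h k) epowr q * ennreal (u t)))"
        unfolding loc_def
        by (intro integ_cmult[symmetric] Mplus_times[OF borel_Mplus cell_Mplus[OF weight_Mplus[OF u]]]
            borel_measurable_epowr borel_measurable_primitive)
      also have "\<dots> \<le> loc f k"
        unfolding loc_def
      proof (rule integ_mono)
        fix t assume t: "t \<in> I k"
        have "h k \<in> Mplus (y (k - 1)) (ereal t)"
          using t y_less[of k] less_trans[of "ereal t" "y k" b]
          by (intro Mplus_mono[OF h(1) y_ge]) (auto simp: einterval_iff intro: less_imp_le)
        then have "d k epowr (1 / p) * integ (y (k - 1)) (ereal t) (h k) =
            integ (y (k - 1)) (ereal t) (\<lambda>s. d k epowr (1 / p) * h k s)"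
          by (rule integ_cmult[symmetric])
        also have "\<dots> \<le> integ (y (k - 1)) (ereal t) f"
          unfolding f_def by (intro integ_mono SUP_upper) simp
        finally have "(d k epowr (1 / p) * integ (y (k - 1)) (ereal t) (h k)) epowr q \<le>
            integ (y (k - 1)) (ereal t) f epowr q"
          using q by (intro epowr_mono) auto
        then have "d k epowr (q / p) * integ (y (k - 1)) (ereal t) (h k) epowr q \<le>
            integ (y (k - 1)) (ereal t) f epowr q"
          by (simp add: epowr_mult epowr_epowr)
        then show "d k epowr (q / p) * (integ (y (k - 1)) (ereal t) (h k) epowr q * ennreal (u t)) \<le>
            integ (y (k - 1)) (ereal t) f epowr q * ennreal (u t)"
          unfolding mult.assoc[symmetric] by (rule mult_right_mono) simp
      qed
      finally have 1: "d k epowr (q / p) * loc (g k) k \<le> loc f k" by (simp only: h(3))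
      have "\<Psi> k epowr q * d k epowr (q / p) \<le> ennreal (2 * \<kappa>) * loc (g k) k * d k epowr (q / p)"
        by (intro mult_right_mono g) simp
      also have "\<dots> \<le> ennreal (2 * \<kappa>) * loc f k"
        using mult_left_mono[OF 1, of "ennreal (2 * \<kappa>)"] by (simp add: mult_ac)
      finally have "(\<Psi> k epowr q * d k epowr (q / p)) epowr (r / q) \<le> (ennreal (2 * \<kappa>) * loc f k) epowr (r / q)"
        using q r by (intro epowr_mono) auto
      moreover have "(\<Psi> k epowr q * d k epowr (q / p)) epowr (r / q) = \<Psi> k epowr r * d k epowr (r / p)"
        using q by (simp add: epowr_mult epowr_epowr)
      moreover have "(ennreal (2 * \<kappa>) * loc f k) epowr (r / q) = ennreal ((2 * \<kappa>) powr (r / q)) * loc f k epowr (r / q)"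
        using \<kappa> by (simp add: epowr_mult)
      ultimately have "\<Psi> k epowr r * d k epowr (r / p) \<le> ennreal ((2 * \<kappa>) powr (r / q)) * loc f k epowr (r / q)" by simp
      from mult_left_mono[OF this, of "E k"] show ?thesis by (simp add: mult_ac)
    qed
    then have "isum (\<lambda>k. (E k * \<Psi> k epowr r) * d k epowr (r / p)) \<le>
        isum (\<lambda>k. ennreal ((2 * \<kappa>) powr (r / q)) * (E k * loc f k epowr (r / q)))"
      by (rule isum_mono)
    also have "\<dots> = ennreal ((2 * \<kappa>) powr (r / q)) * S1 f" unfolding S1_def by (simp only: isum_cmult)
    also have "\<dots> \<le> ennreal ((2 * \<kappa>) powr (r / q)) * B" by (intro mult_left_mono B f en) simp
    finally show ?thesis .
  qed
  then have "isum (\<lambda>k. (E k * \<Psi> k epowr r) epowr (1 / (1 - r / p))) \<le>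
      (ennreal ((2 * \<kappa>) powr (r / q)) * B) epowr (1 / (1 - r / p))"
    by (rule diagonal_sum_le[OF \<theta>(1,2)])
  then show ?thesis
    unfolding \<theta>(3) using rp p by (subst epowr_le_iff_le_root) auto
qed

end

section \<open>Cell functionals and the discrete Hardy operator\<close>

text \<open>\<open>S1_lower_sum\<close> divides by its constant, which therefore has to be a
  positive real.\<close>

definition kl :: "real \<Rightarrow> real \<Rightarrow> real" where
  "kl p q = enn2real (KL p q) + 1"

lemma kl_pos: "0 < kl p q"
  by (simp add: kl_def add_nonneg_pos)

lemma KL_le_kl: "1 \<le> p \<Longrightarrow> 0 < q \<Longrightarrow> KL p q \<le> ennreal (kl p q)"
  using KL_less_top[of p q] by (cases "KL p q") (auto simp: kl_def ennreal_leI)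

context discretization
begin

lemma cell_hardy: "hardy_measure p (y (k - 1)) (y k) v (udist (y (k - 1)) (y k) u)"
proof
  have u': "weight (y (k - 1)) (y k) u" and v': "weight (y (k - 1)) (y k) v"
    using weight_mono[OF u y_ge less_imp_le[OF y_less]] weight_mono[OF v y_ge less_imp_le[OF y_less]] by auto
  show "weight (y (k - 1)) (y k) v" by (rule v')
  show "AE t in udist (y (k - 1)) (y k) u. t \<in> I k"
    by (rule AE_udist[OF u']) (auto intro: AE_lebesgue_onI)
qed (use p in simp_all)

lemma cell_u: "weight (y (k - 1)) (y k) u"
  by (rule weight_mono[OF u y_ge less_imp_le[OF y_less]])

lemma cell_loc: "(\<integral>\<^sup>+ t. integ (y (k - 1)) (ereal t) f epowr q \<partial>udist (y (k - 1)) (y k) u) = loc f k"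
  unfolding loc_def
  by (intro nn_integral_udist[OF cell_u] borel_measurable_epowr borel_measurable_primitive)

lemma cell_V_Mplus: "(\<lambda>t. V p v (y (k - 1)) (ereal t)) \<in> Mplus (y (k - 1)) (y k)"
proof -
  interpret H: hardy_measure p "y (k - 1)" "y k" v "udist (y (k - 1)) (y k) u" by (rule cell_hardy)
  show ?thesis
    unfolding Mplus_iff by (rule measurable_completion) (use H.Va_measurable in simp)
qed

definition U :: "int \<Rightarrow> real \<Rightarrow> ennreal" where
  "U k t = integ (ereal t) (y k) (\<lambda>s. ennreal (u s))"

lemma U_measurable: "U k \<in> borel_measurable borel"
  by (rule borel_measurable_antimono_ennreal) (simp add: U_def integ_mono_interval)

text \<open>The constant of the local inequality on cell k for p \<le> q. Its counterpart for q < p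
  is \<open>\<Theta>\<close>, a root of Maz'ya's functional.\<close>

definition \<Phi> :: "int \<Rightarrow> ennreal" where
  "\<Phi> k = ess_sup (y (k - 1)) (y k) (\<lambda>t. U k t epowr (1 / q) * V p v (y (k - 1)) (ereal t))"

definition \<Theta> :: "int \<Rightarrow> ennreal" where
  "\<Theta> k = integ (y (k - 1)) (y k) (\<lambda>t. U k t epowr (q / (p - q)) * ennreal (u t) *
      V p v (y (k - 1)) (ereal t) epowr (p * q / (p - q))) epowr ((p - q) / (p * q))"

lemma \<Phi>_integrand: "(\<lambda>t. U k t epowr (1 / q) * V p v (y (k - 1)) (ereal t)) \<in> Mplus (y (k - 1)) (y k)"
  by (intro Mplus_times[OF borel_Mplus cell_V_Mplus] borel_measurable_epowr U_measurable)

text \<open>The essential supremum bounds its argument Lebesgue-almost everywhere, hence almost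
  everywhere for u dt, whose tail at t is \<open>U k t\<close>.\<close>

lemma loc_upper_\<Phi>:
  assumes pq: "p \<le> q" and f: "f \<in> Mplus a b" and fin: "\<Phi> k < top"
  shows "loc f k \<le> KU p q * \<Phi> k epowr q * nmk f k epowr (q / p)"
proof -
  interpret H: hardy_measure p "y (k - 1)" "y k" v "udist (y (k - 1)) (y k) u" by (rule cell_hardy)
  let ?P = "\<lambda>t. H.tail t * (H.Va t * indicator (I k) t) epowr q \<le> \<Phi> k epowr q"
  have "AE t in lebesgue_on (I k). U k t epowr (1 / q) * H.Va t \<le> \<Phi> k"
    unfolding \<Phi>_def ess_sup_def by (rule esssup_AE)
  moreover have "AE t in lebesgue_on (I k). t \<in> I k" by (intro AE_lebesgue_onI)
  ultimately have "AE t in lebesgue_on (I k). ?P t"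
  proof eventually_elim
    fix t assume t: "U k t epowr (1 / q) * H.Va t \<le> \<Phi> k" "t \<in> I k"
    have "(U k t epowr (1 / q) * H.Va t) epowr q \<le> \<Phi> k epowr q"
      using q t(1) by (intro epowr_mono) auto
    then show "?P t"
      using q t(2) tail_udist[OF cell_u t(2)] by (simp add: epowr_mult epowr_epowr U_def)
  qed
  moreover have "{t. ?P t} \<in> sets borel"
  proof -
    have "{t \<in> space borel. ?P t} \<in> sets borel" by measurable
    then show ?thesis by simp
  qed
  ultimately have "AE t in udist (y (k - 1)) (y k) u. ?P t" by (intro AE_udist[OF cell_u])
  then have "AE t in udist (y (k - 1)) (y k) u. H.tail t * H.Va t epowr q \<le> \<Phi> k epowr q"
    using H.AE_interval by eventually_elim simp
  from H.upper_sup[OF cell_Mplus[OF f] pq this] show ?thesis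
    using fin by (simp only: cell_loc epowr_less_top_iff)
qed

lemma loc_lower_\<Phi>:
  assumes pq: "p \<le> q"
    and B: "\<And>f. f \<in> Mplus (y (k - 1)) (y k) \<Longrightarrow> nmk f k \<le> 1 \<Longrightarrow> loc f k \<le> B"
  shows "\<Phi> k epowr q \<le> KL p q * B"
proof -
  interpret H: hardy_measure p "y (k - 1)" "y k" v "udist (y (k - 1)) (y k) u" by (rule cell_hardy)
  have *: "U k t epowr (1 / q) * H.Va t \<le> B epowr (1 / q)" if t: "t \<in> I k" for t
  proof -
    have "H.tail t * H.Va t epowr q \<le> B"
      by (rule H.lower_sup[OF q _ t]) (simp only: cell_loc, rule B)
    then have "(U k t epowr (1 / q) * H.Va t) epowr q \<le> B"
      using q tail_udist[OF cell_u t] by (simp add: epowr_mult epowr_epowr U_def)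
    then show ?thesis by (simp only: epowr_le_iff_le_root[OF q])
  qed
  have "\<Phi> k \<le> B epowr (1 / q)"
    unfolding \<Phi>_def ess_sup_def
    using \<Phi>_integrand by (intro esssup_I AE_lebesgue_onI *) (simp_all add: Mplus_def)
  then show ?thesis using pq q by (simp add: KL_def epowr_le_iff_le_root)
qed

lemma cell_mazya:
  assumes qp: "q < p"
  shows "(\<integral>\<^sup>+ t. emeasure (udist (y (k - 1)) (y k) u) {t..} epowr (q / (p - q)) *
      V p v (y (k - 1)) (ereal t) epowr (p * q / (p - q)) \<partial>udist (y (k - 1)) (y k) u) =
    \<Theta> k epowr (p * q / (p - q))"
proof -
  interpret H: hardy_measure p "y (k - 1)" "y k" v "udist (y (k - 1)) (y k) u" by (rule cell_hardy)
  have "H.mazya q = integ (y (k - 1)) (y k) (\<lambda>t. (H.tail t epowr (q / (p - q)) *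
      (H.Va t * indicator (I k) t) epowr (p * q / (p - q))) * ennreal (u t))"
    unfolding H.mazya_eq by (rule nn_integral_udist[OF cell_u]) measurable
  also have "\<dots> = integ (y (k - 1)) (y k) (\<lambda>t. U k t epowr (q / (p - q)) * ennreal (u t) *
      V p v (y (k - 1)) (ereal t) epowr (p * q / (p - q)))"
    by (intro integ_cong) (simp add: tail_udist[OF cell_u] U_def mult_ac)
  also have "\<dots> = \<Theta> k epowr (p * q / (p - q))"
    using p q qp by (simp add: \<Theta>_def epowr_epowr)
  finally show ?thesis .
qed

lemma loc_upper_\<Theta>:
  assumes qp: "q < p" and f: "f \<in> Mplus a b" and fin: "\<Theta> k < top"
  shows "loc f k \<le> KU p q * \<Theta> k epowr q * nmk f k epowr (q / p)"
proof -
  interpret H: hardy_measure p "y (k - 1)" "y k" v "udist (y (k - 1)) (y k) u" by (rule cell_hardy)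
  have e: "(\<Theta> k epowr (p * q / (p - q))) epowr ((p - q) / p) = \<Theta> k epowr q"
    using p qp by (simp add: epowr_epowr)
  show ?thesis
    using H.upper_mazya[OF cell_Mplus[OF f] q qp] fin
    unfolding cell_mazya[OF qp] cell_loc e by simp
qed

lemma loc_lower_\<Theta>:
  assumes qp: "q < p" and Btop: "B < top"
    and B: "\<And>f. f \<in> Mplus (y (k - 1)) (y k) \<Longrightarrow> nmk f k \<le> 1 \<Longrightarrow> loc f k \<le> B"
  shows "\<Theta> k epowr q \<le> KL p q * B"
proof -
  interpret H: hardy_measure p "y (k - 1)" "y k" v "udist (y (k - 1)) (y k) u" by (rule cell_hardy)
  have e: "(\<Theta> k epowr (p * q / (p - q))) epowr ((p - q) / p) = \<Theta> k epowr q"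
    using p qp by (simp add: epowr_epowr)
  have "H.mazya q epowr ((p - q) / p) \<le> KL p q * B"
    by (rule H.lower_mazya[OF q qp Btop]) (simp only: cell_loc, rule B)
  then show ?thesis unfolding cell_mazya[OF qp] e .
qed

text \<open>The discrete Hardy operator \<open>f \<mapsto> (\<integral>\<^bsub>a\<^esub>\<^bsup>x\<^sub>k\<^esup> f)\<^sub>k\<close> is the Hardy operator
  for a purely atomic measure with atoms at the points of the sequence.\<close>

definition \<mu> :: "int \<Rightarrow> ennreal" where
  "\<mu> k = (if a < y k then E k * um k epowr (r / q) else 0)"

text \<open>Above a the points are finite and \<open>yr\<close> loses nothing. If y k = a is
  infinite, the value is the default 0, harmless because such an index has mass 0.\<close>

definition yr :: "int \<Rightarrow> real" where
  "yr k = real_of_ereal (y k)"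

definition atoms :: "real measure" where
  "atoms = distr (density (count_space UNIV) \<mu>) borel yr"

lemma sets_atoms [simp, measurable_cong]: "sets atoms = sets borel"
  by (simp add: atoms_def)

lemma ereal_yr: "a < y k \<Longrightarrow> ereal (yr k) = y k"
  using y_less[of k] unfolding yr_def by (cases "y k") auto

lemma nn_integral_atoms: "g \<in> borel_measurable borel \<Longrightarrow> (\<integral>\<^sup>+ t. g t \<partial>atoms) = isum (\<lambda>k. \<mu> k * g (yr k))"
  unfolding atoms_def by (subst nn_integral_distr) (auto simp: nn_integral_density)

lemma AE_atoms:
  assumes P: "{t. P t} \<in> sets borel" and le: "\<And>k. a < y k \<Longrightarrow> P (yr k)"
  shows "AE t in atoms. P t"
proof -
  have "AE k in density (count_space UNIV) \<mu>. P (yr k)"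
    by (subst AE_density) (auto simp: AE_count_space \<mu>_def le)
  then show ?thesis unfolding atoms_def using P by (subst AE_distr_iff) auto
qed

lemma atoms_hardy: "hardy_measure p a b v atoms"
proof
  show "AE t in atoms. t \<in> einterval a b"
    using y_less by (intro AE_atoms) (auto simp: einterval_iff ereal_yr)
qed (use p v in simp_all)

lemma atoms_S2: "(\<integral>\<^sup>+ t. integ a (ereal t) f epowr r \<partial>atoms) = S2 f"
proof -
  have "(\<integral>\<^sup>+ t. integ a (ereal t) f epowr r \<partial>atoms) = isum (\<lambda>k. \<mu> k * integ a (ereal (yr k)) f epowr r)"
    by (intro nn_integral_atoms borel_measurable_epowr borel_measurable_primitive)
  also have "\<dots> = S2 f"
    unfolding S2_def
  proof (rule nn_integral_cong)
    fix k
    show "\<mu> k * integ a (ereal (yr k)) f epowr r = E k * um k epowr (r / q) * integ a (y k) f epowr r"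
    proof (cases "a < y k")
      case False
      then have "y k = a" using y_ge[of k] by auto
      then show ?thesis by (simp add: \<mu>_def)
    qed (simp add: \<mu>_def ereal_yr)
  qed
  finally show ?thesis .
qed

definition ts :: "int \<Rightarrow> ennreal" where
  "ts k = isum (\<lambda>i. E i * um i epowr (r / q) * indicator {k..} i)"

text \<open>Strictness of the sequence above a separates the atoms: among the indices with a < y i,
  the half-line starting at \<open>yr k\<close> meets exactly those from k on.\<close>

lemma tail_atoms:
  assumes k: "a < y k"
  shows "emeasure atoms {yr k..} = ts k"
proof -
  have "emeasure atoms {yr k..} = (\<integral>\<^sup>+ s. indicator {yr k..} s \<partial>atoms)" by simp
  also have "\<dots> = isum (\<lambda>i. \<mu> i * indicator {yr k..} (yr i))"
    by (rule nn_integral_atoms) simp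
  also have "\<dots> = ts k"
    unfolding ts_def
  proof (rule nn_integral_cong)
    fix i
    show "\<mu> i * indicator {yr k..} (yr i) = E i * um i epowr (r / q) * indicator {k..} i"
    proof (cases "k \<le> i")
      case True
      then have "a < y i" "y k \<le> y i" using k y_mono[OF True] by auto
      then have "ereal (yr k) \<le> ereal (yr i)" using k by (simp add: ereal_yr)
      then show ?thesis using True \<open>a < y i\<close> by (simp add: \<mu>_def)
    next
      case False
      have "\<not> yr k \<le> yr i" if ai: "a < y i"
      proof -
        have "y i < y k" using False k by (intro y_strict) auto
        then have "ereal (yr i) < ereal (yr k)" using k ai by (simp add: ereal_yr)
        then show ?thesis by simp
      qed
      then show ?thesis using False by (simp add: \<mu>_def)
    qed
  qed
  finally show ?thesis .
qed

definition BS :: ennreal where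
  "BS = (SUP k\<in>{k. a < y k}. ts k epowr (1 / r) * V p v a (y k))"

definition BI :: ennreal where
  "BI = isum (\<lambda>k. \<mu> k * ts k epowr (r / (p - r)) * V p v a (y k) epowr (p * r / (p - r)))"

lemma S2_upper_sup:
  assumes pr: "p \<le> r" and f: "f \<in> Mplus a b" and fin: "BS < top"
  shows "S2 f \<le> KU p r * BS epowr r * nm f epowr (r / p)"
proof -
  interpret H: hardy_measure p a b v atoms by (rule atoms_hardy)
  let ?P = "\<lambda>t. H.tail t * (H.Va t * indicator (einterval a b) t) epowr r \<le> BS epowr r"
  have "AE t in atoms. ?P t"
  proof (rule AE_atoms)
    have "{t \<in> space borel. ?P t} \<in> sets borel" by measurable
    then show "{t. ?P t} \<in> sets borel" by simp
    fix k assume k: "a < y k"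
    have "yr k \<in> einterval a b" using k y_less[of k] by (simp add: einterval_iff ereal_yr)
    have "ts k epowr (1 / r) * V p v a (y k) \<le> BS"
      unfolding BS_def using k by (intro SUP_upper) simp
    then have "(ts k epowr (1 / r) * V p v a (y k)) epowr r \<le> BS epowr r"
      using r by (intro epowr_mono) auto
    then show "?P (yr k)"
      using r k \<open>yr k \<in> einterval a b\<close> by (simp add: epowr_mult epowr_epowr tail_atoms ereal_yr)
  qed
  then have "AE t in atoms. H.tail t * H.Va t epowr r \<le> BS epowr r"
    using H.AE_interval by eventually_elim simp
  from H.upper_sup[OF f pr this] show ?thesis
    using fin by (simp only: atoms_S2 epowr_less_top_iff)
qed

lemma S2_lower_sup:
  assumes pr: "p \<le> r" and B: "\<And>f. f \<in> Mplus a b \<Longrightarrow> nm f \<le> 1 \<Longrightarrow> S2 f \<le> B"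
  shows "BS epowr r \<le> KL p r * B"
proof -
  interpret H: hardy_measure p a b v atoms by (rule atoms_hardy)
  have "BS \<le> B epowr (1 / r)"
    unfolding BS_def
  proof (rule SUP_least)
    fix k assume "k \<in> {k. a < y k}"
    then have k: "a < y k" by simp
    have t: "yr k \<in> einterval a b" using k y_less[of k] by (simp add: einterval_iff ereal_yr)
    have "H.tail (yr k) * H.Va (yr k) epowr r \<le> B"
      by (rule H.lower_sup[OF r _ t]) (simp only: atoms_S2, rule B)
    then have "(ts k epowr (1 / r) * V p v a (y k)) epowr r \<le> B"
      using r k by (simp add: epowr_mult epowr_epowr tail_atoms ereal_yr)
    then show "ts k epowr (1 / r) * V p v a (y k) \<le> B epowr (1 / r)"
      by (simp only: epowr_le_iff_le_root[OF r])
  qed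
  then show ?thesis using pr r by (simp add: KL_def epowr_le_iff_le_root)
qed

lemma atoms_mazya:
  "(\<integral>\<^sup>+ t. emeasure atoms {t..} epowr (r / (p - r)) * V p v a (ereal t) epowr (p * r / (p - r)) \<partial>atoms) = BI"
proof -
  interpret H: hardy_measure p a b v atoms by (rule atoms_hardy)
  have "H.mazya r = isum (\<lambda>k. \<mu> k * (H.tail (yr k) epowr (r / (p - r)) *
      (H.Va (yr k) * indicator (einterval a b) (yr k)) epowr (p * r / (p - r))))"
    unfolding H.mazya_eq by (rule nn_integral_atoms) measurable
  also have "\<dots> = BI"
    unfolding BI_def
  proof (rule nn_integral_cong)
    fix k
    show "\<mu> k * (H.tail (yr k) epowr (r / (p - r)) *
      (H.Va (yr k) * indicator (einterval a b) (yr k)) epowr (p * r / (p - r))) =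
      \<mu> k * ts k epowr (r / (p - r)) * V p v a (y k) epowr (p * r / (p - r))"
    proof (cases "a < y k")
      case True
      then have "yr k \<in> einterval a b" using y_less[of k] by (simp add: einterval_iff ereal_yr)
      then show ?thesis using True by (simp add: tail_atoms ereal_yr mult.assoc)
    qed (simp add: \<mu>_def)
  qed
  finally show ?thesis .
qed

lemma S2_upper_sum:
  assumes rp: "r < p" and f: "f \<in> Mplus a b" and fin: "BI < top"
  shows "S2 f \<le> KU p r * BI epowr ((p - r) / p) * nm f epowr (r / p)"
proof -
  interpret H: hardy_measure p a b v atoms by (rule atoms_hardy)
  show ?thesis
    using H.upper_mazya[OF f r rp] fin unfolding atoms_mazya atoms_S2 by simp
qed

lemma S2_lower_sum:
  assumes rp: "r < p" and Btop: "B < top" and B: "\<And>f. f \<in> Mplus a b \<Longrightarrow> nm f \<le> 1 \<Longrightarrow> S2 f \<le> B"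
  shows "BI epowr ((p - r) / p) \<le> KL p r * B"
proof -
  interpret H: hardy_measure p a b v atoms by (rule atoms_hardy)
  have "H.mazya r epowr ((p - r) / p) \<le> KL p r * B"
    by (rule H.lower_mazya[OF r rp Btop]) (simp only: atoms_S2, rule B)
  then show ?thesis unfolding atoms_mazya .
qed

end

section \<open>Best constants\<close>

text \<open>Almost everywhere bounds correspond under a positive power. \<open>A2\<close> has the
  power inside the essential supremum, the power of \<open>\<Phi>\<close> has it outside.\<close>

lemma ess_sup_epowr:
  assumes g: "g \<in> Mplus c d" and s: "0 < s"
  shows "ess_sup c d (\<lambda>t. g t epowr s) = ess_sup c d g epowr s"
proof (rule antisym)
  let ?L = "lebesgue_on (einterval c d)"
  have [measurable]: "g \<in> borel_measurable ?L" using g by (simp add: Mplus_def)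
  have "AE t in ?L. g t \<le> ess_sup c d g" unfolding ess_sup_def by (rule esssup_AE)
  then have "AE t in ?L. g t epowr s \<le> ess_sup c d g epowr s"
    by eventually_elim (use s in simp)
  then show "ess_sup c d (\<lambda>t. g t epowr s) \<le> ess_sup c d g epowr s"
    by (subst ess_sup_def, intro esssup_I) auto
  have "AE t in ?L. g t epowr s \<le> ess_sup c d (\<lambda>t. g t epowr s)" unfolding ess_sup_def by (rule esssup_AE)
  then have "AE t in ?L. g t \<le> ess_sup c d (\<lambda>t. g t epowr s) epowr (1 / s)"
    by eventually_elim (simp only: epowr_le_iff_le_root[OF s])
  then have "ess_sup c d g \<le> ess_sup c d (\<lambda>t. g t epowr s) epowr (1 / s)"
    by (subst ess_sup_def, intro esssup_I) auto
  then show "ess_sup c d g epowr s \<le> ess_sup c d (\<lambda>t. g t epowr s)"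
    by (simp only: epowr_le_iff_le_root[OF s])
qed

lemma ess_sup_empty: "ess_sup c c g = 0"
proof -
  have "ess_sup c c g \<le> 0"
    unfolding ess_sup_def
    by (intro esssup_I AE_lebesgue_onI) (auto simp: einterval_same measurable_def space_restrict_space)
  then show ?thesis by simp
qed

lemma SUP_zero_outside:
  fixes g :: "'a \<Rightarrow> ennreal"
  assumes "\<And>k. k \<notin> S \<Longrightarrow> g k = 0"
  shows "(SUP k. g k) = (SUP k\<in>S. g k)"
proof (rule antisym)
  show "(SUP k. g k) \<le> (SUP k\<in>S. g k)"
  proof (rule SUP_least)
    fix k
    show "g k \<le> (SUP k\<in>S. g k)"
      using assms[of k] by (cases "k \<in> S") (auto intro: SUP_upper)
  qed
qed (simp add: SUP_subset_mono)

section \<open>The functionals of the four cases in uniform notation\<close>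

context discretization
begin

lemma \<Phi>_degenerate: "y (k - 1) = y k \<Longrightarrow> \<Phi> k = 0"
  by (simp add: \<Phi>_def ess_sup_empty)

lemma \<Theta>_degenerate: "y (k - 1) = y k \<Longrightarrow> \<Theta> k = 0"
  by (simp add: \<Theta>_def)

lemma \<Phi>_power:
  assumes rp: "r < p"
  shows "ennreal (2 powr (- real_of_int k * (p / (p - r)))) *
    ess_sup (y (k - 1)) (y k) (\<lambda>t. U k t epowr (p * r / (q * (p - r))) *
      V p v (y (k - 1)) (ereal t) epowr (p * r / (p - r))) = (E k * \<Phi> k epowr r) epowr (p / (p - r))"
proof -
  have \<beta>: "0 < p * r / (p - r)" using p r rp by simp
  have "ess_sup (y (k - 1)) (y k) (\<lambda>t. U k t epowr (p * r / (q * (p - r))) *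
      V p v (y (k - 1)) (ereal t) epowr (p * r / (p - r))) =
    ess_sup (y (k - 1)) (y k) (\<lambda>t. (U k t epowr (1 / q) * V p v (y (k - 1)) (ereal t)) epowr (p * r / (p - r)))"
    by (simp add: epowr_mult epowr_epowr)
  also have "\<dots> = \<Phi> k epowr (p * r / (p - r))"
    unfolding \<Phi>_def by (rule ess_sup_epowr[OF \<Phi>_integrand \<beta>])
  finally show ?thesis by (simp add: epowr_mult epowr_epowr powr_powr mult.commute)
qed

lemma \<Theta>_power:
  assumes rp: "r < p" and qp: "q < p"
  shows "ennreal (2 powr (- real_of_int k * (p / (p - r)))) *
    integ (y (k - 1)) (y k) (\<lambda>t. U k t epowr (q / (p - q)) * ennreal (u t) *
      V p v (y (k - 1)) (ereal t) epowr (p * q / (p - q))) epowr (r * (p - q) / (q * (p - r))) =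
    (E k * \<Theta> k epowr r) epowr (p / (p - r))"
proof -
  have "(p - q) / (p * q) * (r * (p / (p - r))) = r * (p - q) / (q * (p - r))"
    using p q rp qp by (simp add: field_simps)
  then show ?thesis
    by (simp add: \<Theta>_def epowr_mult epowr_epowr powr_powr mult.assoc)
qed

text \<open>With \<open>\<Phi>\<close> and \<open>\<Theta>\<close> for \<Psi> this becomes
  \<open>A1\<close> and \<open>A3\<close>; likewise \<open>Asum\<close> becomes \<open>A2\<close>
  and \<open>A4\<close>.\<close>

definition Asup :: "(int \<Rightarrow> ennreal) \<Rightarrow> ennreal" where
  "Asup \<Psi> = (SUP k. ennreal (2 powr (- real_of_int k / r)) * \<Psi> k)"

definition Asum :: "(int \<Rightarrow> ennreal) \<Rightarrow> ennreal" where
  "Asum \<Psi> = isum (\<lambda>k. (E k * \<Psi> k epowr r) epowr (p / (p - r))) epowr ((p - r) / (p * r))"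

definition BI' :: ennreal where
  "BI' = BI epowr ((p - r) / (p * r))"

text \<open>Through this predicate and \<open>local_lower\<close> the cases p \<le> q and q < p
  share the estimates below. The finiteness conditions are those of the Maz'ya estimates.\<close>

definition local_upper :: "(int \<Rightarrow> ennreal) \<Rightarrow> bool" where
  "local_upper \<Psi> \<longleftrightarrow> (\<forall>f k. f \<in> Mplus a b \<longrightarrow> \<Psi> k < top \<longrightarrow>
     loc f k \<le> KU p q * \<Psi> k epowr q * nmk f k epowr (q / p))"

definition local_lower :: "(int \<Rightarrow> ennreal) \<Rightarrow> bool" where
  "local_lower \<Psi> \<longleftrightarrow> (\<forall>k B. B < top \<longrightarrow>
     (\<forall>f. f \<in> Mplus (y (k - 1)) (y k) \<longrightarrow> nmk f k \<le> 1 \<longrightarrow> loc f k \<le> B) \<longrightarrow>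
     \<Psi> k epowr q \<le> ennreal (kl p q) * B)"

lemma KL_le: "X \<le> KL p q * B \<Longrightarrow> X \<le> ennreal (kl p q) * B"
  using KL_le_kl[OF p q] by (meson mult_right_mono order_trans zero_le)

lemma local_\<Phi>: "p \<le> q \<Longrightarrow> local_upper \<Phi>" "p \<le> q \<Longrightarrow> local_lower \<Phi>"
  unfolding local_upper_def local_lower_def
  using loc_upper_\<Phi> loc_lower_\<Phi> KL_le by blast+

lemma local_\<Theta>: "q < p \<Longrightarrow> local_upper \<Theta>" "q < p \<Longrightarrow> local_lower \<Theta>"
  unfolding local_upper_def local_lower_def
  using loc_upper_\<Theta> loc_lower_\<Theta> KL_le by blast+

definition Kup :: ennreal where
  "Kup = KT * (KU p q epowr (r / q) + KU p r)"

definition Klow :: ennreal where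
  "Klow = ennreal (2 powr r) * (ennreal ((2 * kl p q) powr (r / q)) + KL p r)"

lemma T_le_of_S:
  assumes f: "f \<in> Mplus a b"
    and "S1 f \<le> KU p q epowr (r / q) * A epowr r * nm f epowr (r / p)"
    and "S2 f \<le> KU p r * B epowr r * nm f epowr (r / p)"
  shows "T f \<le> Kup * (A + B) epowr r * nm f epowr (r / p)"
proof -
  have AB: "A epowr r \<le> (A + B) epowr r" "B epowr r \<le> (A + B) epowr r"
    using r by simp_all
  have "S1 f \<le> KU p q epowr (r / q) * (A + B) epowr r * nm f epowr (r / p)"
    by (rule order_trans[OF assms(2)]) (intro mult_right_mono mult_left_mono AB zero_le)
  moreover have "S2 f \<le> KU p r * (A + B) epowr r * nm f epowr (r / p)"
    by (rule order_trans[OF assms(3)]) (intro mult_right_mono mult_left_mono AB zero_le)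
  ultimately have "S1 f + S2 f \<le> KU p q epowr (r / q) * (A + B) epowr r * nm f epowr (r / p) +
      KU p r * (A + B) epowr r * nm f epowr (r / p)"
    by (rule add_mono)
  then have "KT * (S1 f + S2 f) \<le> KT * (KU p q epowr (r / q) * (A + B) epowr r * nm f epowr (r / p) +
      KU p r * (A + B) epowr r * nm f epowr (r / p))"
    by (rule mult_left_mono) simp
  then show ?thesis
    by (intro order_trans[OF T_le_S[OF f]]) (simp add: Kup_def distrib_left distrib_right mult.assoc)
qed

lemma le_Klow:
  assumes "A epowr r \<le> ennreal ((2 * kl p q) powr (r / q)) * D" and "B epowr r \<le> KL p r * D"
  shows "(A + B) epowr r \<le> Klow * D"
proof -
  have "(A + B) epowr r \<le> ennreal (2 powr r) * (A epowr r + B epowr r)"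
    by (rule epowr_add_le[OF r])
  also have "\<dots> \<le> ennreal (2 powr r) * (ennreal ((2 * kl p q) powr (r / q)) * D + KL p r * D)"
    by (intro mult_left_mono add_mono assms) simp
  finally show ?thesis by (simp add: Klow_def distrib_right mult.assoc)
qed

lemma sup_upper:
  assumes "local_upper \<Psi>" and pr: "p \<le> r" and f: "f \<in> Mplus a b" and fin: "Asup \<Psi> + BS < top"
  shows "T f \<le> Kup * (Asup \<Psi> + BS) epowr r * nm f epowr (r / p)"
proof (rule T_le_of_S[OF f])
  have fin: "Asup \<Psi> < top" "BS < top" using fin by simp_all
  show "S2 f \<le> KU p r * BS epowr r * nm f epowr (r / p)"
    by (rule S2_upper_sup[OF pr f fin(2)])
  show "S1 f \<le> KU p q epowr (r / q) * Asup \<Psi> epowr r * nm f epowr (r / p)"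
  proof (rule S1_upper_sup[OF _ f pr _ fin(1)])
    show "loc f k \<le> KU p q * \<Psi> k epowr q * nmk f k epowr (q / p)"
      if "f \<in> Mplus a b" "\<Psi> k < top" for f k
      using assms(1) that unfolding local_upper_def by blast
    fix k
    have "ennreal (2 powr (- real_of_int k / r)) * \<Psi> k \<le> Asup \<Psi>"
      unfolding Asup_def by (rule SUP_upper) simp
    then have "(ennreal (2 powr (- real_of_int k / r)) * \<Psi> k) epowr r \<le> Asup \<Psi> epowr r"
      using r by (intro epowr_mono) auto
    then show "E k * \<Psi> k epowr r \<le> Asup \<Psi> epowr r"
      using r by (simp add: epowr_mult powr_powr)
  qed
qed

lemma sup_lower:
  assumes "local_lower \<Psi>" and pr: "p \<le> r" and D: "D < top"
    and S1: "\<And>f. f \<in> Mplus a b \<Longrightarrow> nm f \<le> 1 \<Longrightarrow> S1 f \<le> D"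
    and S2: "\<And>f. f \<in> Mplus a b \<Longrightarrow> nm f \<le> 1 \<Longrightarrow> S2 f \<le> D"
  shows "(Asup \<Psi> + BS) epowr r \<le> Klow * D"
proof (rule le_Klow)
  show "BS epowr r \<le> KL p r * D" by (rule S2_lower_sup[OF pr S2])
  have kl0: "0 < kl p q" by (rule kl_pos)
  have "E k * \<Psi> k epowr r \<le> ennreal ((2 * kl p q) powr (r / q)) * D" for k
  proof -
    have "E k * \<Psi> k epowr r \<le> ennreal (kl p q) epowr (r / q) * D"
    proof (rule S1_lower_term[OF _ S1 D])
      fix B assume "B < top" "\<And>f. f \<in> Mplus (y (k - 1)) (y k) \<Longrightarrow> nmk f k \<le> 1 \<Longrightarrow> loc f k \<le> B"
      then show "\<Psi> k epowr q \<le> ennreal (kl p q) * B"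
        using assms(1) unfolding local_lower_def by blast
    qed
    also have "\<dots> \<le> ennreal (2 * kl p q) epowr (r / q) * D"
      using kl0 q r by (intro mult_right_mono epowr_mono ennreal_leI) auto
    finally show ?thesis using kl0 by simp
  qed
  moreover have "Asup \<Psi> epowr r = (SUP k. E k * \<Psi> k epowr r)"
    unfolding Asup_def epowr_SUP[OF r] using r by (simp add: epowr_mult powr_powr)
  ultimately show "Asup \<Psi> epowr r \<le> ennreal ((2 * kl p q) powr (r / q)) * D"
    by (simp only:) (rule SUP_least)
qed

lemma sum_upper:
  assumes "local_upper \<Psi>" and rp: "r < p" and f: "f \<in> Mplus a b" and fin: "Asum \<Psi> + BI' < top"
  shows "T f \<le> Kup * (Asum \<Psi> + BI') epowr r * nm f epowr (r / p)"
proof (rule T_le_of_S[OF f])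
  let ?A = "isum (\<lambda>k. (E k * \<Psi> k epowr r) epowr (p / (p - r)))"
  have e: "(p - r) / (p * r) * r = (p - r) / p" using r by simp
  have fin: "?A < top" "BI < top" using fin by (simp_all add: Asum_def BI'_def)
  show "S2 f \<le> KU p r * BI' epowr r * nm f epowr (r / p)"
    unfolding BI'_def epowr_epowr e by (rule S2_upper_sum[OF rp f fin(2)])
  show "S1 f \<le> KU p q epowr (r / q) * Asum \<Psi> epowr r * nm f epowr (r / p)"
    unfolding Asum_def epowr_epowr[of ?A] e
  proof (rule S1_upper_sum[OF _ f rp fin(1)])
    show "loc f k \<le> KU p q * \<Psi> k epowr q * nmk f k epowr (q / p)"
      if "f \<in> Mplus a b" "\<Psi> k < top" for f k
      using assms(1) that unfolding local_upper_def by blast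
  qed
qed

lemma sum_lower:
  assumes "local_lower \<Psi>" and rp: "r < p" and D: "D < top"
    and S1: "\<And>f. f \<in> Mplus a b \<Longrightarrow> nm f \<le> 1 \<Longrightarrow> S1 f \<le> D"
    and S2: "\<And>f. f \<in> Mplus a b \<Longrightarrow> nm f \<le> 1 \<Longrightarrow> S2 f \<le> D"
  shows "(Asum \<Psi> + BI') epowr r \<le> Klow * D"
proof (rule le_Klow)
  let ?A = "isum (\<lambda>k. (E k * \<Psi> k epowr r) epowr (p / (p - r)))"
  have e: "(p - r) / (p * r) * r = (p - r) / p" using r by simp
  show "BI' epowr r \<le> KL p r * D"
    unfolding BI'_def epowr_epowr e by (rule S2_lower_sum[OF rp D S2])
  show "Asum \<Psi> epowr r \<le> ennreal ((2 * kl p q) powr (r / q)) * D"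
    unfolding Asum_def epowr_epowr[of ?A] e
  proof (rule S1_lower_sum[OF _ kl_pos S1 D rp])
    fix k B assume "B < top" "\<And>f. f \<in> Mplus (y (k - 1)) (y k) \<Longrightarrow> nmk f k \<le> 1 \<Longrightarrow> loc f k \<le> B"
    then show "\<Psi> k epowr q \<le> ennreal (kl p q) * B"
      using assms(1) unfolding local_lower_def by blast
  qed
qed

lemma hardy_lhs_eq: "hardy_lhs q r a b u w f = T f epowr (1 / r)"
  by (simp add: hardy_lhs_def T_def inner_def)

text \<open>The summand 1, here and in \<open>L1\<close>, secures positivity. Both constants depend
  on the exponents, c and m alone, so they can be named before the weights and the sequence are
  given.\<close>

definition K2 :: real where
  "K2 = enn2real (Kup epowr (1 / r)) + 1"

definition L1 :: real where
  "L1 = enn2real ((Klow * (2 * (ennreal (2 * c) * of_nat m))) epowr (1 / r)) + 1"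

lemma K2_pos: "0 < K2" and L1_pos: "0 < L1"
  by (simp_all add: K2_def L1_def add_nonneg_pos)

lemma le_ennreal_enn2real: "X < top \<Longrightarrow> X \<le> ennreal (enn2real X + 1)"
  by (cases X) (auto simp: ennreal_leI)

lemma Kup_le: "Kup epowr (1 / r) \<le> ennreal K2"
  unfolding K2_def
  using KT_less_top KU_less_top[OF p q] KU_less_top[OF p r]
  by (intro le_ennreal_enn2real) (simp add: Kup_def ennreal_mult_less_top)

lemma Klow_le: "(Klow * (2 * (ennreal (2 * c) * of_nat m))) epowr (1 / r) \<le> ennreal L1"
  unfolding L1_def
  using KL_less_top[OF p r]
  by (intro le_ennreal_enn2real) (simp add: Klow_def ennreal_mult_less_top of_nat_less_top)

text \<open>The four cases differ only in X. Both hypotheses concern r-th powers; taking roots gives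
  a two-sided estimate of every admissible C, from which the finiteness criterion and the best
  constant are read off.\<close>

lemma characterization:
  assumes up: "\<And>f. f \<in> Mplus a b \<Longrightarrow> X < top \<Longrightarrow> T f \<le> Kup * X epowr r * nm f epowr (r / p)"
    and lo: "\<And>D. D < top \<Longrightarrow> (\<And>f. f \<in> Mplus a b \<Longrightarrow> nm f \<le> 1 \<Longrightarrow> S1 f \<le> D) \<Longrightarrow>
      (\<And>f. f \<in> Mplus a b \<Longrightarrow> nm f \<le> 1 \<Longrightarrow> S2 f \<le> D) \<Longrightarrow> X epowr r \<le> Klow * D"
  shows "((\<exists>C>0. hardy_ineq p q r a b u v w C) \<longleftrightarrow> X < \<infinity>) \<and>
    ennreal (1 / L1) * X \<le> best_const p q r a b u v w \<and>
    best_const p q r a b u v w \<le> ennreal K2 * X"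
proof -
  have upper: "hardy_ineq p q r a b u v w C" if X: "ennreal K2 * X \<le> ennreal C" and fin: "X < top" for C
    unfolding hardy_ineq_def
  proof
    fix f assume f: "f \<in> Mplus a b"
    have "hardy_lhs q r a b u w f \<le> (Kup * X epowr r * nm f epowr (r / p)) epowr (1 / r)"
      unfolding hardy_lhs_eq using r by (intro epowr_mono up[OF f fin]) auto
    also have "\<dots> = Kup epowr (1 / r) * X * nm f epowr (1 / p)"
      using r by (simp add: epowr_mult epowr_epowr)
    also have "\<dots> \<le> ennreal K2 * X * nm f epowr (1 / p)"
      by (intro mult_right_mono Kup_le) auto
    also have "\<dots> \<le> ennreal C * nm f epowr (1 / p)"
      by (intro mult_right_mono X) simp
    finally show "hardy_lhs q r a b u w f \<le> ennreal C * hardy_rhs p a b v f"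
      by (simp add: hardy_rhs_def)
  qed
  have lower: "X \<le> ennreal L1 * ennreal C" if C: "0 < C" and H: "hardy_ineq p q r a b u v w C" for C
  proof -
    let ?k = "ennreal (2 * c) * of_nat m"
    \<comment> \<open>The larger of the bounds from \<open>S1_le_T\<close> and
      \<open>S2_le_T\<close>, so that one number serves both sums.\<close>
    define D where "D = 2 * (?k * ennreal C epowr r)"
    have Tle: "T f \<le> ennreal C epowr r" if f: "f \<in> Mplus a b" "nm f \<le> 1" for f
    proof -
      have "hardy_lhs q r a b u w f \<le> ennreal C * hardy_rhs p a b v f"
        using H f by (simp add: hardy_ineq_def)
      also have "\<dots> \<le> ennreal C * 1"
        using f(2) p epowr_mono[of "nm f" 1 "1 / p"] by (intro mult_left_mono) (auto simp: hardy_rhs_def)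
      finally have "T f epowr (1 / r) \<le> ennreal C" by (simp add: hardy_lhs_eq)
      then have "(T f epowr (1 / r)) epowr r \<le> ennreal C epowr r"
        using r by (intro epowr_mono) auto
      then show ?thesis using r by simp
    qed
    have "X epowr r \<le> Klow * D"
    proof (rule lo)
      show "D < top" by (simp add: D_def ennreal_mult_less_top of_nat_less_top)
      fix f assume f: "f \<in> Mplus a b" "nm f \<le> 1"
      have k: "?k * T f \<le> ?k * ennreal C epowr r" by (intro mult_left_mono Tle f) simp
      have "S2 f \<le> 2 * (?k * T f)" by (rule S2_le_T)
      also have "\<dots> \<le> D" unfolding D_def by (intro mult_left_mono k) simp
      finally show "S2 f \<le> D" .
      have "1 * (?k * ennreal C epowr r) \<le> 2 * (?k * ennreal C epowr r)"
        by (intro mult_right_mono) simp_all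
      then have "?k * ennreal C epowr r \<le> D" by (simp only: mult_1_left D_def)
      with order_trans[OF S1_le_T k] show "S1 f \<le> D" by (rule order_trans)
    qed
    then have "X \<le> (Klow * D) epowr (1 / r)" by (simp only: epowr_le_iff_le_root[OF r])
    also have "Klow * D = (Klow * (2 * ?k)) * ennreal C epowr r"
      by (simp only: D_def mult_ac)
    also have "\<dots> epowr (1 / r) = (Klow * (2 * ?k)) epowr (1 / r) * ennreal C"
      using r by (simp only: epowr_mult[of "Klow * (2 * ?k)"] epowr_epowr) simp
    also have "\<dots> \<le> ennreal L1 * ennreal C" by (intro mult_right_mono Klow_le) simp
    finally show ?thesis .
  qed
  have fin_iff: "(\<exists>C>0. hardy_ineq p q r a b u v w C) \<longleftrightarrow> X < top"
  proof
    assume "\<exists>C>0. hardy_ineq p q r a b u v w C"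
    then obtain C where "0 < C" "hardy_ineq p q r a b u v w C" by blast
    from lower[OF this] show "X < top" by (rule le_less_trans) (simp add: ennreal_mult_less_top)
  next
    assume X: "X < top"
    then have "ennreal K2 * X \<le> ennreal (enn2real (ennreal K2 * X) + 1)"
      by (intro le_ennreal_enn2real) (simp add: ennreal_mult_less_top)
    from upper[OF this X] show "\<exists>C>0. hardy_ineq p q r a b u v w C"
      by (intro exI[of _ "enn2real (ennreal K2 * X) + 1"]) (simp add: add_nonneg_pos)
  qed
  have "ennreal (1 / L1) * X \<le> best_const p q r a b u v w"
    unfolding best_const_def
  proof (rule Inf_greatest)
    fix z assume "z \<in> {ennreal C |C. 0 < C \<and> hardy_ineq p q r a b u v w C}"
    then obtain C where C: "z = ennreal C" "0 < C" "hardy_ineq p q r a b u v w C" by blast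
    have "ennreal (1 / L1) * X \<le> ennreal (1 / L1) * (ennreal L1 * ennreal C)"
      by (intro mult_left_mono lower C) simp
    also have "\<dots> = ennreal C"
      using L1_pos C(2) by (simp add: ennreal_mult[symmetric])
    finally show "ennreal (1 / L1) * X \<le> z" by (simp only: C)
  qed
  moreover have "best_const p q r a b u v w \<le> ennreal K2 * X"
  proof (cases "X = top")
    case True
    then show ?thesis using K2_pos by (simp add: ennreal_mult_top)
  next
    case False
    then have X: "X < top" by (simp add: top.not_eq_extremum)
    show ?thesis
    \<comment> \<open>Comparing with z strictly above K2 X keeps the constant C positive even if X =
      0.\<close>
    proof (rule dense_ge)
      fix z assume z: "ennreal K2 * X < z"
      show "best_const p q r a b u v w \<le> z"
      proof (cases z)
        case (real C)
        have "0 < z" using z by (rule le_less_trans[OF zero_le])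
        then have "0 < C" using real by simp
        moreover have "hardy_ineq p q r a b u v w C"
          using z real by (intro upper[OF _ X]) simp
        ultimately have "z \<in> {ennreal C |C. 0 < C \<and> hardy_ineq p q r a b u v w C}"
          using real by blast
        then show ?thesis unfolding best_const_def by (rule Inf_lower)
      qed simp
    qed
  qed
  ultimately show ?thesis using fin_iff by simp
qed

end

text \<open>With the value \<open>a\<close> below \<open>N\<close> the additional cells are empty, so that all sums may run over \<open>\<int>\<close>.\<close>

definition extend :: "ereal \<Rightarrow> int option \<Rightarrow> (int \<Rightarrow> ereal) \<Rightarrow> int \<Rightarrow> ereal" where
  "extend a N x k = (if k \<in> indices N then x k else a)"

section \<open>From discretizing sequences to the extended sequence\<close>

lemma indices_mono: "i \<in> indices N \<Longrightarrow> i \<le> j \<Longrightarrow> j \<in> indices N"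
  by (cases N) (auto simp: indices_def)

lemma indices1_iff:
  "k \<in> indices1 N \<longleftrightarrow> k - 1 \<in> indices N"
  by (cases N) (auto simp: indices_def indices1_def)

text \<open>The condition on m makes the tail of w lose at least half of its lower bound within m
  steps. The second claim identifies \<open>indices1 N\<close> with the indices whose point lies
  above a.\<close>

lemma discretizing_imp_discretization:
  fixes x :: "int \<Rightarrow> ereal"
  assumes p: "1 \<le> p" "0 < q" "0 < r" "0 < c" and m: "2 * c\<^sup>2 \<le> 2 ^ m"
    and ab: "a < b" and u: "weight a b u" and v: "weight a b v" and w: "weight a b w"
    and d: "discretizing c a b w N x"
  shows "discretization p q r c m a b u v w (extend a N x)"
    and "\<And>k. a < extend a N x k \<longleftrightarrow> k \<in> indices1 N"
proof -
  let ?y = "extend a N x"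
  let ?W = "\<lambda>z. integ z b (\<lambda>s. ennreal (w s))"
  have rng: "a \<le> x k" "x k \<le> b" if "k \<in> indices N" for k
    using d that by (auto simp: discretizing_def)
  have W: "ennreal (inverse c * 2 powr - real_of_int k) \<le> ?W (x k)"
    "?W (x k) \<le> ennreal (c * 2 powr - real_of_int k)" if "k \<in> indices N" for k
    using d that by (auto simp: discretizing_def Wstar_def)
  have mono: "x i < x j" if "i \<in> indices N" "i < j" for i j
    using d that indices_mono[of i N j] by (auto simp: discretizing_def strict_mono_on_def)
  \<comment> \<open>At b the tail of w would be 0, but it is at least a positive multiple of
    2^(-k).\<close>
  have less: "x k < b" if k: "k \<in> indices N" for k
  proof (rule ccontr)
    assume "\<not> x k < b"
    then have "x k = b" using rng[OF k] by auto
    then have "ennreal (inverse c * 2 powr - real_of_int k) \<le> 0" using W(1)[OF k] by simp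
    then show False using p(4) by (simp add: ennreal_eq_0_iff mult_le_0_iff)
  qed
  have y_ge: "a \<le> ?y k" for k using rng by (simp add: extend_def)
  have y_less: "?y k < b" for k using less ab by (simp add: extend_def)
  have y_pos: "a < ?y k \<longleftrightarrow> k \<in> indices1 N" for k
  proof
    assume k: "k \<in> indices1 N"
    then have "x (k - 1) < x k" "a \<le> x (k - 1)" by (auto simp: indices1_iff intro: mono rng)
    moreover have "k \<in> indices N" using k indices_mono[of "k - 1" N k] by (simp add: indices1_iff)
    ultimately show "a < ?y k" by (auto simp: extend_def)
  next
    assume "a < ?y k"
    then show "k \<in> indices1 N"
    proof (cases N)
      case (Some n)
      then have "x n = a" using d by (simp add: discretizing_def)
      then show ?thesis using \<open>a < ?y k\<close> Some
        by (cases "k = n") (auto simp: extend_def indices_def indices1_def split: if_splits)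
    qed (simp add: indices1_def)
  qed
  then show "\<And>k. a < ?y k \<longleftrightarrow> k \<in> indices1 N" .
  have y_mono: "?y i \<le> ?y j" if "i \<le> j" for i j
  proof (cases "i \<in> indices N")
    case True
    then show ?thesis
      using that mono[of i j] indices_mono[of i N j] by (cases "i = j") (auto simp: extend_def)
  next
    case False
    then show ?thesis using y_ge[of j] by (simp add: extend_def)
  qed
  show "discretization p q r c m a b u v w ?y"
  proof
    show "?y i \<le> ?y j" if "i \<le> j" for i j by (rule y_mono[OF that])
    show "?y i < ?y j" if "i < j" "a < ?y j" for i j
      using that mono[of i j] indices_mono[of i N j] by (cases "i \<in> indices N") (auto simp: extend_def)
    show "\<exists>k. ?y k < ereal t" if t: "a < ereal t" for t
    proof (cases N)
      case None
      then have "(x \<longlongrightarrow> a) at_bot" using d by (simp add: discretizing_def)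
      then have "eventually (\<lambda>k. x k < ereal t) at_bot" using t by (rule order_tendstoD)
      then obtain k where "x k < ereal t" by (auto simp: eventually_at_bot_linorder)
      then show ?thesis using None by (intro exI[of _ k]) (simp add: extend_def indices_def)
    next
      case (Some n)
      then have "?y n = a" using d by (simp add: discretizing_def extend_def)
      then show ?thesis using t by (intro exI[of _ n]) simp
    qed
    \<comment> \<open>If the sequence stayed below t, the tail of w at t would be at most c 2^(-k)
      for all large k, hence 0; but w is positive on (t, b).\<close>
    show "\<exists>k. ereal t < ?y k" if t: "ereal t < b" for t
    proof (rule ccontr)
      assume "\<not> ?thesis"
      then have le: "?y k \<le> ereal t" for k by (simp add: not_less)
      have at: "a \<le> ereal t" using y_ge[of 0] le[of 0] by (rule order_trans)
      have pos: "0 < ?W (ereal t)"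
        using weight_mono[OF w at order_refl] t
        by (intro integ_pos weight_Mplus) (auto simp: weight_def)
      have bound: "?W (ereal t) \<le> ennreal (c * 2 powr - real_of_int k)" if k: "k \<in> indices N" for k
      proof -
        have "?W (ereal t) \<le> ?W (x k)"
          using le[of k] k by (intro integ_mono_interval) (simp_all add: extend_def)
        then show ?thesis using W(2)[OF k] by (rule order_trans)
      qed
      obtain n where n: "{n..} \<subseteq> indices N"
        by (cases N) (auto simp: indices_def)
      have "?W (ereal t) < top"
        by (rule le_less_trans[OF bound[of n]]) (use n in auto)
      then obtain \<omega> where \<omega>: "?W (ereal t) = ennreal \<omega>" "0 < \<omega>"
        using pos by (cases "?W (ereal t)") auto
      obtain j where j: "c / \<omega> < 2 ^ j" using real_arch_pow[of 2 "c / \<omega>"] by auto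
      define k where "k = max n (int j)"
      have "ennreal \<omega> \<le> ennreal (c * 2 powr - real_of_int k)"
        unfolding \<omega>(1)[symmetric] using n by (intro bound) (auto simp: k_def)
      then have "\<omega> \<le> c * 2 powr - real_of_int k" using p(4) by (simp add: ennreal_le_iff)
      also have "\<dots> \<le> c * 2 powr - real j"
        using p(4) by (intro mult_left_mono powr_mono) (auto simp: k_def)
      also have "\<dots> = c / 2 ^ j" by (simp add: powr_minus powr_realpow divide_inverse)
      finally show False using j \<omega>(2) p(4) by (simp add: field_simps)
    qed
    show "integ (?y (k - 1)) b (\<lambda>s. ennreal (w s)) \<le> ennreal (2 * c * 2 powr - real_of_int k)"
      if k: "a < ?y k" for k
    proof -
      have k1: "k - 1 \<in> indices N" using k by (simp only: y_pos indices1_iff)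
      have "2 powr - real_of_int (k - 1) = 2 * 2 powr - real_of_int k"
        using powr_add[of 2 1 "- real_of_int k"] by simp
      then show ?thesis using W(2)[OF k1] k1 by (simp add: extend_def mult_ac)
    qed
    show "ennreal (2 powr - real_of_int k) \<le>
        ennreal (2 * c) * integ (?y k) (?y (k + int m)) (\<lambda>s. ennreal (w s))" if k: "a < ?y k" for k
    proof -
      have k0: "k \<in> indices N"
        using k indices_mono[of "k - 1" N k] by (simp add: y_pos indices1_iff)
      then have km: "k + int m \<in> indices N" by (rule indices_mono) simp
      let ?Z = "integ (?y k) (?y (k + int m)) (\<lambda>s. ennreal (w s))"
      define e where "e = 2 powr - real_of_int k"
      have e: "0 < e" by (simp add: e_def)
      have split: "?W (?y k) = ?Z + ?W (?y (k + int m))"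
        using y_ge y_less y_mono
        by (intro integ_split Mplus_mono[OF weight_Mplus[OF w]]) (auto intro: less_imp_le)
      have lower: "ennreal (inverse c * e) \<le> ?W (?y k)" using W(1)[OF k0] k0 by (simp add: extend_def e_def)
      have "?W (?y (k + int m)) \<le> ennreal (c * (e / 2 ^ m))"
      proof -
        have "2 powr - real_of_int (k + int m) = e / 2 ^ m"
          by (simp add: e_def powr_diff powr_realpow powr_minus divide_inverse powr_add)
        then show ?thesis using W(2)[OF km] km by (simp add: extend_def)
      qed
      then have main: "ennreal (inverse c * e) \<le> ?Z + ennreal (c * (e / 2 ^ m))"
        using lower unfolding split by (rule order_trans[OF _ add_left_mono, rotated])
      show ?thesis
      proof (cases ?Z)
        case (real z)
        have "inverse c * e \<le> z + c * (e / 2 ^ m)"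
          using main real e p(4) by (simp add: ennreal_plus[symmetric] ennreal_le_iff del: ennreal_plus)
        then have "2 * c * (inverse c * e) \<le> 2 * c * (z + c * (e / 2 ^ m))"
          using p(4) by (intro mult_left_mono) auto
        \<comment> \<open>The choice of m: the tail beyond y (k + m) uses at most half of the lower
          bound e/c for the tail at y k.\<close>
        moreover have "2 * c * (c * (e / 2 ^ m)) \<le> e"
        proof -
          have "2 * c\<^sup>2 * e \<le> 2 ^ m * e" using m e by (intro mult_right_mono) auto
          then show ?thesis by (simp add: field_simps power2_eq_square)
        qed
        moreover have "2 * c * (inverse c * e) = 2 * e" using p(4) by simp
        ultimately have "e \<le> 2 * c * z" by (simp add: distrib_left)
        then show ?thesis
          using real p(4) by (simp add: e_def[symmetric] ennreal_mult[symmetric] ennreal_leI)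
      next
        case top
        then show ?thesis using p(4) by (simp add: ennreal_mult_top)
      qed
    qed
  qed (use p u v w y_ge y_less in auto)
qed

text \<open>Cells outside \<open>indices1 N\<close> are empty and contribute 0 to suprema and sums.
  For k in \<open>indices1 N\<close> both ends of the cell, and all later points, belong to the
  original sequence.\<close>

lemma (in discretization) conversion:
  assumes y: "y = extend a N x" and pos: "\<And>k. a < y k \<longleftrightarrow> k \<in> indices1 N"
  shows "A1 p q r u v N x = Asup \<Phi>" and "A3 p q r u v N x = Asup \<Theta>"
    and "r < p \<Longrightarrow> A2 p q r u v N x = Asum \<Phi>"
    and "r < p \<Longrightarrow> q < p \<Longrightarrow> A4 p q r u v N x = Asum \<Theta>"
    and "B1 p q r a u v N x = BS" and "B2 p q r a u v N x = BI'"
proof -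
  have xy: "x k = y k" "x (k - 1) = y (k - 1)" if "k \<in> indices1 N" for k
    using that indices_mono[of "k - 1" N k] by (auto simp: y extend_def indices1_iff)
  have up: "j \<in> indices1 N" if "k \<in> indices1 N" "k \<le> j" for k j
    using that indices_mono[of "k - 1" N "j - 1"] by (simp add: indices1_iff)
  have deg: "y (k - 1) = y k" if "k \<notin> indices1 N" for k
    using that pos[of k] y_ge[of "k - 1"] y_ge[of k] y_mono[of "k - 1" k] by auto
  have tail: "tail_sum q r u x k = ts k" if k: "k \<in> indices1 N" for k
    unfolding tail_sum_def infsum_eq_isum ts_def um_def
  proof (rule nn_integral_cong)
    fix i
    have "x i = y i \<and> x (i + 1) = y (i + 1)" if "k \<le> i"
      using xy(1)[OF up[OF k that]] xy(1)[OF up[OF k, of "i + 1"]] that by simp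
    then show "E i * integ (x i) (x (i + 1)) (\<lambda>s. ennreal (u s)) epowr (r / q) * indicator {k..} i =
        E i * integ (y i) (y (i + 1)) (\<lambda>s. ennreal (u s)) epowr (r / q) * indicator {k..} i"
      by (auto split: split_indicator)
  qed
  have um: "integ (x k) (x (k + 1)) (\<lambda>s. ennreal (u s)) = um k" if k: "k \<in> indices1 N" for k
    using xy(1)[OF k] xy(1)[OF up[OF k, of "k + 1"]] by (simp add: um_def)
  have S: "{k. a < y k} = indices1 N" using pos by auto
  show "A1 p q r u v N x = Asup \<Phi>"
  proof -
    have "A1 p q r u v N x = (SUP k\<in>indices1 N. ennreal (2 powr (- real_of_int k / r)) * \<Phi> k)"
      unfolding A1_def \<Phi>_def U_def by (intro SUP_cong refl) (simp add: xy)
    then show ?thesis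
      unfolding Asup_def by (subst SUP_zero_outside[of "indices1 N"]) (auto simp: deg \<Phi>_degenerate)
  qed
  show "A3 p q r u v N x = Asup \<Theta>"
  proof -
    have "A3 p q r u v N x = (SUP k\<in>indices1 N. ennreal (2 powr (- real_of_int k / r)) * \<Theta> k)"
      unfolding A3_def \<Theta>_def U_def by (intro SUP_cong refl) (simp add: xy)
    then show ?thesis
      unfolding Asup_def by (subst SUP_zero_outside[of "indices1 N"]) (auto simp: deg \<Theta>_degenerate)
  qed
  show "A2 p q r u v N x = Asum \<Phi>" if rp: "r < p"
    unfolding A2_def infsum_eq_isum Asum_def
  proof (rule arg_cong[where f="\<lambda>z. z epowr ((p - r) / (p * r))"], rule nn_integral_cong)
    fix k
    show "ennreal (2 powr (- real_of_int k * (p / (p - r)))) *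
        ess_sup (x (k - 1)) (x k) (\<lambda>t. integ (ereal t) (x k) (\<lambda>s. ennreal (u s)) epowr (p * r / (q * (p - r))) *
          V p v (x (k - 1)) (ereal t) epowr (p * r / (p - r))) * indicator (indices1 N) k =
        (E k * \<Phi> k epowr r) epowr (p / (p - r))"
    proof (cases "k \<in> indices1 N")
      case True
      then show ?thesis using \<Phi>_power[OF rp, of k] unfolding U_def xy[OF True] by simp
    next
      case False
      then show ?thesis by (simp add: \<Phi>_degenerate[OF deg])
    qed
  qed
  show "A4 p q r u v N x = Asum \<Theta>" if rp: "r < p" and qp: "q < p"
    unfolding A4_def infsum_eq_isum Asum_def
  proof (rule arg_cong[where f="\<lambda>z. z epowr ((p - r) / (p * r))"], rule nn_integral_cong)
    fix k
    show "ennreal (2 powr (- real_of_int k * (p / (p - r)))) *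
        integ (x (k - 1)) (x k) (\<lambda>t. integ (ereal t) (x k) (\<lambda>s. ennreal (u s)) epowr (q / (p - q)) * ennreal (u t) *
          V p v (x (k - 1)) (ereal t) epowr (p * q / (p - q))) epowr (r * (p - q) / (q * (p - r))) *
        indicator (indices1 N) k = (E k * \<Theta> k epowr r) epowr (p / (p - r))"
    proof (cases "k \<in> indices1 N")
      case True
      then show ?thesis using \<Theta>_power[OF rp qp, of k] unfolding U_def xy[OF True] by simp
    next
      case False
      then show ?thesis by (simp add: \<Theta>_degenerate[OF deg])
    qed
  qed
  show "B1 p q r a u v N x = BS"
    unfolding B1_def BS_def S by (intro SUP_cong refl) (simp add: tail xy)
  show "B2 p q r a u v N x = BI'"
    unfolding B2_def infsum_eq_isum BI'_def BI_def
  proof (rule arg_cong[where f="\<lambda>z. z epowr ((p - r) / (p * r))"], rule nn_integral_cong)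
    fix k
    show "E k * integ (x k) (x (k + 1)) (\<lambda>s. ennreal (u s)) epowr (r / q) *
        tail_sum q r u x k epowr (r / (p - r)) * V p v a (x k) epowr (p * r / (p - r)) *
        indicator (indices1 N) k =
      \<mu> k * ts k epowr (r / (p - r)) * V p v a (y k) epowr (p * r / (p - r))"
    proof (cases "k \<in> indices1 N")
      case True
      then show ?thesis unfolding um[OF True] tail[OF True] unfolding xy[OF True] by (simp add: \<mu>_def pos)
    next
      case False
      then show ?thesis by (simp add: \<mu>_def pos)
    qed
  qed
qed

text \<open>The order of quantifiers expresses the uniformity: K1 and K2 are fixed once the
  exponents and the constant c of the discretizing sequence are given, before the interval, the
  weights and the sequence.\<close>

theorem theorem3p6:
  fixes p q r c :: real
  assumes "1 \<le> p" and "0 < q" and "0 < r" and "0 < c"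
  shows "\<exists>K1>0. \<exists>K2>0.
    \<forall>(a::ereal) (b::ereal) (u::real \<Rightarrow> real) (v::real \<Rightarrow> real) (w::real \<Rightarrow> real)
      (N::int option) (x::int \<Rightarrow> ereal).
      a < b \<longrightarrow> weight a b u \<longrightarrow> weight a b v \<longrightarrow> weight a b w \<longrightarrow> discretizing c a b w N x \<longrightarrow>
      (p \<le> r \<and> p \<le> q \<longrightarrow>
        ((\<exists>C>0. hardy_ineq p q r a b u v w C) \<longleftrightarrow> A1 p q r u v N x + B1 p q r a u v N x < \<infinity>) \<and>
        ennreal K1 * (A1 p q r u v N x + B1 p q r a u v N x) \<le> best_const p q r a b u v w \<and>
        best_const p q r a b u v w \<le> ennreal K2 * (A1 p q r u v N x + B1 p q r a u v N x)) \<and>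
      (r < p \<and> p \<le> q \<longrightarrow>
        ((\<exists>C>0. hardy_ineq p q r a b u v w C) \<longleftrightarrow> A2 p q r u v N x + B2 p q r a u v N x < \<infinity>) \<and>
        ennreal K1 * (A2 p q r u v N x + B2 p q r a u v N x) \<le> best_const p q r a b u v w \<and>
        best_const p q r a b u v w \<le> ennreal K2 * (A2 p q r u v N x + B2 p q r a u v N x)) \<and>
      (q < p \<and> p \<le> r \<longrightarrow>
        ((\<exists>C>0. hardy_ineq p q r a b u v w C) \<longleftrightarrow> A3 p q r u v N x + B1 p q r a u v N x < \<infinity>) \<and>
        ennreal K1 * (A3 p q r u v N x + B1 p q r a u v N x) \<le> best_const p q r a b u v w \<and>
        best_const p q r a b u v w \<le> ennreal K2 * (A3 p q r u v N x + B1 p q r a u v N x)) \<and>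
      (r < p \<and> q < p \<longrightarrow>
        ((\<exists>C>0. hardy_ineq p q r a b u v w C) \<longleftrightarrow> A4 p q r u v N x + B2 p q r a u v N x < \<infinity>) \<and>
        ennreal K1 * (A4 p q r u v N x + B2 p q r a u v N x) \<le> best_const p q r a b u v w \<and>
        best_const p q r a b u v w \<le> ennreal K2 * (A4 p q r u v N x + B2 p q r a u v N x))"
proof -
  obtain m where "2 * c\<^sup>2 < 2 ^ m" using real_arch_pow[of 2 "2 * c\<^sup>2"] by auto
  then have m: "2 * c\<^sup>2 \<le> 2 ^ m" by simp
  \<comment> \<open>The locale constants have no other arguments than these, but their positivity is
    known only inside the locale, that is once weights and a sequence exist; hence the dummy value 1
    in \<open>K1\<close> and \<open>K2\<close>.\<close>
  define L where "L = discretization.L1 p q r c m"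
  define K1 where "K1 = (if 0 < L then 1 / L else 1)"
  define K where "K = discretization.K2 p q r c"
  define K2 where "K2 = (if 0 < K then K else 1)"
  define both where "both = (\<lambda>a b u v w X. ((\<exists>C>0. hardy_ineq p q r a b u v w C) \<longleftrightarrow> X < \<infinity>) \<and>
    ennreal K1 * X \<le> best_const p q r a b u v w \<and> best_const p q r a b u v w \<le> ennreal K2 * X)"
  have main: "(p \<le> r \<and> p \<le> q \<longrightarrow> both a b u v w (A1 p q r u v N x + B1 p q r a u v N x)) \<and>
      (r < p \<and> p \<le> q \<longrightarrow> both a b u v w (A2 p q r u v N x + B2 p q r a u v N x)) \<and>
      (q < p \<and> p \<le> r \<longrightarrow> both a b u v w (A3 p q r u v N x + B1 p q r a u v N x)) \<and>
      (r < p \<and> q < p \<longrightarrow> both a b u v w (A4 p q r u v N x + B2 p q r a u v N x))"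
    if "a < b" "weight a b u" "weight a b v" "weight a b w" "discretizing c a b w N x" for a b u v w N x
  proof -
    note D = discretizing_imp_discretization[OF assms m that]
    interpret D: discretization p q r c m a b u v w "extend a N x" by (rule D(1))
    have K: "K1 = 1 / D.L1" "K2 = D.K2"
      using D.L1_pos D.K2_pos by (simp_all add: K1_def K2_def L_def K_def)
    note conv = D.conversion[OF refl D(2)]
    show ?thesis
    proof (intro conjI impI; elim conjE)
      assume pr: "p \<le> r" "p \<le> q"
      show "both a b u v w (A1 p q r u v N x + B1 p q r a u v N x)"
        unfolding both_def K conv
        by (rule D.characterization[OF D.sup_upper[OF D.local_\<Phi>(1)[OF pr(2)] pr(1)]
              D.sup_lower[OF D.local_\<Phi>(2)[OF pr(2)] pr(1)]])
    next
      assume pr: "r < p" "p \<le> q"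
      show "both a b u v w (A2 p q r u v N x + B2 p q r a u v N x)"
        unfolding both_def K conv(3)[OF pr(1)] conv(6)
        by (rule D.characterization[OF D.sum_upper[OF D.local_\<Phi>(1)[OF pr(2)] pr(1)]
              D.sum_lower[OF D.local_\<Phi>(2)[OF pr(2)] pr(1)]])
    next
      assume pr: "q < p" "p \<le> r"
      show "both a b u v w (A3 p q r u v N x + B1 p q r a u v N x)"
        unfolding both_def K conv
        by (rule D.characterization[OF D.sup_upper[OF D.local_\<Theta>(1)[OF pr(1)] pr(2)]
              D.sup_lower[OF D.local_\<Theta>(2)[OF pr(1)] pr(2)]])
    next
      assume pr: "r < p" "q < p"
      show "both a b u v w (A4 p q r u v N x + B2 p q r a u v N x)"
        unfolding both_def K conv(4)[OF pr] conv(6)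
        by (rule D.characterization[OF D.sum_upper[OF D.local_\<Theta>(1)[OF pr(2)] pr(1)]
              D.sum_lower[OF D.local_\<Theta>(2)[OF pr(2)] pr(1)]])
    qed
  qed
  have "0 < K1" "0 < K2" by (simp_all add: K1_def K2_def)
  show ?thesis
  proof (rule exI[of _ K1], rule conjI[OF \<open>0 < K1\<close>], rule exI[of _ K2], rule conjI[OF \<open>0 < K2\<close>],
      intro allI, (rule impI)+, goal_cases)
    case (1 a b u v w N x)
    from main[OF this] show ?case unfolding both_def .
  qed
qed

end
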